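(* (In neutral constructive geometry, with intuitionistic logic.) Let $\mathrm{Perp}(x,L)$ be the ruler-and-compass construction defined in the context. For every point $x$ and line $L$, $\mathrm{Perp}(x,L)$ is defined, $\mathrm{Perp}(x,L)$ is perpendicular to $L$, and $x$ lies on $\mathrm{Perp}(x,L)$.
   Context: Logic is intuitionistic. Neutral constructive geometry means constructive plane geometry without any parallel postulate. Primitives: points, strict betweenness $B(a,b,c)$, segment congruence $ab=cd$; $T(a,b,c)$ abbreviates $\neg(a\neq b\wedge b\neq c\wedge\neg B(a,b,c))$. For $a\neq b$, a point $x$ lies on $\mathrm{Line}(a,b)$ iff $\neg\neg(B(a,b,x)\vee B(b,x,a)\vee B(x,a,b)\vee x=a\vee x=b)$; every line is given by two distinct points. Points are collinear if they lie on a common line. A circle is given by a center and a radius segment (possibly null). $ab\le cd$ means $\exists e\,(T(c,e,d)\wedge ab=ce)$. No particular axiomatization is prescribed; the principles used are: (1) Stability: $\neg\neg A\to A$ for $A$ an equality, betweenness or congruence. (2) $ab=ba$; $ab=pq\wedge ab=rs\to pq=rs$; $ab=cc\to a=b$. (3) Extension: if $a\neq b$ then for all $c,d$ there is $x$ with $T(a,b,x)$ and $bx=cd$. (4) Five-segment axiom: if $a\neq b$, $T(a,b,c)$, $T(a',b',c')$, $ab=a'b'$, $bc=b'c'$, $ad=a'd'$, $bd=b'd'$ then $cd=c'd'$. (5) $B(a,b,c)$ implies $B(c,b,a)$, $a\ne b$, $b\neq c$; $\neg B(a,b,a)$; $T(a,b,d)\wedge T(b,c,d)\to T(a,b,c)\wedge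 T(a,c,d)$; $T(a,b,c)\wedge T(b,c,d)\wedge b\neq c\to T(a,c,d)\wedge T(a,b,d)$; $B(a,b,c)\wedge B(a,b,d)\wedge\neg T(a,c,d)\to T(a,d,c)$. (6) Inner Pasch: if $a,b,c$ are not collinear, $B(a,p,c)$ and $B(b,q,c)$, there is $x$ with $B(p,x,b)$ and $B(q,x,a)$. (7) There are three non-collinear points; any three points each equidistant from two given distinct points are collinear. (8) Line-circle continuity: if $a\ne b$, $a$ is non-strictly inside a circle and $b$ non-strictly outside it, then the circle contains a point $x$ with $T(a,x,b)$. Circle-circle continuity: if two circles have distinct centers and the first has a point non-strictly inside and a point non-strictly outside the second, they have a common point. Line $K$ is perpendicular to line $L$ at $m$ if $m$ is on both, and there are a point $a\neq m$ on $K$ and points $b,c$ on $L$ with $B(b,m,c)$, $ab=ac$ and $bm=mc$; $K$ is perpendicular to $L$ if this holds for some $m$. Elementary constructions: $\mathrm{Line}(a,b)$ (defined if $a\neq b$); $\mathrm{Circle}(a,b)$, center $a$ through $b$; $\mathrm{Circle3}(a,b,c)$, center $a$ and radius $bc$ (always defined). $\mathrm{IntersectLineCircle1}(L,C)$ and $\mathrm{IntersectLineCircle2}(L,C)$ are the two intersection points of line $L=\mathrm{Line}(a,b)$ and circle $C$, in the same (non-strict) order on $L$ as $a,b$ (equal if $L$ is tangent to $C$; undefined if they do not meet). $\mathrm{IntersectCircles1}$, $\mathrm{IntersectCircles2}$ are the two intersection points of two circles (undefined if the circles coincide or do not meet), distinguished by handedness with respect to the centers. Definition of $\mathrm{Perp}(x,L)$,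 for $L=\mathrm{Line}(a,b)$: let $Q=\mathrm{Circle3}(b,x,a)$, $c=\mathrm{IntersectLineCircle2}(L,Q)$, $C=\mathrm{Circle3}(x,a,c)$, $p=\mathrm{IntersectLineCircle1}(L,C)$, $q=\mathrm{IntersectLineCircle2}(L,C)$, $K=\mathrm{Circle}(p,q)$, $R=\mathrm{Circle}(q,p)$, $d=\mathrm{IntersectCircles1}(K,R)$, $e=\mathrm{IntersectCircles2}(K,R)$; then $\mathrm{Perp}(x,L)=\mathrm{Line}(d,e)$. *)

theory Defs
  imports Main
begin

section \<open>Intuitionistic first-order logic\<close>

text \<open>
  HOL is classical, so the intuitionistic logic of the source is embedded deeply: the statement is
  about derivability in intuitionistic natural deduction, not about truth in HOL.
  Variables range over points and are de Bruijn indices; there are no function symbols, so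
  substitution is renaming. The partial constructions enter as definable graphs.
\<close>

type_synonym var = nat

datatype fm =
    Eq var var                (infix "\<^bold>=" 55)
  | Betw var var var
  | Cong var var var var
  | LeftTurn var var var
  | Falsum                    ("\<^bold>\<bottom>")
  | And fm fm                 (infixr "\<^bold>\<and>" 45)
  | Or fm fm                  (infixr "\<^bold>\<or>" 40)
  | Imp fm fm                 (infixr "\<^bold>\<longrightarrow>" 35)
  | Forall fm                 ("\<^bold>\<forall> _" [50] 50)
  | Exists fm                 ("\<^bold>\<exists> _" [50] 50)

abbreviation Neg :: "fm \<Rightarrow> fm" ("\<^bold>\<not> _" [50] 50) where
  "\<^bold>\<not> A \<equiv> A \<^bold>\<longrightarrow> \<^bold>\<bottom>"

abbreviation Neq :: "var \<Rightarrow> var \<Rightarrow> fm" (infix "\<^bold>\<noteq>" 55) where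
  "a \<^bold>\<noteq> b \<equiv> \<^bold>\<not> (a \<^bold>= b)"

definition lift :: "(var \<Rightarrow> var) \<Rightarrow> var \<Rightarrow> var" where
  "lift f = case_nat 0 (\<lambda>j. Suc (f j))"

primrec ren :: "(var \<Rightarrow> var) \<Rightarrow> fm \<Rightarrow> fm" where
  "ren f (a \<^bold>= b) = (f a \<^bold>= f b)"
| "ren f (Betw a b c) = Betw (f a) (f b) (f c)"
| "ren f (Cong a b c d) = Cong (f a) (f b) (f c) (f d)"
| "ren f (LeftTurn a b c) = LeftTurn (f a) (f b) (f c)"
| "ren f \<^bold>\<bottom> = \<^bold>\<bottom>"
| "ren f (A \<^bold>\<and> B) = (ren f A \<^bold>\<and> ren f B)"
| "ren f (A \<^bold>\<or> B) = (ren f A \<^bold>\<or> ren f B)"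
| "ren f (A \<^bold>\<longrightarrow> B) = (ren f A \<^bold>\<longrightarrow> ren f B)"
| "ren f (\<^bold>\<forall> A) = (\<^bold>\<forall> (ren (lift f) A))"
| "ren f (\<^bold>\<exists> A) = (\<^bold>\<exists> (ren (lift f) A))"

abbreviation shift :: "fm \<Rightarrow> fm" where
  "shift \<equiv> ren Suc"

definition inst :: "var \<Rightarrow> fm \<Rightarrow> fm" where
  "inst t = ren (case_nat t (\<lambda>j. j))"

text \<open>
  The members of \<open>Ax\<close> are read as universally closed: unlike the hypotheses \<open>G\<close> they are not shifted
  by the quantifier rules. This is adequate for sets \<open>Ax\<close> closed under renaming, as \<open>neutral_geometry\<close> is.
  There is no rule of excluded middle or double negation elimination.
\<close>

inductive derives :: "fm set \<Rightarrow> fm set \<Rightarrow> fm \<Rightarrow> bool" for Ax :: "fm set" where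
  axiom: "A \<in> Ax \<Longrightarrow> derives Ax G A"
| assumption: "A \<in> G \<Longrightarrow> derives Ax G A"
| FalsumE: "derives Ax G \<^bold>\<bottom> \<Longrightarrow> derives Ax G A"
| AndI: "derives Ax G A \<Longrightarrow> derives Ax G B \<Longrightarrow> derives Ax G (A \<^bold>\<and> B)"
| AndE1: "derives Ax G (A \<^bold>\<and> B) \<Longrightarrow> derives Ax G A"
| AndE2: "derives Ax G (A \<^bold>\<and> B) \<Longrightarrow> derives Ax G B"
| OrI1: "derives Ax G A \<Longrightarrow> derives Ax G (A \<^bold>\<or> B)"
| OrI2: "derives Ax G B \<Longrightarrow> derives Ax G (A \<^bold>\<or> B)"
| OrE: "derives Ax G (A \<^bold>\<or> B) \<Longrightarrow> derives Ax (insert A G) C \<Longrightarrow> derives Ax (insert B G) C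
        \<Longrightarrow> derives Ax G C"
| ImpI: "derives Ax (insert A G) B \<Longrightarrow> derives Ax G (A \<^bold>\<longrightarrow> B)"
| ImpE: "derives Ax G (A \<^bold>\<longrightarrow> B) \<Longrightarrow> derives Ax G A \<Longrightarrow> derives Ax G B"
| ForallI: "derives Ax (shift ` G) A \<Longrightarrow> derives Ax G (\<^bold>\<forall> A)"
| ForallE: "derives Ax G (\<^bold>\<forall> A) \<Longrightarrow> derives Ax G (inst t A)"
| ExistsI: "derives Ax G (inst t A) \<Longrightarrow> derives Ax G (\<^bold>\<exists> A)"
| ExistsE: "derives Ax G (\<^bold>\<exists> A) \<Longrightarrow> derives Ax (insert A (shift ` G)) (shift C) \<Longrightarrow> derives Ax G C"
| EqI: "derives Ax G (a \<^bold>= a)"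
| EqE: "derives Ax G (a \<^bold>= b) \<Longrightarrow> derives Ax G (inst a A) \<Longrightarrow> derives Ax G (inst b A)"


section \<open>Geometric notions\<close>

text \<open>
  A formula-valued function below takes variables as arguments; under \<open>n\<close> quantifiers an argument
  \<open>a\<close> appears as \<open>a + n\<close>, and the bound variables are \<open>n - 1\<close> (outermost), \<dots>, \<open>0\<close> (innermost).
\<close>

definition T :: "var \<Rightarrow> var \<Rightarrow> var \<Rightarrow> fm" where
  "T a b c = (\<^bold>\<not> (a \<^bold>\<noteq> b \<^bold>\<and> b \<^bold>\<noteq> c \<^bold>\<and> \<^bold>\<not> Betw a b c))"

text \<open>\<open>on_line a b x\<close>: the point \<open>x\<close> lies on \<open>Line(a,b)\<close>; only used for \<open>a \<noteq> b\<close>.\<close>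

definition on_line :: "var \<Rightarrow> var \<Rightarrow> var \<Rightarrow> fm" where
  "on_line a b x =
     (\<^bold>\<not> \<^bold>\<not> (Betw a b x \<^bold>\<or> Betw b x a \<^bold>\<or> Betw x a b \<^bold>\<or> x \<^bold>= a \<^bold>\<or> x \<^bold>= b))"

definition collinear :: "var \<Rightarrow> var \<Rightarrow> var \<Rightarrow> fm" where
  "collinear a b c =
     (\<^bold>\<exists> \<^bold>\<exists> (1 \<^bold>\<noteq> 0 \<^bold>\<and> on_line 1 0 (a+2) \<^bold>\<and> on_line 1 0 (b+2) \<^bold>\<and> on_line 1 0 (c+2)))"

text \<open>\<open>ab \<le> cd\<close>\<close>

definition seg_le :: "var \<Rightarrow> var \<Rightarrow> var \<Rightarrow> var \<Rightarrow> fm" where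
  "seg_le a b c d = (\<^bold>\<exists> (T (c+1) 0 (d+1) \<^bold>\<and> Cong (a+1) (b+1) (c+1) 0))"

text \<open>
  \<open>Line(k,k')\<close> is perpendicular to \<open>Line(l,l')\<close> at \<open>m\<close>. The three bound points \<open>2, 1, 0\<close> are
  \<open>a\<close> on the first line and \<open>b, c\<close> on the second.
\<close>

definition perpendicular_at :: "var \<Rightarrow> var \<Rightarrow> var \<Rightarrow> var \<Rightarrow> var \<Rightarrow> fm" where
  "perpendicular_at k k' l l' m =
     (on_line k k' m \<^bold>\<and> on_line l l' m \<^bold>\<and>
      (\<^bold>\<exists> \<^bold>\<exists> \<^bold>\<exists> (let k = k+3; k' = k'+3; l = l+3; l' = l'+3; m = m+3; a = 2; b = 1; c = 0 in
         a \<^bold>\<noteq> m \<^bold>\<and> on_line k k' a \<^bold>\<and> on_line l l' b \<^bold>\<and> on_line l l' c \<^bold>\<and>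
         Betw b m c \<^bold>\<and> Cong a b a c \<^bold>\<and> Cong b m m c)))"

definition perpendicular :: "var \<Rightarrow> var \<Rightarrow> var \<Rightarrow> var \<Rightarrow> fm" where
  "perpendicular k k' l l' = (\<^bold>\<exists> (perpendicular_at (k+1) (k'+1) (l+1) (l'+1) 0))"


section \<open>Elementary constructions\<close>

text \<open>A triple \<open>u r s\<close> of arguments stands for \<open>Circle3(u,r,s)\<close>; \<open>Circle(a,b)\<close> is \<open>Circle3(a,a,b)\<close>.\<close>

definition on_circle :: "var \<Rightarrow> var \<Rightarrow> var \<Rightarrow> var \<Rightarrow> fm" where
  "on_circle u r s x = Cong u x r s"

definition inside_circle :: "var \<Rightarrow> var \<Rightarrow> var \<Rightarrow> var \<Rightarrow> fm" where
  "inside_circle u r s x = seg_le u x r s"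

definition outside_circle :: "var \<Rightarrow> var \<Rightarrow> var \<Rightarrow> var \<Rightarrow> fm" where
  "outside_circle u r s x = seg_le r s u x"

definition circles_coincide :: "var \<Rightarrow> var \<Rightarrow> var \<Rightarrow> var \<Rightarrow> var \<Rightarrow> var \<Rightarrow> fm" where
  "circles_coincide u r s v r' s' = (u \<^bold>= v \<^bold>\<and> Cong r s r' s')"

text \<open>
  For \<open>a \<noteq> b\<close> and \<open>p, q\<close> on \<open>Line(a,b)\<close>: \<open>q\<close> does not come strictly before \<open>p\<close> in the order of the
  line in which \<open>a\<close> comes before \<open>b\<close>. If \<open>p\<close> comes strictly before \<open>b\<close>, this says that \<open>p\<close> is not
  between \<open>q\<close> and \<open>b\<close>; otherwise \<open>a\<close> comes strictly before \<open>p\<close>, and it says \<open>T(a,p,q)\<close>.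
\<close>

definition same_order :: "var \<Rightarrow> var \<Rightarrow> var \<Rightarrow> var \<Rightarrow> fm" where
  "same_order a b p q =
     ((\<^bold>\<not> T a b p \<^bold>\<longrightarrow> \<^bold>\<not> Betw q p b) \<^bold>\<and> (T a b p \<^bold>\<longrightarrow> T a p q))"

text \<open>\<open>p\<close> and \<open>q\<close> are the two (possibly equal) intersection points, in this order.\<close>

definition line_circle_points ::
  "var \<Rightarrow> var \<Rightarrow> var \<Rightarrow> var \<Rightarrow> var \<Rightarrow> var \<Rightarrow> var \<Rightarrow> fm" where
  "line_circle_points a b u r s p q =
     (a \<^bold>\<noteq> b \<^bold>\<and>
      on_line a b p \<^bold>\<and> on_circle u r s p \<^bold>\<and> on_line a b q \<^bold>\<and> on_circle u r s q \<^bold>\<and>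
      (\<^bold>\<forall> (on_line (a+1) (b+1) 0 \<^bold>\<and> on_circle (u+1) (r+1) (s+1) 0 \<^bold>\<longrightarrow>
          \<^bold>\<not> \<^bold>\<not> (0 \<^bold>= p+1 \<^bold>\<or> 0 \<^bold>= q+1))) \<^bold>\<and>
      same_order a b p q)"

text \<open>
  Graphs of the partial constructions: the last argument is the value, and a construction is
  defined if it has a value.
\<close>

definition IntersectLineCircle1 :: "var \<Rightarrow> var \<Rightarrow> var \<Rightarrow> var \<Rightarrow> var \<Rightarrow> var \<Rightarrow> fm" where
  "IntersectLineCircle1 a b u r s p =
     (\<^bold>\<exists> (line_circle_points (a+1) (b+1) (u+1) (r+1) (s+1) (p+1) 0))"

definition IntersectLineCircle2 :: "var \<Rightarrow> var \<Rightarrow> var \<Rightarrow> var \<Rightarrow> var \<Rightarrow> var \<Rightarrow> fm" where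
  "IntersectLineCircle2 a b u r s q =
     (\<^bold>\<exists> (line_circle_points (a+1) (b+1) (u+1) (r+1) (s+1) 0 (q+1)))"

text \<open>
  Two distinct circles meet in points that are mirror images in the line of centers: either one
  point on each side or one point on that line. Hence the first (second) point is the common point
  that is not strictly to the right (left) of the ray from the first center to the second.
  \<open>LeftTurn v u y\<close> says that \<open>u v y\<close> is a right turn.
\<close>

definition IntersectCircles1 :: "var \<Rightarrow> var \<Rightarrow> var \<Rightarrow> var \<Rightarrow> var \<Rightarrow> var \<Rightarrow> var \<Rightarrow> fm" where
  "IntersectCircles1 u r s v r' s' y =
     (\<^bold>\<not> circles_coincide u r s v r' s' \<^bold>\<and>
      on_circle u r s y \<^bold>\<and> on_circle v r' s' y \<^bold>\<and> \<^bold>\<not> LeftTurn v u y)"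

definition IntersectCircles2 :: "var \<Rightarrow> var \<Rightarrow> var \<Rightarrow> var \<Rightarrow> var \<Rightarrow> var \<Rightarrow> var \<Rightarrow> fm" where
  "IntersectCircles2 u r s v r' s' y =
     (\<^bold>\<not> circles_coincide u r s v r' s' \<^bold>\<and>
      on_circle u r s y \<^bold>\<and> on_circle v r' s' y \<^bold>\<and> \<^bold>\<not> LeftTurn u v y)"

text \<open>
  \<open>Perp x a b d e\<close>: the construction \<open>Perp(x,L)\<close>, for \<open>L = Line(a,b)\<close>, yields \<open>Line(d,e)\<close>.
  Since \<open>Line(d,e)\<close> is defined only for distinct points, this includes \<open>d \<noteq> e\<close>.
\<close>

definition Perp :: "var \<Rightarrow> var \<Rightarrow> var \<Rightarrow> var \<Rightarrow> var \<Rightarrow> fm" where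
  "Perp x a b d e =
     (\<^bold>\<exists> \<^bold>\<exists> \<^bold>\<exists> (let x = x+3; a = a+3; b = b+3; d = d+3; e = e+3; c = 2; p = 1; q = 0 in
        IntersectLineCircle2 a b b x a c \<^bold>\<and>
        IntersectLineCircle1 a b x a c p \<^bold>\<and>
        IntersectLineCircle2 a b x a c q \<^bold>\<and>
        IntersectCircles1 p p q q q p d \<^bold>\<and>
        IntersectCircles2 p p q q q p e \<^bold>\<and>
        d \<^bold>\<noteq> e))"


section \<open>Axioms\<close>

inductive_set neutral_axioms :: "fm set" where
  stable_eq: "(\<^bold>\<not> \<^bold>\<not> (a \<^bold>= b) \<^bold>\<longrightarrow> a \<^bold>= b) \<in> neutral_axioms"
| stable_Betw: "(\<^bold>\<not> \<^bold>\<not> Betw a b c \<^bold>\<longrightarrow> Betw a b c) \<in> neutral_axioms"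
| stable_Cong: "(\<^bold>\<not> \<^bold>\<not> Cong a b c d \<^bold>\<longrightarrow> Cong a b c d) \<in> neutral_axioms"
| cong_swap: "(Cong a b b a) \<in> neutral_axioms"
| cong_trans: "(Cong a b p q \<^bold>\<and> Cong a b r s \<^bold>\<longrightarrow> Cong p q r s) \<in> neutral_axioms"
| cong_null: "(Cong a b c c \<^bold>\<longrightarrow> a \<^bold>= b) \<in> neutral_axioms"
| extension:
    "(a \<^bold>\<noteq> b \<^bold>\<longrightarrow> (\<^bold>\<exists> (T (a+1) (b+1) 0 \<^bold>\<and> Cong (b+1) 0 (c+1) (d+1)))) \<in> neutral_axioms"
| five_segment:
    "(a \<^bold>\<noteq> b \<^bold>\<and> T a b c \<^bold>\<and> T a' b' c' \<^bold>\<and> Cong a b a' b' \<^bold>\<and> Cong b c b' c' \<^bold>\<and>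
     Cong a d a' d' \<^bold>\<and> Cong b d b' d' \<^bold>\<longrightarrow> Cong c d c' d') \<in> neutral_axioms"
| betw_sym: "(Betw a b c \<^bold>\<longrightarrow> Betw c b a \<^bold>\<and> a \<^bold>\<noteq> b \<^bold>\<and> b \<^bold>\<noteq> c) \<in> neutral_axioms"
| betw_identity: "(\<^bold>\<not> Betw a b a) \<in> neutral_axioms"
| inner_transitivity: "(T a b d \<^bold>\<and> T b c d \<^bold>\<longrightarrow> T a b c \<^bold>\<and> T a c d) \<in> neutral_axioms"
| outer_transitivity:
    "(T a b c \<^bold>\<and> T b c d \<^bold>\<and> b \<^bold>\<noteq> c \<^bold>\<longrightarrow> T a c d \<^bold>\<and> T a b d) \<in> neutral_axioms"
| connectivity:
    "(Betw a b c \<^bold>\<and> Betw a b d \<^bold>\<and> \<^bold>\<not> T a c d \<^bold>\<longrightarrow> T a d c) \<in> neutral_axioms"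
| inner_Pasch:
    "(\<^bold>\<not> collinear a b c \<^bold>\<and> Betw a p c \<^bold>\<and> Betw b q c \<^bold>\<longrightarrow>
     (\<^bold>\<exists> (Betw (p+1) 0 (b+1) \<^bold>\<and> Betw (q+1) 0 (a+1)))) \<in> neutral_axioms"
| lower_dimension: "(\<^bold>\<exists> \<^bold>\<exists> \<^bold>\<exists> \<^bold>\<not> collinear 2 1 0) \<in> neutral_axioms"
| upper_dimension:
    "(a \<^bold>\<noteq> b \<^bold>\<and> Cong p a p b \<^bold>\<and> Cong q a q b \<^bold>\<and> Cong r a r b \<^bold>\<longrightarrow> collinear p q r) \<in> neutral_axioms"
| line_circle_continuity:
    "(a \<^bold>\<noteq> b \<^bold>\<and> inside_circle u r s a \<^bold>\<and> outside_circle u r s b \<^bold>\<longrightarrow>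
     (\<^bold>\<exists> (on_circle (u+1) (r+1) (s+1) 0 \<^bold>\<and> T (a+1) 0 (b+1)))) \<in> neutral_axioms"
| circle_circle_continuity:
    "(u \<^bold>\<noteq> v \<^bold>\<and>
     on_circle u r s y \<^bold>\<and> inside_circle v r' s' y \<^bold>\<and>
     on_circle u r s z \<^bold>\<and> outside_circle v r' s' z \<^bold>\<longrightarrow>
     (\<^bold>\<exists> (on_circle (u+1) (r+1) (s+1) 0 \<^bold>\<and> on_circle (v+1) (r'+1) (s'+1) 0))) \<in> neutral_axioms"

text \<open>
  Handedness cannot be defined from betweenness and congruence alone, since reflections preserve
  both. It is therefore a primitive relation, axiomatized as an orientation of the plane.
  The last axiom gives the domain of definition of the circle-circle intersection constructions:
  both are defined when the circles do not coincide and meet.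
\<close>

inductive_set handedness_axioms :: "fm set" where
  turn_asym: "(LeftTurn a b c \<^bold>\<longrightarrow> \<^bold>\<not> LeftTurn b a c) \<in> handedness_axioms"
| turn_noncollinear: "(LeftTurn a b c \<^bold>\<longrightarrow> \<^bold>\<not> collinear a b c) \<in> handedness_axioms"
| turn_total:
    "(\<^bold>\<not> collinear a b c \<^bold>\<longrightarrow> \<^bold>\<not> (\<^bold>\<not> LeftTurn a b c \<^bold>\<and> \<^bold>\<not> LeftTurn b a c)) \<in> handedness_axioms"
| turn_cyclic: "(LeftTurn a b c \<^bold>\<longrightarrow> LeftTurn b c a) \<in> handedness_axioms"
| turn_opposite_sides:
    "(LeftTurn a b c \<^bold>\<and> on_line a b y \<^bold>\<and> Betw c y d \<^bold>\<longrightarrow> LeftTurn b a d) \<in> handedness_axioms"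
| IntersectCircles_defined:
    "(\<^bold>\<not> circles_coincide u r s v r' s' \<^bold>\<and> on_circle u r s y \<^bold>\<and> on_circle v r' s' y \<^bold>\<longrightarrow>
     (\<^bold>\<exists> (IntersectCircles1 (u+1) (r+1) (s+1) (v+1) (r'+1) (s'+1) 0)) \<^bold>\<and>
     (\<^bold>\<exists> (IntersectCircles2 (u+1) (r+1) (s+1) (v+1) (r'+1) (s'+1) 0))) \<in> handedness_axioms"

definition neutral_geometry :: "fm set" where
  "neutral_geometry = neutral_axioms \<union> handedness_axioms"

lemma lift_0 [simp]: "lift f 0 = 0" and lift_Suc [simp]: "lift f (Suc n) = Suc (f n)"
  by (simp_all add: lift_def)

named_theorems ren_geo

lemma ren_T [ren_geo]: "ren f (T a b c) = T (f a) (f b) (f c)"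
  by (simp add: T_def)

lemma ren_on_line [ren_geo]: "ren f (on_line a b x) = on_line (f a) (f b) (f x)"
  by (simp add: on_line_def)

lemma ren_collinear [ren_geo]: "ren f (collinear a b c) = collinear (f a) (f b) (f c)"
  by (simp add: collinear_def ren_geo)

lemma ren_seg_le [ren_geo]: "ren f (seg_le a b c d) = seg_le (f a) (f b) (f c) (f d)"
  by (simp add: seg_le_def ren_geo)

lemma ren_on_circle [ren_geo]:
  "ren f (on_circle u r s x) = on_circle (f u) (f r) (f s) (f x)"
  "ren f (inside_circle u r s x) = inside_circle (f u) (f r) (f s) (f x)"
  "ren f (outside_circle u r s x) = outside_circle (f u) (f r) (f s) (f x)"
  by (simp_all add: on_circle_def inside_circle_def outside_circle_def ren_geo)

lemma ren_IntersectCircles [ren_geo]: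
  "ren f (circles_coincide u r s v r' s') = circles_coincide (f u) (f r) (f s) (f v) (f r') (f s')"
  "ren f (IntersectCircles1 u r s v r' s' y) =
     IntersectCircles1 (f u) (f r) (f s) (f v) (f r') (f s') (f y)"
  "ren f (IntersectCircles2 u r s v r' s' y) =
     IntersectCircles2 (f u) (f r) (f s) (f v) (f r') (f s') (f y)"
  by (simp_all add: circles_coincide_def IntersectCircles1_def IntersectCircles2_def ren_geo)

lemma ren_perpendicular [ren_geo]:
  "ren f (perpendicular k k' l l') = perpendicular (f k) (f k') (f l) (f l')"
  by (simp add: perpendicular_def perpendicular_at_def ren_geo numeral_2_eq_2 numeral_3_eq_3)

lemma ren_IntersectLineCircle [ren_geo]:
  "ren f (IntersectLineCircle1 a b u r s p) = IntersectLineCircle1 (f a) (f b) (f u) (f r) (f s) (f p)"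
  "ren f (IntersectLineCircle2 a b u r s p) = IntersectLineCircle2 (f a) (f b) (f u) (f r) (f s) (f p)"
  by (simp_all add: IntersectLineCircle1_def IntersectLineCircle2_def line_circle_points_def
      same_order_def ren_geo)

lemma ren_Perp [ren_geo]: "ren f (Perp x a b d e) = Perp (f x) (f a) (f b) (f d) (f e)"
  by (simp add: Perp_def ren_geo numeral_2_eq_2 numeral_3_eq_3)

text \<open>This justifies reading the axioms as universally closed.\<close>

lemma ren_neutral_geometry: "A \<in> neutral_geometry \<Longrightarrow> ren f A \<in> neutral_geometry"
proof -
  have "ren f A \<in> neutral_axioms" if "A \<in> neutral_axioms"
    using that by cases
      (simp add: ren_geo numeral_2_eq_2;
       rule neutral_axioms.intros
         [simplified numeral_2_eq_2 add_Suc_right add_0_right One_nat_def])+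
  moreover have "ren f A \<in> handedness_axioms" if "A \<in> handedness_axioms"
    using that by cases
      (simp add: ren_geo;
       rule handedness_axioms.intros[simplified add_Suc_right add_0_right One_nat_def])+
  ultimately show "A \<in> neutral_geometry \<Longrightarrow> ren f A \<in> neutral_geometry"
    by (auto simp: neutral_geometry_def)
qed

end

theory Submission
  imports Defs "HOL-Library.Countable" "HOL-Library.Infinite_Set"
begin

text \<open>
  The theorem asserts derivability in an intuitionistic calculus, and its proof separates the points that
  must be constructed from the facts about them.

  Equality, betweenness and congruence are stable, hence so is every formula built from them with
  conjunction, implication and universal quantification: \<open>T\<close>, \<open>on_line\<close>, and the statement that two points
  are the ordered intersections of a line with a circle. For such conclusions classical reasoning is
  conservative (\<open>classical_transfer\<close>). If a stable \<open>F\<close> is not derivable, then \<open>\<not>F\<close> is consistent with the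
  hypotheses, and Henkin's construction gives a classical model of the axioms in which \<open>F\<close> fails. The
  construction works over intuitionistic logic because the universal quantifiers that occur have stable
  bodies, so that a refuted universal statement has a refutable instance. Therefore each stable fact may be
  proved as an ordinary theorem of HOL about the classical structures of locale \<open>plane\<close>.

  What remains for the calculus is to introduce the points, and each is given by an axiom whose
  premises are stable or are inequalities of segments; the latter can be reduced to stable facts
  (\<open>use_seg_le\<close>). Let \<open>ac = ab + xa\<close> as in the construction. The circle about \<open>x\<close> with radius \<open>ac\<close> has \<open>a\<close>
  strictly inside, and the points of the line at distance \<open>ac + xa\<close> from \<open>a\<close> outside, so the line meets it
  in distinct points \<open>p\<close> and \<open>q\<close> on either side of \<open>a\<close>, with no case distinction on whether \<open>x\<close> is on the
  line. The points \<open>d\<close> and \<open>e\<close> complete equilateral triangles on \<open>pq\<close> and differ in handedness. The points \<open>x\<close>,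
  \<open>d\<close>, \<open>e\<close> and the midpoint \<open>m\<close> of \<open>pq\<close> are equidistant from \<open>p\<close> and \<open>q\<close>, so by the upper dimension axiom
  they are collinear. The point \<open>m\<close> itself is obtained from the triangle \<open>d p q\<close> by applying inner Pasch twice.

  The classical facts used are that a line meets a circle at most twice, which follows from the
  uniqueness of perpendiculars (\<open>two_right_angles\<close>), and the triangle inequality. The latter rests
  on the comparison of a leg with the hypotenuse (\<open>right_triangle_crossing\<close>). Feet of perpendiculars are
  cheap, because the two handed intersections of circles provide mirror images (\<open>mirror_point\<close>), and the
  orientation replaces outer Pasch in the one place where sides of a line matter (\<open>feet_separated\<close>).
\<close>

section \<open>Renaming and fresh variables\<close>

lemma lift_comp: "lift f \<circ> lift g = lift (f \<circ> g)"
  by (rule ext) (simp add: lift_def split: nat.splits)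

lemma ren_ren: "ren f (ren g A) = ren (f \<circ> g) A"
  by (induction A arbitrary: f g) (simp_all add: lift_comp)

lemma lift_id: "lift (\<lambda>j. j) = (\<lambda>j. j)"
  by (rule ext) (simp add: lift_def split: nat.splits)

lemma ren_id: "ren (\<lambda>j. j) A = A"
  by (induction A) (simp_all add: lift_id)

lemma ren_lift_shift: "ren (lift f) (shift A) = shift (ren f A)"
  by (simp add: ren_ren comp_def)

lemma ren_inst: "ren f (inst t A) = inst (f t) (ren (lift f) A)"
proof -
  have "f \<circ> case_nat t (\<lambda>j. j) = case_nat (f t) (\<lambda>j. j) \<circ> lift f"
    by (rule ext) (simp split: nat.splits)
  then show ?thesis by (simp add: inst_def ren_ren)
qed

lemma inst_lift: "inst t (ren (lift f) A) = ren (case_nat t f) A"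
proof -
  have "case_nat t (\<lambda>j. j) \<circ> lift f = case_nat t f"
    by (rule ext) (simp split: nat.splits)
  then show ?thesis by (simp add: inst_def ren_ren)
qed

lemma derives_mono: "derives Ax G A \<Longrightarrow> G \<subseteq> H \<Longrightarrow> derives Ax H A"
proof (induction G A arbitrary: H rule: derives.induct)
  case (OrE G A B C)
  then show ?case by (meson derives.OrE insert_mono)
next
  case (ImpI A G B)
  then show ?case by (meson derives.ImpI insert_mono)
next
  case (ForallI G A)
  then show ?case by (meson derives.ForallI image_mono)
next
  case (ExistsE G A C)
  then show ?case by (meson derives.ExistsE image_mono insert_mono)
qed (blast intro: derives.intros)+

lemma derives_ren:
  assumes Ax: "\<And>f A. A \<in> Ax \<Longrightarrow> ren f A \<in> Ax"
  shows "derives Ax G A \<Longrightarrow> derives Ax (ren f ` G) (ren f A)"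
proof (induction G A arbitrary: f rule: derives.induct)
  case (OrE G A B C)
  then show ?case using derives.OrE[of Ax "ren f ` G" "ren f A" "ren f B" "ren f C"] by simp
next
  case (ForallI G A)
  from ForallI.IH[of "lift f"] have "derives Ax (shift ` ren f ` G) (ren (lift f) A)"
    by (simp add: image_image ren_lift_shift)
  then show ?case by (simp add: derives.ForallI)
next
  case (ForallE G A t)
  then show ?case using derives.ForallE[of Ax "ren f ` G" "ren (lift f) A" "f t"] by (simp add: ren_inst)
next
  case (ExistsI G t A)
  then show ?case using derives.ExistsI[of Ax "ren f ` G" "f t" "ren (lift f) A"] by (simp add: ren_inst)
next
  case (ExistsE G A C)
  from ExistsE.IH(2)[of "lift f"]
  have "derives Ax (insert (ren (lift f) A) (shift ` ren f ` G)) (shift (ren f C))"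
    by (simp add: image_image ren_lift_shift)
  then show ?case using ExistsE.IH(1)[of f] by (simp add: derives.ExistsE)
next
  case (EqE G a b A)
  then show ?case
    using derives.EqE[of Ax "ren f ` G" "f a" "f b" "ren (lift f) A"] by (simp add: ren_inst)
qed (auto intro: derives.intros Ax)

text \<open>
  A derivation uses finitely many hypotheses. This makes unions of chains of consistent sets
  consistent.
\<close>

lemma derives_finite_support:
  "derives Ax G A \<Longrightarrow> \<exists>F. finite F \<and> F \<subseteq> G \<and> derives Ax F A"
proof (induction G A rule: derives.induct)
  case (assumption A G)
  then show ?case by (intro exI[of _ "{A}"]) (auto intro: derives.assumption)
next
  case (AndI G A B)
  then obtain F1 F2 where "finite F1" "F1 \<subseteq> G" "derives Ax F1 A" "finite F2" "F2 \<subseteq> G" "derives Ax F2 B"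
    by auto
  then show ?case
    by (intro exI[of _ "F1 \<union> F2"]) (auto intro!: derives.AndI intro: derives_mono)
next
  case (OrE G A B C)
  then obtain F1 F2 F3 where F: "finite F1" "F1 \<subseteq> G" "derives Ax F1 (A \<^bold>\<or> B)"
    "finite F2" "F2 \<subseteq> insert A G" "derives Ax F2 C" "finite F3" "F3 \<subseteq> insert B G" "derives Ax F3 C"
    by auto
  let ?F = "F1 \<union> (F2 - {A}) \<union> (F3 - {B})"
  have "derives Ax ?F (A \<^bold>\<or> B)" using F(3) by (rule derives_mono) auto
  moreover have "derives Ax (insert A ?F) C" using F(6) by (rule derives_mono) auto
  moreover have "derives Ax (insert B ?F) C" using F(9) by (rule derives_mono) auto
  ultimately have "derives Ax ?F C" by (rule derives.OrE)
  then show ?case using F by (intro exI[of _ ?F]) auto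
next
  case (ImpI A G B)
  then obtain F where F: "finite F" "F \<subseteq> insert A G" "derives Ax F B" by auto
  then have "derives Ax (insert A (F - {A})) B" by (auto elim!: derives_mono)
  then show ?case using F by (intro exI[of _ "F - {A}"]) (auto intro: derives.ImpI)
next
  case (ImpE G A B)
  then obtain F1 F2 where "finite F1" "F1 \<subseteq> G" "derives Ax F1 (A \<^bold>\<longrightarrow> B)" "finite F2" "F2 \<subseteq> G" "derives Ax F2 A"
    by auto
  then show ?case
    by (intro exI[of _ "F1 \<union> F2"]) (auto intro!: derives.ImpE[of _ _ A B] intro: derives_mono)
next
  case (ForallI G A)
  then obtain F where F: "finite F" "F \<subseteq> shift ` G" "derives Ax F A" by auto
  then obtain F' where "F' \<subseteq> G" "finite F'" "F = shift ` F'" by (meson finite_subset_image)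
  then show ?case using F by (auto intro: derives.ForallI)
next
  case (ExistsE G A C)
  then obtain F1 F2 where F: "finite F1" "F1 \<subseteq> G" "derives Ax F1 (\<^bold>\<exists> A)"
    "finite F2" "F2 \<subseteq> insert A (shift ` G)" "derives Ax F2 (shift C)" by auto
  then have "F2 - {A} \<subseteq> shift ` G" "finite (F2 - {A})" by auto
  then obtain F' where F': "F' \<subseteq> G" "finite F'" "F2 - {A} = shift ` F'" by (meson finite_subset_image)
  have "derives Ax (insert A (shift ` (F1 \<union> F'))) (shift C)"
    using F(6) by (rule derives_mono) (use F' in auto)
  moreover have "derives Ax (F1 \<union> F') (\<^bold>\<exists> A)" using F(3) by (rule derives_mono) auto
  ultimately show ?case using F F' by (intro exI[of _ "F1 \<union> F'"]) (auto intro: derives.ExistsE)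
next
  case (EqE G a b A)
  then obtain F1 F2 where "finite F1" "F1 \<subseteq> G" "derives Ax F1 (a \<^bold>= b)" "finite F2" "F2 \<subseteq> G" "derives Ax F2 (inst a A)"
    by auto
  then show ?case
    by (intro exI[of _ "F1 \<union> F2"]) (auto intro!: derives.EqE[of _ _ a b A] intro: derives_mono)
qed (blast intro: derives.intros)+

text \<open>
  \<open>bound n A\<close>: every free variable of \<open>A\<close> is below \<open>n\<close>, so that \<open>n, n + 1, \<dots>\<close> are fresh for \<open>A\<close>.
\<close>

primrec bound :: "nat \<Rightarrow> fm \<Rightarrow> bool" where
  "bound n (a \<^bold>= b) = (a < n \<and> b < n)"
| "bound n (Betw a b c) = (a < n \<and> b < n \<and> c < n)"
| "bound n (Cong a b c d) = (a < n \<and> b < n \<and> c < n \<and> d < n)"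
| "bound n (LeftTurn a b c) = (a < n \<and> b < n \<and> c < n)"
| "bound n \<^bold>\<bottom> = True"
| "bound n (A \<^bold>\<and> B) = (bound n A \<and> bound n B)"
| "bound n (A \<^bold>\<or> B) = (bound n A \<and> bound n B)"
| "bound n (A \<^bold>\<longrightarrow> B) = (bound n A \<and> bound n B)"
| "bound n (\<^bold>\<forall> A) = bound (Suc n) A"
| "bound n (\<^bold>\<exists> A) = bound (Suc n) A"

lemma bound_mono: "bound n A \<Longrightarrow> n \<le> m \<Longrightarrow> bound m A"
proof (induction A arbitrary: n m)
  case (Forall A) then show ?case by (metis Suc_le_mono bound.simps(9))
next
  case (Exists A) then show ?case by (metis Suc_le_mono bound.simps(10))
qed (simp; meson less_le_trans)+

lemma bound_exists: "\<exists>n. bound n A"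
proof (induction A)
  case (Forall A) then show ?case by (metis bound.simps(9) bound_mono le_SucI order_refl)
next
  case (Exists A) then show ?case by (metis bound.simps(10) bound_mono le_SucI order_refl)
next
  case (And A B) then show ?case by (metis bound.simps(6) bound_mono nle_le)
next
  case (Or A B) then show ?case by (metis bound.simps(7) bound_mono nle_le)
next
  case (Imp A B) then show ?case by (metis bound.simps(8) bound_mono nle_le)
next
  case (Eq a b) show ?case by (rule exI[of _ "Suc (a + b)"]) simp
next
  case (Betw a b c) show ?case by (rule exI[of _ "Suc (a + b + c)"]) simp
next
  case (Cong a b c d) show ?case by (rule exI[of _ "Suc (a + b + c + d)"]) simp
next
  case (LeftTurn a b c) show ?case by (rule exI[of _ "Suc (a + b + c)"]) simp
qed simp

lemma bound_exists_finite: "finite G \<Longrightarrow> \<exists>n. \<forall>A\<in>G. bound n A"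
proof (induction rule: finite_induct)
  case (insert A G)
  then obtain n m where nm: "\<forall>A\<in>G. bound n A" "bound m A" using bound_exists by blast
  have "bound (max n m) B" if "B \<in> insert A G" for B
    using that nm bound_mono[of n B "max n m"] bound_mono[of m B "max n m"] by auto
  then show ?case by blast
qed simp

lemma ren_cong_bound: "bound n A \<Longrightarrow> (\<And>i. i < n \<Longrightarrow> f i = g i) \<Longrightarrow> ren f A = ren g A"
proof (induction A arbitrary: n f g)
  case (Forall A)
  have "ren (lift f) A = ren (lift g) A"
    using Forall.prems by (intro Forall.IH[of "Suc n"]) (auto simp: lift_def split: nat.splits)
  then show ?case by simp
next
  case (Exists A)
  have "ren (lift f) A = ren (lift g) A"
    using Exists.prems by (intro Exists.IH[of "Suc n"]) (auto simp: lift_def split: nat.splits)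
  then show ?case by simp
qed (simp; metis)+

text \<open>
  The renaming below exchanges the two ways of introducing a fresh point: a named variable \<open>t\<close>, and
  the de Bruijn index \<open>0\<close> in front of a shifted context. It turns the quantifier rules of the calculus
  into the named rules \<open>ForallI_fresh\<close> and \<open>ExistsE_fresh\<close>, under which the variables already in use keep
  their numbers.
\<close>

lemma ren_fresh:
  assumes "bound t A"
  shows "ren (\<lambda>j. if j = t then 0 else Suc j) A = shift A"
  using assms by (rule ren_cong_bound) simp

lemma ren_fresh_inst:
  assumes "bound (Suc t) A"
  shows "ren (\<lambda>j. if j = t then 0 else Suc j) (inst t A) = A"
proof -
  have "ren (\<lambda>j. if j = t then 0 else Suc j) (inst t A) = ren (\<lambda>j. j) A"
    unfolding inst_def ren_ren using assms by (rule ren_cong_bound) (auto split: nat.splits)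
  then show ?thesis by (simp add: ren_id)
qed

lemma ForallI_fresh:
  assumes Ax: "\<And>f A. A \<in> Ax \<Longrightarrow> ren f A \<in> Ax"
    and "derives Ax G (inst t A)" "\<forall>B\<in>G. bound t B" "bound (Suc t) A"
  shows "derives Ax G (\<^bold>\<forall> A)"
proof -
  have "derives Ax (ren (\<lambda>j. if j = t then 0 else Suc j) ` G) A"
    using derives_ren[OF Ax assms(2), of "\<lambda>j. if j = t then 0 else Suc j"] assms(4)
    by (simp add: ren_fresh_inst)
  moreover have "ren (\<lambda>j. if j = t then 0 else Suc j) ` G = shift ` G"
    using assms(3) by (auto simp: ren_fresh intro!: image_cong)
  ultimately show ?thesis by (simp add: derives.ForallI)
qed

lemma ExistsE_fresh:
  assumes Ax: "\<And>f A. A \<in> Ax \<Longrightarrow> ren f A \<in> Ax"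
    and "derives Ax G (\<^bold>\<exists> A)" "derives Ax (insert (inst t A) G) C"
    and "\<forall>B\<in>G. bound t B" "bound (Suc t) A" "bound t C"
  shows "derives Ax G C"
proof -
  have "derives Ax (insert A (ren (\<lambda>j. if j = t then 0 else Suc j) ` G)) (shift C)"
    using derives_ren[OF Ax assms(3), of "\<lambda>j. if j = t then 0 else Suc j"] assms(5,6)
    by (simp add: ren_fresh_inst ren_fresh)
  moreover have "ren (\<lambda>j. if j = t then 0 else Suc j) ` G = shift ` G"
    using assms(4) by (auto simp: ren_fresh intro!: image_cong)
  ultimately show ?thesis using assms(2) by (auto intro: derives.ExistsE)
qed

lemma derives_cut: "derives Ax G A \<Longrightarrow> derives Ax (insert A G) B \<Longrightarrow> derives Ax G B"
  by (meson derives.ImpE derives.ImpI)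

section \<open>Stable formulas\<close>

text \<open>
  A syntactic condition under which a formula follows from its double negation. Of an implication only
  the conclusion matters, so negations and all formulas under them are included.
\<close>

primrec stable :: "fm \<Rightarrow> bool" where
  "stable (a \<^bold>= b) = True"
| "stable (Betw a b c) = True"
| "stable (Cong a b c d) = True"
| "stable (LeftTurn a b c) = False"
| "stable \<^bold>\<bottom> = True"
| "stable (A \<^bold>\<and> B) = (stable A \<and> stable B)"
| "stable (A \<^bold>\<or> B) = False"
| "stable (A \<^bold>\<longrightarrow> B) = stable B"
| "stable (\<^bold>\<forall> A) = stable A"
| "stable (\<^bold>\<exists> A) = False"

lemma stable_ren [simp]: "stable (ren f A) = stable A"
  by (induction A arbitrary: f) simp_all

locale stable_theory =
  fixes Ax :: "fm set"
  assumes Ax_ren: "A \<in> Ax \<Longrightarrow> ren f A \<in> Ax"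
    and Ax_stable_eq: "(\<^bold>\<not> \<^bold>\<not> (a \<^bold>= b) \<^bold>\<longrightarrow> a \<^bold>= b) \<in> Ax"
    and Ax_stable_Betw: "(\<^bold>\<not> \<^bold>\<not> Betw a b c \<^bold>\<longrightarrow> Betw a b c) \<in> Ax"
    and Ax_stable_Cong: "(\<^bold>\<not> \<^bold>\<not> Cong a b c d \<^bold>\<longrightarrow> Cong a b c d) \<in> Ax"
begin

abbreviation prv :: "fm set \<Rightarrow> fm \<Rightarrow> bool" (infix "\<turnstile>" 20) where
  "G \<turnstile> A \<equiv> derives Ax G A"

lemma not_not_map:
  assumes "G \<turnstile> \<^bold>\<not> \<^bold>\<not> A" "insert A G \<turnstile> B"
  shows "G \<turnstile> \<^bold>\<not> \<^bold>\<not> B"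
proof -
  let ?H = "insert A (insert (\<^bold>\<not> B) G)"
  have "?H \<turnstile> B" by (rule derives_mono[OF assms(2)]) auto
  moreover have "?H \<turnstile> \<^bold>\<not> B" by (rule derives.assumption) simp
  ultimately have "insert (\<^bold>\<not> B) G \<turnstile> \<^bold>\<not> A" by (blast intro: derives.ImpE derives.ImpI)
  moreover have "insert (\<^bold>\<not> B) G \<turnstile> \<^bold>\<not> \<^bold>\<not> A" by (rule derives_mono[OF assms(1)]) auto
  ultimately show ?thesis by (blast intro: derives.ImpE derives.ImpI)
qed

text \<open>
  Stability passes from the atoms through conjunction, implication and universal quantification, because
  \<open>\<not>\<not>\<close> commutes with these connectives in the direction needed here.
\<close>

lemma stable_not_notE: "stable A \<Longrightarrow> G \<turnstile> \<^bold>\<not> \<^bold>\<not> A \<Longrightarrow> G \<turnstile> A"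
proof (induction A arbitrary: G)
  case (Eq a b) then show ?case by (meson Ax_stable_eq derives.ImpE derives.axiom)
next
  case (Betw a b c) then show ?case by (meson Ax_stable_Betw derives.ImpE derives.axiom)
next
  case (Cong a b c d) then show ?case by (meson Ax_stable_Cong derives.ImpE derives.axiom)
next
  case Falsum
  have "G \<turnstile> \<^bold>\<not> \<^bold>\<bottom>" by (rule derives.ImpI, rule derives.assumption) simp
  then show ?case using Falsum by (blast intro: derives.ImpE)
next
  case (And A B)
  have *: "insert (A \<^bold>\<and> B) G \<turnstile> A \<^bold>\<and> B" by (rule derives.assumption) simp
  show ?case
    using And.prems(1)
      And.IH(1)[OF _ not_not_map[OF And.prems(2) derives.AndE1[OF *]]]
      And.IH(2)[OF _ not_not_map[OF And.prems(2) derives.AndE2[OF *]]]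
    by (simp add: derives.AndI)
next
  case (Imp A B)
  have "insert A G \<turnstile> \<^bold>\<not> \<^bold>\<not> (A \<^bold>\<longrightarrow> B)" by (rule derives_mono[OF Imp.prems(2)]) auto
  moreover have "insert (A \<^bold>\<longrightarrow> B) (insert A G) \<turnstile> B"
    by (rule derives.ImpE[of _ _ A]; rule derives.assumption) simp_all
  ultimately have "insert A G \<turnstile> \<^bold>\<not> \<^bold>\<not> B" by (rule not_not_map)
  then show ?case using Imp by (simp add: derives.ImpI)
next
  case (Forall A)
  have "shift ` G \<turnstile> \<^bold>\<not> \<^bold>\<not> \<^bold>\<forall> (ren (lift Suc) A)"
    using derives_ren[OF Ax_ren Forall.prems(2), of Suc] by simp
  moreover have "insert (\<^bold>\<forall> (ren (lift Suc) A)) (shift ` G) \<turnstile> A"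
  proof -
    have "case_nat 0 Suc = (\<lambda>j. j)" by (rule ext) (simp split: nat.splits)
    then have "inst 0 (ren (lift Suc) A) = A" by (simp add: inst_lift ren_id)
    then show ?thesis by (metis derives.ForallE derives.assumption insertI1)
  qed
  ultimately have "shift ` G \<turnstile> \<^bold>\<not> \<^bold>\<not> A" by (rule not_not_map)
  then show ?case using Forall by (simp add: derives.ForallI)
qed simp_all

end

section \<open>Maximal consistent sets as classical models\<close>

instance fm :: countable by countable_datatype

text \<open>
  Classical satisfaction in a structure with domain \<open>D\<close>. The domain is a parameter because the first
  model built from a maximal consistent set is carried by a set of representatives, not by a whole type.
\<close>

primrec sat :: "'a set \<Rightarrow> ('a \<Rightarrow> 'a \<Rightarrow> 'a \<Rightarrow> bool) \<Rightarrow> ('a \<Rightarrow> 'a \<Rightarrow> 'a \<Rightarrow> 'a \<Rightarrow> bool) \<Rightarrow>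
    ('a \<Rightarrow> 'a \<Rightarrow> 'a \<Rightarrow> bool) \<Rightarrow> (nat \<Rightarrow> 'a) \<Rightarrow> fm \<Rightarrow> bool" where
  "sat D B C L v (a \<^bold>= b) = (v a = v b)"
| "sat D B C L v (Betw a b c) = B (v a) (v b) (v c)"
| "sat D B C L v (Cong a b c d) = C (v a) (v b) (v c) (v d)"
| "sat D B C L v (LeftTurn a b c) = L (v a) (v b) (v c)"
| "sat D B C L v \<^bold>\<bottom> = False"
| "sat D B C L v (F \<^bold>\<and> F') = (sat D B C L v F \<and> sat D B C L v F')"
| "sat D B C L v (F \<^bold>\<or> F') = (sat D B C L v F \<or> sat D B C L v F')"
| "sat D B C L v (F \<^bold>\<longrightarrow> F') = (sat D B C L v F \<longrightarrow> sat D B C L v F')"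
| "sat D B C L v (\<^bold>\<forall> F) = (\<forall>x\<in>D. sat D B C L (case_nat x v) F)"
| "sat D B C L v (\<^bold>\<exists> F) = (\<exists>x\<in>D. sat D B C L (case_nat x v) F)"

text \<open>
  Universal statements with an unstable body are the obstacle to reading a maximal consistent set as a
  model: refuting \<open>\<forall>x. A x\<close> does not refute an instance intuitionistically. It does if \<open>A\<close> is stable.
\<close>

primrec forall_stable :: "fm \<Rightarrow> bool" where
  "forall_stable (a \<^bold>= b) = True"
| "forall_stable (Betw a b c) = True"
| "forall_stable (Cong a b c d) = True"
| "forall_stable (LeftTurn a b c) = True"
| "forall_stable \<^bold>\<bottom> = True"
| "forall_stable (A \<^bold>\<and> B) = (forall_stable A \<and> forall_stable B)"
| "forall_stable (A \<^bold>\<or> B) = (forall_stable A \<and> forall_stable B)"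
| "forall_stable (A \<^bold>\<longrightarrow> B) = (forall_stable A \<and> forall_stable B)"
| "forall_stable (\<^bold>\<forall> A) = (forall_stable A \<and> stable A)"
| "forall_stable (\<^bold>\<exists> A) = forall_stable A"

context stable_theory
begin

lemma negI: "insert A G \<turnstile> \<^bold>\<bottom> \<Longrightarrow> G \<turnstile> \<^bold>\<not> A"
  by (rule derives.ImpI)

text \<open>
  The last two clauses ask for a witness of every existential statement in \<open>M\<close> and, contrapositively,
  for a counterexample to every universal statement with stable body that is not in \<open>M\<close>.
\<close>

definition maximal :: "fm set \<Rightarrow> bool" where
  "maximal M \<longleftrightarrow> \<not> (M \<turnstile> \<^bold>\<bottom>) \<and> (\<forall>A. A \<in> M \<or> (\<^bold>\<not> A) \<in> M) \<and>
     (\<forall>A. (\<^bold>\<exists> A) \<in> M \<longrightarrow> (\<exists>t. inst t A \<in> M)) \<and>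
     (\<forall>A. stable A \<and> (\<forall>t. inst t A \<in> M) \<longrightarrow> (\<^bold>\<forall> A) \<in> M)"

primrec witness :: "nat \<Rightarrow> fm \<Rightarrow> fm set" where
  "witness t (a \<^bold>= b) = {}"
| "witness t (Betw a b c) = {}"
| "witness t (Cong a b c d) = {}"
| "witness t (LeftTurn a b c) = {}"
| "witness t \<^bold>\<bottom> = {}"
| "witness t (A \<^bold>\<and> B) = {}"
| "witness t (A \<^bold>\<or> B) = {}"
| "witness t (A \<^bold>\<longrightarrow> B) = {}"
| "witness t (\<^bold>\<forall> A) = {}"
| "witness t (\<^bold>\<exists> A) = {inst t A}"

primrec counterexample :: "nat \<Rightarrow> fm \<Rightarrow> fm set" where
  "counterexample t (a \<^bold>= b) = {}"
| "counterexample t (Betw a b c) = {}"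
| "counterexample t (Cong a b c d) = {}"
| "counterexample t (LeftTurn a b c) = {}"
| "counterexample t \<^bold>\<bottom> = {}"
| "counterexample t (A \<^bold>\<and> B) = {}"
| "counterexample t (A \<^bold>\<or> B) = {}"
| "counterexample t (A \<^bold>\<longrightarrow> B) = {}"
| "counterexample t (\<^bold>\<forall> A) = (if stable A then {\<^bold>\<not> inst t A} else {})"
| "counterexample t (\<^bold>\<exists> A) = {}"

definition fresh_var :: "fm set \<Rightarrow> nat" where
  "fresh_var H = (SOME t. \<forall>B\<in>H. bound t B)"

lemma fresh_var: "finite H \<Longrightarrow> B \<in> H \<Longrightarrow> bound (fresh_var H) B"
  unfolding fresh_var_def by (rule someI2_ex[OF bound_exists_finite]) auto

definition extend :: "fm \<Rightarrow> fm set \<Rightarrow> fm set" where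
  "extend A H = (if insert A H \<turnstile> \<^bold>\<bottom> then counterexample (fresh_var (insert A H)) A \<union> H
                 else witness (fresh_var (insert A H)) A \<union> insert A H)"

text \<open>
  Adding a counterexample \<open>\<not> A t\<close> with \<open>t\<close> fresh is harmless: otherwise \<open>H\<close> would prove \<open>\<not>\<not> A t\<close>, hence
  \<open>A t\<close> by stability, hence \<open>\<forall>x. A x\<close>, although \<open>H\<close> is inconsistent with it. A fresh witness is harmless by
  existential elimination.
\<close>

lemma extend_consistent:
  assumes "finite H" "\<not> (H \<turnstile> \<^bold>\<bottom>)"
  shows "finite (extend A H) \<and> \<not> (extend A H \<turnstile> \<^bold>\<bottom>)"
proof
  have "finite (witness t A)" "finite (counterexample t A)" for t
    by (induction A) simp_all
  then show "finite (extend A H)" using assms by (simp add: extend_def)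
next
  let ?t = "fresh_var (insert A H)"
  have fresh: "bound ?t B" if "B \<in> insert A H" for B
    using assms(1) that by (simp add: fresh_var)
  show "\<not> (extend A H \<turnstile> \<^bold>\<bottom>)"
  proof (cases "insert A H \<turnstile> \<^bold>\<bottom>")
    case True
    show ?thesis
    proof (cases "\<exists>B. A = (\<^bold>\<forall> B) \<and> stable B")
      case False
      then have "counterexample ?t A = {}" by (cases A) auto
      then show ?thesis using True assms(2) by (simp add: extend_def)
    next
      case 2: True
      then obtain B where B: "A = (\<^bold>\<forall> B)" "stable B" by blast
      show ?thesis
      proof
        assume "extend A H \<turnstile> \<^bold>\<bottom>"
        then have "H \<turnstile> \<^bold>\<not> \<^bold>\<not> inst ?t B"
          using True B by (simp add: extend_def negI)
        then have "H \<turnstile> inst ?t B" using B by (auto intro: stable_not_notE simp: inst_def)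
        then have "H \<turnstile> A"
          unfolding B(1)
          by (intro ForallI_fresh[of Ax H ?t]) (use fresh fresh[of A] B Ax_ren in simp_all)
        then show False using True assms(2) derives_cut by blast
      qed
    qed
  next
    case False
    show ?thesis
    proof (cases "\<exists>B. A = (\<^bold>\<exists> B)")
      case 2: False
      then have "witness ?t A = {}" by (cases A) auto
      then show ?thesis using False by (simp add: extend_def)
    next
      case True
      then obtain B where B: "A = (\<^bold>\<exists> B)" by blast
      show ?thesis
      proof
        assume "extend A H \<turnstile> \<^bold>\<bottom>"
        then have "insert (inst ?t B) (insert A H) \<turnstile> \<^bold>\<bottom>"
          using False B by (simp add: extend_def insert_commute)
        moreover have "insert A H \<turnstile> \<^bold>\<exists> B" by (rule derives.assumption) (simp add: B)
        moreover have "bound (Suc ?t) B" using fresh[of A] B by simp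
        ultimately have "insert A H \<turnstile> \<^bold>\<bottom>"
          using fresh by (intro ExistsE_fresh[OF Ax_ren, of "insert A H" B ?t "\<^bold>\<bottom>"]) simp_all
        then show False using False by blast
      qed
    qed
  qed
qed

primrec chain :: "fm set \<Rightarrow> nat \<Rightarrow> fm set" where
  "chain G 0 = G"
| "chain G (Suc n) = extend (from_nat n) (chain G n)"

text \<open>
  Henkin's construction: the formulas are enumerated, each is added if this is consistent, and witnesses
  and counterexamples are added on the way. Every stage is finite, so fresh variables never run out.
\<close>

lemma maximal_extension:
  assumes "finite G" "\<not> (G \<turnstile> \<^bold>\<bottom>)"
  shows "\<exists>M. G \<subseteq> M \<and> maximal M"
proof -
  define M where "M = (\<Union>n. chain G n)"
  have chain: "finite (chain G n) \<and> \<not> (chain G n \<turnstile> \<^bold>\<bottom>)" for n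
    by (induction n) (use assms extend_consistent in auto)
  have "chain G n \<subseteq> chain G (Suc n)" for n
    by (auto simp: extend_def)
  then have mono: "chain G n \<subseteq> chain G m" if "n \<le> m" for n m
    using that by (rule lift_Suc_mono_le)
  have sub: "chain G n \<subseteq> M" for n by (auto simp: M_def)
  have M_consistent: "\<not> (M \<turnstile> \<^bold>\<bottom>)"
  proof
    assume "M \<turnstile> \<^bold>\<bottom>"
    then obtain F where F: "finite F" "F \<subseteq> M" "F \<turnstile> \<^bold>\<bottom>" using derives_finite_support[OF \<open>M \<turnstile> \<^bold>\<bottom>\<close>] by blast
    have "\<exists>n. F \<subseteq> chain G n" using F(1,2)
    proof (induction F rule: finite_induct)
      case (insert A F)
      then obtain n m where "F \<subseteq> chain G n" "A \<in> chain G m" by (auto simp: M_def)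
      then have "insert A F \<subseteq> chain G (max n m)"
        using mono[of n "max n m"] mono[of m "max n m"] by auto
      then show ?case by blast
    qed simp
    then obtain n where "F \<subseteq> chain G n" ..
    then show False using derives_mono[OF F(3)] chain[of n] by simp
  qed
  have step: "chain G (Suc (to_nat A)) = extend A (chain G (to_nat A))" for A by simp
  have closed: "A \<in> M" if "M \<turnstile> A" for A
  proof (cases "insert A (chain G (to_nat A)) \<turnstile> \<^bold>\<bottom>")
    case True
    then have "insert A M \<turnstile> \<^bold>\<bottom>" by (rule derives_mono) (use sub in auto)
    then show ?thesis using M_consistent derives_cut[OF that] by simp
  next
    case False
    then have "A \<in> chain G (Suc (to_nat A))" unfolding step by (simp add: extend_def)
    then show ?thesis using sub by blast
  qed
  have inconsistent: "insert A (chain G (to_nat A)) \<turnstile> \<^bold>\<bottom>" if "A \<notin> M" for A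
  proof (rule ccontr)
    assume "\<not> ?thesis"
    then have "A \<in> chain G (Suc (to_nat A))" unfolding step by (simp add: extend_def)
    then show False using sub that by blast
  qed
  have "(\<^bold>\<not> A) \<in> M" if "A \<notin> M" for A
    using inconsistent[OF that] by (intro closed derives_mono[OF negI sub])
  moreover have "\<exists>t. inst t A \<in> M" if "(\<^bold>\<exists> A) \<in> M" for A
  proof -
    let ?A = "\<^bold>\<exists> A"
    have "\<not> (insert ?A (chain G (to_nat ?A)) \<turnstile> \<^bold>\<bottom>)"
    proof
      assume "insert ?A (chain G (to_nat ?A)) \<turnstile> \<^bold>\<bottom>"
      then have "M \<turnstile> \<^bold>\<bottom>" by (rule derives_mono) (use sub that in auto)
      then show False using M_consistent by blast
    qed
    then have "inst (fresh_var (insert ?A (chain G (to_nat ?A)))) A \<in> chain G (Suc (to_nat ?A))"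
      unfolding step by (simp add: extend_def)
    then show ?thesis using sub by blast
  qed
  moreover have "(\<^bold>\<forall> A) \<in> M" if "stable A" and inst: "\<And>t. inst t A \<in> M" for A
  proof (rule ccontr)
    let ?A = "\<^bold>\<forall> A"
    let ?t = "fresh_var (insert ?A (chain G (to_nat ?A)))"
    assume "?A \<notin> M"
    then have "(\<^bold>\<not> inst ?t A) \<in> chain G (Suc (to_nat ?A))"
      using inconsistent[of ?A] \<open>stable A\<close> unfolding step by (simp add: extend_def)
    then have "M \<turnstile> \<^bold>\<not> inst ?t A" using sub by (blast intro: derives.assumption)
    moreover have "M \<turnstile> inst ?t A" using inst by (rule derives.assumption)
    ultimately show False using M_consistent by (blast intro: derives.ImpE)
  qed
  ultimately have "maximal M" using M_consistent by (auto simp: maximal_def)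
  moreover have "G \<subseteq> M" using sub[of 0] by simp
  ultimately show ?thesis by blast
qed

lemma maximal_closed:
  assumes "maximal M" "M \<turnstile> A"
  shows "A \<in> M"
proof (rule ccontr)
  assume "A \<notin> M"
  then have "M \<turnstile> \<^bold>\<not> A" using assms(1) by (auto simp: maximal_def intro: derives.assumption)
  then show False using assms by (auto simp: maximal_def intro: derives.ImpE)
qed

lemma maximal_not: "maximal M \<Longrightarrow> (\<^bold>\<not> A) \<in> M \<longleftrightarrow> A \<notin> M"
  unfolding maximal_def by (meson derives.ImpE derives.assumption)

lemma maximal_and: "maximal M \<Longrightarrow> (A \<^bold>\<and> B) \<in> M \<longleftrightarrow> A \<in> M \<and> B \<in> M"
  by (meson derives.AndE1 derives.AndE2 derives.AndI derives.assumption maximal_closed)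

lemma maximal_imp:
  assumes "maximal M"
  shows "(A \<^bold>\<longrightarrow> B) \<in> M \<longleftrightarrow> (A \<in> M \<longrightarrow> B \<in> M)"
proof
  assume "(A \<^bold>\<longrightarrow> B) \<in> M"
  then show "A \<in> M \<longrightarrow> B \<in> M"
    using assms by (meson derives.ImpE derives.assumption maximal_closed)
next
  assume *: "A \<in> M \<longrightarrow> B \<in> M"
  have "insert A M \<turnstile> B"
  proof (cases "A \<in> M")
    case True
    then show ?thesis using * by (auto intro: derives.assumption)
  next
    case False
    then have "insert A M \<turnstile> \<^bold>\<not> A" using assms by (auto simp: maximal_def intro: derives.assumption)
    moreover have "insert A M \<turnstile> A" by (rule derives.assumption) simp
    ultimately show ?thesis by (blast intro: derives.ImpE derives.FalsumE)
  qed
  then show "(A \<^bold>\<longrightarrow> B) \<in> M" using assms by (intro maximal_closed derives.ImpI)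
qed

lemma maximal_or:
  assumes "maximal M"
  shows "(A \<^bold>\<or> B) \<in> M \<longleftrightarrow> A \<in> M \<or> B \<in> M"
proof
  assume AB: "(A \<^bold>\<or> B) \<in> M"
  show "A \<in> M \<or> B \<in> M"
  proof (rule ccontr)
    assume "\<not> ?thesis"
    then have "(\<^bold>\<not> A) \<in> M" "(\<^bold>\<not> B) \<in> M" using assms by (auto simp: maximal_not)
    then have "insert A M \<turnstile> \<^bold>\<bottom>" "insert B M \<turnstile> \<^bold>\<bottom>"
      by (meson derives.ImpE derives.assumption insertI1 insertI2)+
    then have "M \<turnstile> \<^bold>\<bottom>" using AB by (meson derives.OrE derives.assumption)
    then show False using assms by (simp add: maximal_def)
  qed
next
  assume "A \<in> M \<or> B \<in> M"
  then show "(A \<^bold>\<or> B) \<in> M" using assms by (meson derives.OrI1 derives.OrI2 derives.assumption maximal_closed)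
qed

lemma maximal_forall:
  "maximal M \<Longrightarrow> stable A \<Longrightarrow> (\<^bold>\<forall> A) \<in> M \<longleftrightarrow> (\<forall>t. inst t A \<in> M)"
  using maximal_closed[of M] derives.ForallE[of Ax M A] derives.assumption[of "\<^bold>\<forall> A" M Ax]
  unfolding maximal_def by blast

lemma maximal_exists: "maximal M \<Longrightarrow> (\<^bold>\<exists> A) \<in> M \<longleftrightarrow> (\<exists>t. inst t A \<in> M)"
  using maximal_closed[of M] derives.ExistsI[of Ax M _ A] derives.assumption[of "inst _ A" M Ax]
  unfolding maximal_def by blast

lemma maximal_subst:
  "maximal M \<Longrightarrow> (a \<^bold>= b) \<in> M \<Longrightarrow> inst a A \<in> M \<Longrightarrow> inst b A \<in> M"
  by (meson derives.EqE derives.assumption maximal_closed)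

lemma maximal_refl: "maximal M \<Longrightarrow> (a \<^bold>= a) \<in> M"
  by (simp add: derives.EqI maximal_closed)

lemma maximal_sym: "maximal M \<Longrightarrow> (a \<^bold>= b) \<in> M \<Longrightarrow> (b \<^bold>= a) \<in> M"
  using maximal_subst[of M a b "0 \<^bold>= Suc a"] maximal_refl[of M a] by (simp add: inst_def)

lemma maximal_trans: "maximal M \<Longrightarrow> (a \<^bold>= b) \<in> M \<Longrightarrow> (b \<^bold>= c) \<in> M \<Longrightarrow> (a \<^bold>= c) \<in> M"
  using maximal_subst[of M b c "Suc a \<^bold>= 0"] by (simp add: inst_def)

lemma maximal_Betw:
  assumes "maximal M" "(a \<^bold>= a') \<in> M" "(b \<^bold>= b') \<in> M" "(c \<^bold>= c') \<in> M" "Betw a b c \<in> M"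
  shows "Betw a' b' c' \<in> M"
  using assms maximal_subst[of M a a' "Betw 0 (Suc b) (Suc c)"]
    maximal_subst[of M b b' "Betw (Suc a') 0 (Suc c)"]
    maximal_subst[of M c c' "Betw (Suc a') (Suc b') 0"]
  by (simp add: inst_def)

lemma maximal_LeftTurn:
  assumes "maximal M" "(a \<^bold>= a') \<in> M" "(b \<^bold>= b') \<in> M" "(c \<^bold>= c') \<in> M" "LeftTurn a b c \<in> M"
  shows "LeftTurn a' b' c' \<in> M"
  using assms maximal_subst[of M a a' "LeftTurn 0 (Suc b) (Suc c)"]
    maximal_subst[of M b b' "LeftTurn (Suc a') 0 (Suc c)"]
    maximal_subst[of M c c' "LeftTurn (Suc a') (Suc b') 0"]
  by (simp add: inst_def)

lemma maximal_Cong: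
  assumes "maximal M" "(a \<^bold>= a') \<in> M" "(b \<^bold>= b') \<in> M" "(c \<^bold>= c') \<in> M" "(d \<^bold>= d') \<in> M" "Cong a b c d \<in> M"
  shows "Cong a' b' c' d' \<in> M"
  using assms maximal_subst[of M a a' "Cong 0 (Suc b) (Suc c) (Suc d)"]
    maximal_subst[of M b b' "Cong (Suc a') 0 (Suc c) (Suc d)"]
    maximal_subst[of M c c' "Cong (Suc a') (Suc b') 0 (Suc d)"]
    maximal_subst[of M d d' "Cong (Suc a') (Suc b') (Suc c') 0"]
  by (simp add: inst_def)

text \<open>
  The variables themselves are the points; \<open>h\<close> identifies those that \<open>M\<close> declares equal, and a relation
  holds of points if \<open>M\<close> contains the atom for some choice of names.
\<close>

definition canonical_sat :: "fm set \<Rightarrow> (nat \<Rightarrow> 'a) \<Rightarrow> (nat \<Rightarrow> 'a) \<Rightarrow> fm \<Rightarrow> bool" where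
  "canonical_sat M h = sat (range h)
     (\<lambda>x y z. \<exists>a b c. x = h a \<and> y = h b \<and> z = h c \<and> Betw a b c \<in> M)
     (\<lambda>x y z w. \<exists>a b c d. x = h a \<and> y = h b \<and> z = h c \<and> w = h d \<and> Cong a b c d \<in> M)
     (\<lambda>x y z. \<exists>a b c. x = h a \<and> y = h b \<and> z = h c \<and> LeftTurn a b c \<in> M)"

text \<open>
  The induction runs over all renamings \<open>f\<close> at once: instantiating the quantifier in a renamed formula is
  again a renaming.
\<close>

lemma truth_lemma:
  assumes M: "maximal M" and h: "\<And>a b. h a = h b \<longleftrightarrow> (a \<^bold>= b) \<in> M"
  shows "forall_stable A \<Longrightarrow> canonical_sat M h (h \<circ> f) A \<longleftrightarrow> ren f A \<in> M"
proof (induction A arbitrary: f)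
  case (Betw a b c)
  have "(\<exists>a' b' c'. (f a \<^bold>= a') \<in> M \<and> (f b \<^bold>= b') \<in> M \<and> (f c \<^bold>= c') \<in> M \<and> Betw a' b' c' \<in> M) \<longleftrightarrow> Betw (f a) (f b) (f c) \<in> M"
    using maximal_Betw[OF M maximal_sym[OF M] maximal_sym[OF M] maximal_sym[OF M]] maximal_refl[OF M] by blast
  then show ?case by (simp add: canonical_sat_def h)
next
  case (Cong a b c d)
  have "(\<exists>a' b' c' d'. (f a \<^bold>= a') \<in> M \<and> (f b \<^bold>= b') \<in> M \<and> (f c \<^bold>= c') \<in> M \<and> (f d \<^bold>= d') \<in> M \<and> Cong a' b' c' d' \<in> M) \<longleftrightarrow> Cong (f a) (f b) (f c) (f d) \<in> M"
    using maximal_Cong[OF M maximal_sym[OF M] maximal_sym[OF M] maximal_sym[OF M] maximal_sym[OF M]] maximal_refl[OF M] by blast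
  then show ?case by (simp add: canonical_sat_def h)
next
  case (LeftTurn a b c)
  have "(\<exists>a' b' c'. (f a \<^bold>= a') \<in> M \<and> (f b \<^bold>= b') \<in> M \<and> (f c \<^bold>= c') \<in> M \<and> LeftTurn a' b' c' \<in> M) \<longleftrightarrow> LeftTurn (f a) (f b) (f c) \<in> M"
    using maximal_LeftTurn[OF M maximal_sym[OF M] maximal_sym[OF M] maximal_sym[OF M]] maximal_refl[OF M] by blast
  then show ?case by (simp add: canonical_sat_def h)
next
  case Falsum
  show ?case using M maximal_def[of M] by (auto simp: canonical_sat_def intro: derives.assumption)
next
  case (Forall A)
  have *: "case_nat (h t) (\<lambda>a. h (f a)) = (\<lambda>a. h (case_nat t f a))" for t
    by (rule ext) (simp split: nat.splits)
  show ?case using Forall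
    by (simp add: canonical_sat_def M maximal_forall inst_lift *)
next
  case (Exists A)
  have *: "case_nat (h t) (\<lambda>a. h (f a)) = (\<lambda>a. h (case_nat t f a))" for t
    by (rule ext) (simp split: nat.splits)
  show ?case using Exists
    by (simp add: canonical_sat_def M maximal_exists inst_lift *)
qed (simp_all add: canonical_sat_def h M maximal_and maximal_or maximal_imp)

end

section \<open>Order on a line\<close>

definition weakly_between :: "('a \<Rightarrow> 'a \<Rightarrow> 'a \<Rightarrow> bool) \<Rightarrow> 'a \<Rightarrow> 'a \<Rightarrow> 'a \<Rightarrow> bool" where
  "weakly_between B a b c \<longleftrightarrow> a = b \<or> b = c \<or> B a b c"

definition in_line :: "('a \<Rightarrow> 'a \<Rightarrow> 'a \<Rightarrow> bool) \<Rightarrow> 'a \<Rightarrow> 'a \<Rightarrow> 'a \<Rightarrow> bool" where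
  "in_line B a b x \<longleftrightarrow> B a b x \<or> B b x a \<or> B x a b \<or> x = a \<or> x = b"

definition on_common_line :: "('a \<Rightarrow> 'a \<Rightarrow> 'a \<Rightarrow> bool) \<Rightarrow> 'a \<Rightarrow> 'a \<Rightarrow> 'a \<Rightarrow> bool" where
  "on_common_line B a b c \<longleftrightarrow> (\<exists>u v. u \<noteq> v \<and> in_line B u v a \<and> in_line B u v b \<and> in_line B u v c)"

definition segment_le ::
  "('a \<Rightarrow> 'a \<Rightarrow> 'a \<Rightarrow> bool) \<Rightarrow> ('a \<Rightarrow> 'a \<Rightarrow> 'a \<Rightarrow> 'a \<Rightarrow> bool) \<Rightarrow> 'a \<Rightarrow> 'a \<Rightarrow> 'a \<Rightarrow> 'a \<Rightarrow> bool" where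
  "segment_le B C a b c d \<longleftrightarrow> (\<exists>e. weakly_between B c e d \<and> C a b c e)"

text \<open>
  The classical reading of those axioms on which the facts about the construction rest.
\<close>

locale plane =
  fixes B :: "'a \<Rightarrow> 'a \<Rightarrow> 'a \<Rightarrow> bool"
    and C :: "'a \<Rightarrow> 'a \<Rightarrow> 'a \<Rightarrow> 'a \<Rightarrow> bool"
    and L :: "'a \<Rightarrow> 'a \<Rightarrow> 'a \<Rightarrow> bool"
  assumes C_swap: "C a b b a"
    and C_trans: "C a b p q \<Longrightarrow> C a b r s \<Longrightarrow> C p q r s"
    and C_null: "C a b c c \<Longrightarrow> a = b"
    and extension: "a \<noteq> b \<Longrightarrow> \<exists>x. weakly_between B a b x \<and> C b x c d"
    and five_segment: "a \<noteq> b \<Longrightarrow> weakly_between B a b c \<Longrightarrow> weakly_between B a' b' c' \<Longrightarrow>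
      C a b a' b' \<Longrightarrow> C b c b' c' \<Longrightarrow> C a d a' d' \<Longrightarrow> C b d b' d' \<Longrightarrow> C c d c' d'"
    and B_sym: "B a b c \<Longrightarrow> B c b a"
    and B_distinct: "B a b c \<Longrightarrow> a \<noteq> b \<and> b \<noteq> c"
    and B_identity: "\<not> B a b a"
    and inner_transitivity: "weakly_between B a b d \<Longrightarrow> weakly_between B b c d \<Longrightarrow>
      weakly_between B a b c \<and> weakly_between B a c d"
    and outer_transitivity: "weakly_between B a b c \<Longrightarrow> weakly_between B b c d \<Longrightarrow> b \<noteq> c \<Longrightarrow>
      weakly_between B a c d \<and> weakly_between B a b d"
    and connectivity: "B a b c \<Longrightarrow> B a b d \<Longrightarrow> weakly_between B a c d \<or> weakly_between B a d c"
    and Pasch: "\<not> on_common_line B a b c \<Longrightarrow> B a p c \<Longrightarrow> B b q c \<Longrightarrow> \<exists>x. B p x b \<and> B q x a"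
    and lower_dimension: "\<exists>a b c. \<not> on_common_line B a b c"
    and upper_dimension: "a \<noteq> b \<Longrightarrow> C p a p b \<Longrightarrow> C q a q b \<Longrightarrow> C r a r b \<Longrightarrow> on_common_line B p q r"
    and circle_circle: "u \<noteq> v \<Longrightarrow> C u y r s \<Longrightarrow> segment_le B C v y r' s' \<Longrightarrow>
      C u z r s \<Longrightarrow> segment_le B C r' s' v z \<Longrightarrow> \<exists>x. C u x r s \<and> C v x r' s'"
    and turn_asym: "L a b c \<Longrightarrow> \<not> L b a c"
    and turn_total: "\<not> on_common_line B a b c \<Longrightarrow> L a b c \<or> L b a c"
    and turn_opposite: "L a b c \<Longrightarrow> in_line B a b y \<Longrightarrow> B c y d \<Longrightarrow> L b a d"
    and circles_meet_left: "\<not> (u = v \<and> C r s r' s') \<Longrightarrow> C u y r s \<Longrightarrow> C v y r' s' \<Longrightarrow>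
      \<exists>w. C u w r s \<and> C v w r' s' \<and> \<not> L v u w"
    and circles_meet_right: "\<not> (u = v \<and> C r s r' s') \<Longrightarrow> C u y r s \<Longrightarrow> C v y r' s' \<Longrightarrow>
      \<exists>w. C u w r s \<and> C v w r' s' \<and> \<not> L u v w"
begin

abbreviation bt :: "'a \<Rightarrow> 'a \<Rightarrow> 'a \<Rightarrow> bool" where
  "bt \<equiv> weakly_between B"

lemma two_points: "\<exists>a b :: 'a. a \<noteq> b"
proof (rule ccontr)
  assume *: "\<not> ?thesis"
  obtain a b c where "\<not> on_common_line B a b c" using lower_dimension by blast
  then have "L a b c \<or> L b a c" by (rule turn_total)
  moreover have "a = b" using * by blast
  ultimately show False using turn_asym by blast
qed

lemma bt_refl [simp]: "bt a a b" "bt a b b"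
  by (simp_all add: weakly_between_def)

lemma B_iff: "B a b c \<longleftrightarrow> bt a b c \<and> a \<noteq> b \<and> b \<noteq> c"
  using B_distinct weakly_between_def by metis

lemma bt_sym: "bt a b c \<Longrightarrow> bt c b a"
  using B_sym by (auto simp: weakly_between_def)

lemma bt_identity: "bt a b a \<Longrightarrow> a = b"
  using B_identity by (auto simp: weakly_between_def)

lemma bt_inner1: "bt a b d \<Longrightarrow> bt b c d \<Longrightarrow> bt a b c"
  using inner_transitivity by blast

lemma bt_inner2: "bt a b d \<Longrightarrow> bt b c d \<Longrightarrow> bt a c d"
  using inner_transitivity by blast

lemma bt_outer1: "bt a b c \<Longrightarrow> bt b c d \<Longrightarrow> b \<noteq> c \<Longrightarrow> bt a c d"
  using outer_transitivity by blast

lemma bt_outer2: "bt a b c \<Longrightarrow> bt b c d \<Longrightarrow> b \<noteq> c \<Longrightarrow> bt a b d"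
  using outer_transitivity by blast

lemma bt_antisym: "bt a b c \<Longrightarrow> bt b a c \<Longrightarrow> a = b"
  by (metis bt_identity bt_inner1)

lemma bt_prefix1: "bt a b c \<Longrightarrow> bt a c d \<Longrightarrow> bt b c d"
  by (meson bt_inner1 bt_sym)

lemma bt_prefix2: "bt a b c \<Longrightarrow> bt a c d \<Longrightarrow> bt a b d"
  by (meson bt_inner2 bt_sym)

lemma bt_connect: "a \<noteq> b \<Longrightarrow> bt a b c \<Longrightarrow> bt a b d \<Longrightarrow> bt a c d \<or> bt a d c"
  using connectivity by (metis weakly_between_def)

lemma bt_connect_tail: "a \<noteq> b \<Longrightarrow> bt a b c \<Longrightarrow> bt a b d \<Longrightarrow> bt b c d \<or> bt b d c"
  by (meson bt_connect bt_prefix1)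

text \<open>
  The extension axiom may return the endpoint itself when the segment laid off is null, so a segment
  known to be proper is laid off.
\<close>

lemma extend_distinct:
  assumes "a \<noteq> b" shows "\<exists>x. B a b x"
proof -
  obtain u v :: 'a where uv: "u \<noteq> v" using two_points by blast
  obtain x where "bt a b x" "C b x u v" using extension[OF assms] by blast
  moreover have "b \<noteq> x"
    using C_null[of u v b] C_trans[of b x u v b b] C_swap[of b b] uv calculation by blast
  ultimately show ?thesis using assms by (auto simp: B_iff)
qed

lemma bt_connect_inner:
  assumes "bt a b d" "bt a c d" shows "bt a b c \<or> bt a c b"
proof (cases "a = d")
  case True then show ?thesis using assms bt_identity by fastforce
next
  case False
  then obtain e where "bt e a d" "e \<noteq> a" using extend_distinct[of d a] by (metis B_iff bt_sym)
  then show ?thesis using assms by (meson bt_connect_tail bt_inner1)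
qed

definition Col :: "'a \<Rightarrow> 'a \<Rightarrow> 'a \<Rightarrow> bool" where
  "Col a b c \<longleftrightarrow> bt a b c \<or> bt b c a \<or> bt c a b"

lemma Col_rotate: "Col a b c \<Longrightarrow> Col b c a"
  by (auto simp: Col_def)

lemma Col_swap: "Col a b c \<Longrightarrow> Col b a c"
  by (auto simp: Col_def dest: bt_sym)

lemma Col_triv [simp]: "Col a a b" "Col a b b" "Col a b a"
  by (auto simp: Col_def)

lemma Col_trans:
  assumes "a \<noteq> b" "Col a b c" "Col a b d"
  shows "Col a c d"
proof -
  consider "bt a b c" "bt a b d" | "bt a b c" "bt a d b" | "bt a b c" "bt d a b"
    | "bt a c b" "bt a b d" | "bt a c b" "bt a d b" | "bt a c b" "bt d a b"
    | "bt c a b" "bt a b d" | "bt c a b" "bt a d b" | "bt c a b" "bt d a b"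
    using assms(2,3) bt_sym by (auto simp: Col_def)
  then show ?thesis
  proof cases
    case 1 then show ?thesis using bt_connect[OF assms(1)] bt_sym[of a d c] unfolding Col_def by blast
  next
    case 2 then show ?thesis using bt_prefix2[of a d b c] bt_sym[of a d c] unfolding Col_def by blast
  next
    case 3 then show ?thesis using bt_outer2[of d a b c] assms(1) bt_sym[of d a c] unfolding Col_def by blast
  next
    case 4 then show ?thesis using bt_prefix2[of a c b d] unfolding Col_def by blast
  next
    case 5 then show ?thesis using bt_connect_inner[of a c b d] bt_sym[of a d c] unfolding Col_def by blast
  next
    case 6 then show ?thesis using bt_inner1[of d a c b] bt_prefix1 bt_sym unfolding Col_def by meson
  next
    case 7 then show ?thesis using bt_outer2[of c a b d] assms(1) bt_sym[of c a d] unfolding Col_def by blast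
  next
    case 8 then show ?thesis using bt_inner1[of c a b d] bt_sym[of c a d] unfolding Col_def by blast
  next
    case 9 then show ?thesis
      using bt_connect_tail[of b a c d] assms(1) bt_sym[of c a b] bt_sym[of d a b] bt_sym[of a d c]
      unfolding Col_def by blast
  qed
qed

lemma in_line_iff: "a \<noteq> b \<Longrightarrow> in_line B a b x \<longleftrightarrow> Col a b x"
  unfolding in_line_def Col_def using B_iff bt_sym by (metis bt_refl)

lemma Col_on_line:
  assumes "u \<noteq> v" "Col u v a" "Col u v b" "Col u v c" shows "Col a b c"
  using assms by (metis Col_rotate Col_swap Col_trans)

lemma on_common_line_iff: "on_common_line B a b c \<longleftrightarrow> Col a b c"
proof
  assume "on_common_line B a b c"
  then show "Col a b c" using Col_on_line by (auto simp: on_common_line_def in_line_iff)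
next
  assume *: "Col a b c"
  obtain w where "w \<noteq> a" using two_points by metis
  consider "a \<noteq> b" | "a = b" "a \<noteq> c" | "a = b" "a = c" by blast
  then show "on_common_line B a b c"
  proof cases
    case 1
    then have "in_line B a b a \<and> in_line B a b b \<and> in_line B a b c" using * by (simp add: in_line_iff)
    then show ?thesis using 1 unfolding on_common_line_def by blast
  next
    case 2
    then have "in_line B a c a \<and> in_line B a c b \<and> in_line B a c c" by (simp add: in_line_iff)
    then show ?thesis using 2 unfolding on_common_line_def by blast
  next
    case 3
    then have "in_line B w a a \<and> in_line B w a b \<and> in_line B w a c"
      using \<open>w \<noteq> a\<close> by (simp add: in_line_iff)
    then show ?thesis using \<open>w \<noteq> a\<close> unfolding on_common_line_def by blast
  qed
qed

section \<open>Congruence\<close>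

text \<open>
  The class of all segments congruent to \<open>ab\<close>. Congruence becomes equality of lengths, so that reflexivity,
  symmetry and transitivity are left to the logic.
\<close>

definition len :: "'a \<Rightarrow> 'a \<Rightarrow> ('a \<times> 'a) set" where
  "len a b = {(c, d). C a b c d}"

lemma C_refl: "C a b a b"
  using C_trans[OF C_swap[of b a] C_swap[of b a]] .

lemma C_iff: "C a b c d \<longleftrightarrow> len a b = len c d"
proof
  assume "C a b c d" then show "len a b = len c d"
    unfolding len_def using C_trans[of a b c d] C_trans[of c d a b] C_trans[of a b c d a b] C_refl[of a b]
    by blast
next
  assume "len a b = len c d" then show "C a b c d"
    using C_refl[of c d] by (auto simp: len_def)
qed

lemma len_commute: "len a b = len b a"
  using C_swap[of a b] by (simp add: C_iff)

lemma len_null_eq: "len a a = len b b"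
proof -
  obtain u v :: 'a where uv: "u \<noteq> v" using two_points by blast
  obtain w where "w \<noteq> a" using uv by metis
  then obtain x where "bt w a x" "C a x b b" using extension by blast
  then show ?thesis using C_null[of a x b] by (auto simp: C_iff)
qed

lemma len_null: "len a b = len c c \<longleftrightarrow> a = b"
  using C_null[of a b c] len_null_eq[of a c] by (auto simp: C_iff)

lemma len_null': "len c c = len a b \<longleftrightarrow> a = b"
  using len_null[of a b c] by auto

lemma extend: "a \<noteq> b \<Longrightarrow> \<exists>x. bt a b x \<and> len b x = len c d"
  using extension by (simp add: C_iff)

lemma five: "a \<noteq> b \<Longrightarrow> bt a b c \<Longrightarrow> bt a' b' c' \<Longrightarrow> len a b = len a' b' \<Longrightarrow> len b c = len b' c' \<Longrightarrow>
    len a d = len a' d' \<Longrightarrow> len b d = len b' d' \<Longrightarrow> len c d = len c' d'"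
  unfolding C_iff[symmetric] by (fact five_segment)

lemma len_add:
  assumes "bt a b c" "bt a' b' c'" "len a b = len a' b'" "len b c = len b' c'"
  shows "len a c = len a' c'"
proof (cases "a = b")
  case True
  then have "a' = b'" using assms(3) by (simp add: len_null')
  then show ?thesis using True assms(4) by simp
next
  case False
  have "len c a = len c' a'"
  proof (rule five[OF False assms])
    show "len a a = len a' a'" by (rule len_null_eq)
    show "len b a = len b' a'" using assms(3) len_commute[of a b] len_commute[of a' b'] by argo
  qed
  then show ?thesis using len_commute[of a c] len_commute[of a' c'] by argo
qed

lemma extend_unique:
  assumes "a \<noteq> b" "bt a b x" "bt a b y" "len b x = len b y" shows "x = y"
proof -
  have "len a x = len a y" using len_add[OF assms(2,3) refl assms(4)] .
  then have "len x x = len x y" using five[OF assms(1,2,2) refl refl, of x y] assms(4) by blast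
  then show ?thesis by (simp add: len_null')
qed

text \<open>
  The five-segment axiom moves outward from \<open>ab\<close> to \<open>c\<close>. To move inward, prolong \<open>ac\<close> beyond \<open>c\<close> to \<open>e\<close>, compare
  \<open>ed\<close> by the axiom, and come back from \<open>e\<close>.
\<close>

lemma inner_five:
  assumes "bt a b c" "bt a' b' c'" "len a c = len a' c'" "len b c = len b' c'"
    "len a d = len a' d'" "len c d = len c' d'"
  shows "len b d = len b' d'"
proof (cases "a = c")
  case True
  then have "a' = c'" using assms(3) by (simp add: len_null')
  then have "b' = a'" using assms(2) bt_identity by blast
  moreover have "b = a" using assms(1) True bt_identity by blast
  ultimately show ?thesis using assms(5) by simp
next
  case False
  then have n: "a' \<noteq> c'" using assms(3) by (auto simp: len_null)
  obtain e where e: "bt a c e" "c \<noteq> e" using extend_distinct[OF False] B_iff by blast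
  obtain e' where e': "bt a' c' e'" "len c' e' = len c e" using extend[OF n] by blast
  have "len e d = len e' d'"
    by (rule five[OF False e(1) e'(1) assms(3) _ assms(5,6)]) (simp add: e'(2))
  moreover have "bt e c b" "bt e' c' b'" using assms(1,2) e(1) e'(1) bt_prefix1 bt_sym by blast+
  moreover have "len e c = len e' c'" "len c b = len c' b'"
    using e' assms(4) len_commute[of e c] len_commute[of e' c'] len_commute[of c b] len_commute[of c' b']
    by argo+
  ultimately show ?thesis
    using five[of e c b e' c' b' d d'] e(2) assms(6) \<open>len e d = len e' d'\<close> by simp
qed

lemma len_subtract:
  assumes "bt a b c" "bt a' b' c'" "len a c = len a' c'" "len b c = len b' c'"
  shows "len a b = len a' b'"
  using inner_five[OF assms len_null_eq[of a a']] assms(3) len_commute[of c a] len_commute[of c' a']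
    len_commute[of b a] len_commute[of b' a'] by argo

lemma len_subtract':
  assumes "bt a b c" "bt a' b' c'" "len a c = len a' c'" "len a b = len a' b'"
  shows "len b c = len b' c'"
  using len_subtract[of c b a c' b' a'] assms bt_sym[of a b c] bt_sym[of a' b' c']
    len_commute[of c a] len_commute[of c' a'] len_commute[of b a] len_commute[of b' a']
    len_commute[of c b] len_commute[of c' b'] by argo

lemma bt_len_eq: "bt a b c \<Longrightarrow> len a b = len a c \<Longrightarrow> b = c"
  using len_subtract'[of a b c a c c] by (simp add: len_null)

lemma transport_bt:
  assumes "bt a b c" "len a c = len a' c'"
  shows "\<exists>b'. bt a' b' c' \<and> len a b = len a' b' \<and> len b c = len b' c'"
proof (cases "a = c")
  case True
  then have "a' = c'" "b = a" using assms bt_identity by (auto simp: len_null')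
  then show ?thesis using True using len_null_eq[of c c'] by (intro exI[of _ a']) simp
next
  case False
  then have n: "a' \<noteq> c'" using assms(2) by (auto simp: len_null)
  obtain x where x: "bt c' a' x" "a' \<noteq> x" using extend_distinct[of c' a'] n B_iff by blast
  obtain b' where b': "bt x a' b'" "len a' b' = len a b" using extend[of x a'] x by blast
  show ?thesis
  proof (cases "a = b")
    case True
    then show ?thesis using assms len_null_eq[of a a'] by (intro exI[of _ a']) simp
  next
    case 2: False
    then have "x \<noteq> b'" using b'(1) bt_identity x(2) by blast
    then obtain c'' where c'': "bt x b' c''" "len b' c'' = len b c" using extend by blast
    have "bt a' b' c''" using b'(1) c''(1) bt_prefix1 by blast
    moreover then have "len a' c'' = len a c" using len_add[of a' b' c'' a b c] b' c'' assms(1) by simp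
    moreover have "bt x a' c''" using b'(1) c''(1) bt_prefix2 by blast
    ultimately have "c'' = c'" using extend_unique[of x a' c'' c'] x assms(2) bt_sym[of c' a' x] by simp
    then show ?thesis using \<open>bt a' b' c''\<close> b' c'' by auto
  qed
qed

lemma bt_transfer:
  assumes "bt a b c" "len a b = len a' b'" "len b c = len b' c'" "len a c = len a' c'"
  shows "bt a' b' c'"
proof -
  obtain b'' where b'': "bt a' b'' c'" "len a b = len a' b''" "len b c = len b'' c'"
    using transport_bt[OF assms(1,4)] by blast
  have "len b b = len b'' b'"
    using inner_five[OF assms(1) b''(1) assms(4) b''(3), of b b'] assms(2,3)
    len_commute[of c b] len_commute[of c' b'] by argo
  then have "b'' = b'" by (simp add: len_null')
  then show ?thesis using b'' by simp
qed

lemma equidistant_on_line: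
  assumes "a \<noteq> b" "Col a b c" "len a p = len a q" "len b p = len b q"
  shows "len c p = len c q"
proof -
  consider "bt a b c" | "bt b c a" | "bt c a b" using assms(2) by (auto simp: Col_def)
  then show ?thesis
  proof cases
    case 1 then show ?thesis using five[OF assms(1) 1 1 refl refl assms(3,4)] by simp
  next
    case 2 then show ?thesis using inner_five[OF 2 2 refl refl assms(4,3)] by simp
  next
    case 3
    then have "bt b a c" by (rule bt_sym)
    then show ?thesis using five[of b a c b a c p q] assms by simp
  qed
qed

lemma equidistant_point_unique:
  assumes "a \<noteq> b" "Col a b c" "len a c = len a d" "len b c = len b d"
  shows "c = d"
  using equidistant_on_line[OF assms] by (simp add: len_null')

definition cong3 :: "'a \<Rightarrow> 'a \<Rightarrow> 'a \<Rightarrow> 'a \<Rightarrow> 'a \<Rightarrow> 'a \<Rightarrow> bool" where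
  "cong3 a b c a' b' c' \<longleftrightarrow> len a b = len a' b' \<and> len b c = len b' c' \<and> len a c = len a' c'"

lemma cong3_rotate: "cong3 a b c a' b' c' \<Longrightarrow> cong3 b c a b' c' a'"
  unfolding cong3_def using len_commute[of a b] len_commute[of a' b'] len_commute[of a c] len_commute[of a' c']
  by metis

lemma cong3_swap: "cong3 a b c a' b' c' \<Longrightarrow> cong3 b a c b' a' c'"
  unfolding cong3_def using len_commute[of a b] len_commute[of a' b'] by metis

lemma bt_cong3: "bt a b c \<Longrightarrow> cong3 a b c a' b' c' \<Longrightarrow> bt a' b' c'"
  using bt_transfer by (simp add: cong3_def)

lemma Col_cong3: "Col a b c \<Longrightarrow> cong3 a b c a' b' c' \<Longrightarrow> Col a' b' c'"
  unfolding Col_def by (meson bt_cong3 cong3_rotate)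

lemma five_Col:
  assumes "Col a b c" "cong3 a b c a' b' c'" "len a d = len a' d'" "len b d = len b' d'" "a \<noteq> b"
  shows "len c d = len c' d'"
proof -
  have c: "len a b = len a' b'" "len b c = len b' c'" "len a c = len a' c'"
    "len b a = len b' a'" "len c a = len c' a'"
    using assms(2) cong3_rotate[OF assms(2)] cong3_swap[OF assms(2)] cong3_rotate[OF cong3_rotate[OF assms(2)]]
    by (auto simp: cong3_def)
  consider "bt a b c" | "bt b c a" | "bt c a b" using assms(1) by (auto simp: Col_def)
  then show ?thesis
  proof cases
    case 1
    then have "bt a' b' c'" using assms(2) bt_cong3 by blast
    then show ?thesis using five[OF assms(5) 1 _ c(1,2) assms(3,4)] by blast
  next
    case 2
    have "bt b' c' a'" using bt_cong3[OF 2 cong3_rotate[OF assms(2)]] .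
    then show ?thesis using inner_five[OF 2 _ c(4) c(5) assms(4,3)] by blast
  next
    case 3
    then have "bt b a c" by (rule bt_sym)
    moreover have "bt b' a' c'" using bt_cong3[OF calculation cong3_swap[OF assms(2)]] .
    ultimately show ?thesis using five[of b a c b' a' c' d d'] assms(5) c assms(3,4) by blast
  qed
qed

lemma transport_Col:
  assumes "Col a b c" "len a b = len a' b'" "a \<noteq> b"
  shows "\<exists>c'. cong3 a b c a' b' c'"
proof -
  have n: "a' \<noteq> b'" using assms by (auto simp: len_null)
  consider "bt a b c" | "bt b c a" | "bt c a b" using assms(1) by (auto simp: Col_def)
  then show ?thesis
  proof cases
    case 1
    obtain c' where "bt a' b' c'" "len b' c' = len b c" using extend[OF n] by blast
    then have "cong3 a b c a' b' c'" using 1 len_add[of a b c a' b' c'] assms(2) by (simp add: cong3_def)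
    then show ?thesis by blast
  next
    case 2
    have "len b a = len b' a'" using assms(2) len_commute[of a b] len_commute[of a' b'] by metis
    then obtain c' where "len b c = len b' c'" "len c a = len c' a'" using transport_bt[OF 2] by blast
    then have "cong3 a b c a' b' c'" using assms(2) len_commute[of c a] len_commute[of c' a']
      unfolding cong3_def by metis
    then show ?thesis by blast
  next
    case 3
    obtain c' where c': "bt b' a' c'" "len a' c' = len a c" using extend[of b' a'] n by metis
    have "len b a = len b' a'" using assms(2) len_commute[of a b] len_commute[of a' b'] by metis
    then have "len b c = len b' c'" using len_add[OF bt_sym[OF 3] c'(1)] c'(2) by metis
    then have "cong3 a b c a' b' c'" using assms(2) c'(2) unfolding cong3_def by metis
    then show ?thesis by blast
  qed
qed

section \<open>Midpoints and half-turns\<close>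

definition Mid :: "'a \<Rightarrow> 'a \<Rightarrow> 'a \<Rightarrow> bool" where
  "Mid m p q \<longleftrightarrow> bt p m q \<and> len p m = len m q"

lemma Mid_sym: "Mid m p q \<Longrightarrow> Mid m q p"
  unfolding Mid_def using bt_sym len_commute[of p m] len_commute[of m q] by auto

lemma Mid_refl [simp]: "Mid m m m" by (simp add: Mid_def)

lemma Mid_Col: "Mid m p q \<Longrightarrow> Col p m q" by (simp add: Mid_def Col_def)

lemma Mid_self: "Mid m m q \<Longrightarrow> q = m" by (auto simp: Mid_def len_null')

lemma Mid_self': "Mid m p m \<Longrightarrow> p = m" by (auto simp: Mid_def len_null)

lemma Mid_same: "Mid m p p \<Longrightarrow> p = m" using bt_identity by (auto simp: Mid_def)

lemma reflect: "\<exists>q. Mid m p q"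
proof (cases "p = m")
  case False
  then obtain q where "bt p m q" "len m q = len p m" using extend by blast
  then show ?thesis unfolding Mid_def by metis
qed (auto intro: Mid_refl)

lemma Mid_unique: "Mid m p q \<Longrightarrow> Mid m p q' \<Longrightarrow> q = q'"
  using extend_unique[of p m q q'] Mid_self by (cases "p = m") (auto simp: Mid_def len_null')

text \<open>
  A half-turn is an isometry. Prolonging \<open>pp'\<close> at both ends by \<open>mq\<close> and \<open>qq'\<close> by \<open>mp\<close> gives two segments \<open>xx'\<close>
  and \<open>yy'\<close> of equal length with common midpoint \<open>m\<close>. For these the five-segment axiom applies
  symmetrically, and its inner form carries the result back to \<open>p\<close> and \<open>q\<close>.
\<close>

lemma half_turn_len:
  assumes pp: "Mid m p p'" and qq: "Mid m q q'"
  shows "len p q = len p' q'"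
proof (cases "p = m \<or> q = m")
  case True
  then show ?thesis
  proof
    assume "p = m"
    then show ?thesis using Mid_self[of m p'] pp qq len_commute[of q m] by (auto simp: Mid_def)
  next
    assume "q = m"
    then show ?thesis using Mid_self[of m q'] pp qq len_commute[of p' m] by (auto simp: Mid_def)
  qed
next
  case False
  have p: "bt p m p'" "len m p = len m p'" and q: "bt q m q'" "len m q = len m q'"
    using pp qq len_commute[of p m] len_commute[of q m] by (auto simp: Mid_def)
  have ne: "p \<noteq> m" "q \<noteq> m" "p' \<noteq> m" "q' \<noteq> m"
    using False Mid_self'[of m p] Mid_self'[of m q] pp qq by auto
  have nn: "p \<noteq> p'" "q \<noteq> q'" using pp qq ne Mid_same by blast+
  obtain x where x: "bt p' p x" "len p x = len m q" using extend[of p' p] nn by metis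
  obtain x' where x': "bt p p' x'" "len p' x' = len m q" using extend[of p p'] nn by metis
  obtain y where y: "bt q' q y" "len q y = len m p" using extend[of q' q] nn by metis
  obtain y' where y': "bt q q' y'" "len q' y' = len m p" using extend[of q q'] nn by metis
  have o: "bt m p x" "bt m p' x'" "bt m q y" "bt m q' y'"
    using x x' y y' p q bt_prefix1 bt_sym by blast+
  have l: "len m x = len m x'" "len m y = len m y'" "len m x = len m y"
  proof -
    show "len m x = len m x'" by (rule len_add[OF o(1,2) p(2)]) (simp add: x x')
    show "len m y = len m y'" by (rule len_add[OF o(3,4) q(2)]) (simp add: y y')
    show "len m x = len m y"
      using len_add[OF o(1) bt_sym[OF o(3)]] x(2) y(2) len_commute[of q y] len_commute[of m q] len_commute[of y m]
      by metis
  qed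
  have "bt p m x'" using bt_prefix2[OF p(1) x'(1)] .
  have xmx: "bt x m x'" using bt_outer1[OF bt_sym[OF o(1)] \<open>bt p m x'\<close>] bt_outer2[OF bt_sym[OF o(1)] \<open>bt p m x'\<close>] ne by blast
  have "bt q m y'" using bt_prefix2[OF q(1) y'(1)] .
  have ymy: "bt y m y'" using bt_outer1[OF bt_sym[OF o(3)] \<open>bt q m y'\<close>] bt_outer2[OF bt_sym[OF o(3)] \<open>bt q m y'\<close>] ne by blast
  have xm: "x \<noteq> m" "y \<noteq> m" "x' \<noteq> m" "y' \<noteq> m"
    using o ne bt_identity by blast+
  have c: "len x m = len m x" "len x' m = len m x'" "len y m = len m y" "len y' m = len m y'"
    by (rule len_commute)+
  have 1: "len x' y = len y' x"
    using five[OF xm(1) xmx ymy, of y x] l c len_commute[of x y] by metis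
  have 2: "len x y = len x' y'"
    using five[OF xm(3) bt_sym[OF xmx] xmx, of y y'] l c 1 len_commute[of y' x] by metis
  have xx: "len x x' = len x' x" "len y y' = len y' y" by (rule len_commute)+
  have px: "len p x' = len p' x"
    using len_add[OF \<open>bt p m x'\<close>, of p' m x] bt_prefix2[OF bt_sym[OF p(1)] x(1)] p(2) l
      len_commute[of p m] len_commute[of p' m] by metis
  have qy: "len q y' = len q' y"
    using len_add[OF \<open>bt q m y'\<close>, of q' m y] bt_prefix2[OF bt_sym[OF q(1)] y(1)] q(2) l
      len_commute[of q m] len_commute[of q' m] by metis
  have B: "bt y q y'" "bt y' q' y" "bt x p x'" "bt x' p' x"
    using bt_inner2 o xmx ymy bt_sym bt_prefix2 by meson+
  have 3: "len q x = len q' x'"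
    using inner_five[OF B(1,2) xx(2) qy, of x x'] 1 2 len_commute[of x y] len_commute[of x' y'] len_commute[of y' x] len_commute[of x' y]
    by metis
  have 4: "len q x' = len q' x"
    using inner_five[OF B(1,2) xx(2) qy, of x' x] 1 2 len_commute[of x y] len_commute[of x' y'] len_commute[of y' x] len_commute[of x' y]
    by metis
  show ?thesis
    using inner_five[OF B(3,4) xx(1) px, of q q'] 3 4 len_commute[of x q] len_commute[of x' q] len_commute[of x q'] len_commute[of x' q']
    by metis
qed

lemma Mid_len: "Mid m p q \<Longrightarrow> len m p = len m q"
  unfolding Mid_def using len_commute[of p m] by metis

lemma Pasch_Col: "\<not> Col a b c \<Longrightarrow> B a p c \<Longrightarrow> B b q c \<Longrightarrow> \<exists>x. B p x b \<and> B q x a"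
  using Pasch by (simp add: on_common_line_iff)

lemma equidistant_Col:
  "a \<noteq> b \<Longrightarrow> len p a = len p b \<Longrightarrow> len q a = len q b \<Longrightarrow> len r a = len r b \<Longrightarrow> Col p q r"
  using upper_dimension[of a b p q r] by (simp add: on_common_line_iff C_iff)

lemma B_Col: "B a b c \<Longrightarrow> Col a b c" "B a b c \<Longrightarrow> Col a c b"
  by (auto simp: B_iff Col_def dest: bt_sym)

lemma Col_join:
  assumes "a \<noteq> b" "Col a b p" "Col a b q" "p \<noteq> q" "Col p q r" shows "Col a b r"
proof -
  have "Col p q a" "Col p q b" using Col_on_line[OF assms(1-3)] by simp_all
  then show ?thesis using Col_on_line[OF assms(4)] assms(5) by blast
qed

lemma lines_meet_once:
  assumes "\<not> Col a b u" "a \<noteq> b" "Col a b p" "Col a b q" "u \<noteq> v" "Col u v p" "Col u v q"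
  shows "p = q"
proof (rule ccontr)
  assume "p \<noteq> q"
  moreover have "Col p q u" using Col_on_line[of u v p q u] assms by simp
  moreover have "Col p q a" "Col p q b" using Col_on_line[of a b p q] assms by simp_all
  ultimately show False using Col_on_line[of p q a b u] assms(1) by simp
qed

text \<open>
  The sides \<open>ca\<close> and \<open>cb\<close> of an isosceles triangle are prolonged equally to \<open>P\<close> and \<open>Q\<close>; the segments \<open>aQ\<close> and
  \<open>bP\<close> cross at \<open>R\<close>, which by symmetry is equidistant from \<open>a\<close> and \<open>b\<close>. So is every point of the line \<open>cR\<close>, in
  particular its crossing \<open>X\<close> with \<open>ab\<close>. Both crossings come from inner Pasch, so the midpoint exists
  constructively.
\<close>

lemma isosceles_midpoint:
  assumes n: "\<not> Col c a b" and ca: "len c a = len c b" and P: "B c a P" and Q: "B c b Q"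
    and PQ: "len a P = len b Q" and R: "B a R Q" "B b R P" and X: "B a X b" "B R X c"
  shows "Mid X a b"
proof -
  have Pb: "len P b = len Q a"
    by (rule five[OF _ _ _ ca PQ ca[symmetric] len_commute]) (use P Q in \<open>auto simp: B_iff\<close>)
  then have aQ: "len a Q = len b P" using len_commute[of P b] len_commute[of Q a] by metis
  have "bt a R Q" "bt b R P" using R by (auto simp: B_iff)
  obtain R' where R': "bt b R' P" "len a R = len b R'" "len R Q = len R' P"
    using transport_bt[OF \<open>bt a R Q\<close> aQ] by blast
  have "len R b = len R' a"
    by (rule inner_five[OF \<open>bt a R Q\<close> R'(1) aQ R'(3) len_commute])
      (use PQ len_commute[of Q b] len_commute[of P a] in metis)
  moreover have "len R P = len R' Q"
    by (rule inner_five[OF \<open>bt a R Q\<close> R'(1) aQ R'(3) PQ len_commute])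
  ultimately have "cong3 b R P a R' Q"
    unfolding cong3_def using aQ len_commute[of R b] len_commute[of R' a] by metis
  then have "bt a R' Q" using \<open>bt b R P\<close> bt_cong3 by blast
  have d: "c \<noteq> b" "b \<noteq> Q" "a \<noteq> Q" "b \<noteq> P" "c \<noteq> a" "a \<noteq> P" using P Q R bt_identity by (auto simp: B_iff)
  have "\<not> Col a Q b"
  proof
    assume "Col a Q b"
    moreover have "Col b Q c" using B_Col[OF Q] Col_rotate Col_swap by blast
    ultimately have "Col c a b" using Col_on_line[of b Q c a b] d Col_rotate Col_swap by (metis Col_triv)
    then show False using n by blast
  qed
  then have "R = R'"
    by (rule lines_meet_once[of a Q b R R' P])
      (use d \<open>bt a R Q\<close> \<open>bt a R' Q\<close> \<open>bt b R P\<close> R'(1) bt_sym in \<open>auto simp: Col_def\<close>)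
  then have Rab: "len R a = len R b" using R'(2) len_commute[of a R] len_commute[of b R] by metis
  have "c \<noteq> R"
  proof
    assume "c = R"
    then have "Col a Q b" using B_Col[OF Q] B_Col[OF R(1)] d(1) Col_on_line[of c Q a Q b] Q bt_identity
      by (metis B_iff Col_rotate Col_swap Col_triv(2))
    then show False using \<open>\<not> Col a Q b\<close> by blast
  qed
  moreover have "Col c R X" using B_Col[OF X(2)] Col_rotate by blast
  ultimately have "len X a = len X b" using equidistant_on_line[OF _ _ ca Rab] by simp
  moreover have "bt a X b" using X(1) by (simp add: B_iff)
  ultimately show ?thesis unfolding Mid_def using len_commute[of a X] by metis
qed

lemma isosceles_crossings:
  assumes "\<not> Col c a b" "B c a P" "B c b Q"
  shows "\<not> Col P Q c" "\<not> Col c b P"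
proof -
  have d: "c \<noteq> b" "c \<noteq> Q" "c \<noteq> a" "c \<noteq> P" using assms bt_identity by (auto simp: B_iff)
  have "Col c P a" "Col c Q b" using assms B_Col by blast+
  then show "\<not> Col c b P" "\<not> Col P Q c"
    using assms(1) d Col_trans Col_rotate Col_swap by meson+
qed

lemma equilateral_noncollinear:
  assumes "p \<noteq> q" "len p y = len p q" "len q y = len q p"
  shows "\<not> Col y p q"
proof
  assume "Col y p q"
  then consider "bt p y q" | "bt q p y" | "bt p q y" using bt_sym by (auto simp: Col_def)
  then show False
  proof cases
    case 1 then have "y = q" using bt_len_eq assms(2) by blast
    then show False using assms len_null' by metis
  next
    case 2 then have "p = y" using bt_len_eq assms(3) by metis
    then show False using assms len_null' by metis
  next
    case 3 then have "q = y" using bt_len_eq assms(2) by metis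
    then show False using assms len_null' by metis
  qed
qed

lemma equilateral_triangle:
  assumes "p \<noteq> q" shows "\<exists>y. len p y = len p q \<and> len q y = len q p"
proof -
  obtain z where z: "bt q p z" "len p z = len p q" using extend[of q p] assms by metis
  have "segment_le B C q q q p" unfolding segment_le_def by (intro exI[of _ q]) (simp add: C_iff)
  moreover have "segment_le B C q p q z"
    unfolding segment_le_def using z(1) by (intro exI[of _ p]) (simp add: C_iff)
  ultimately show ?thesis using circle_circle[OF assms, of q p q q p z] z(2) by (simp add: C_iff)
qed

lemma midpoint: "\<exists>m. Mid m p q"
proof (cases "p = q")
  case False
  obtain y where y: "len p y = len p q" "len q y = len q p" using equilateral_triangle[OF False] by blast
  then have n: "\<not> Col y p q" using equilateral_noncollinear[OF False] by blast
  have d: "y \<noteq> p" "y \<noteq> q" using n by auto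
  obtain P where P: "B y p P" using extend_distinct[OF d(1)] by blast
  obtain Q where Q: "bt y q Q" "len q Q = len p P" using extend[OF d(2)] by blast
  have "B y q Q" using Q P d by (auto simp: B_iff len_null' len_null)
  obtain R where R: "B p R Q" "B q R P"
    using Pasch_Col[of P Q y p q] isosceles_crossings(1)[OF n P \<open>B y q Q\<close>] P \<open>B y q Q\<close> B_sym by blast
  obtain X where "B p X q" "B R X y"
    using Pasch_Col[of y q P p R] isosceles_crossings(2)[OF n P \<open>B y q Q\<close>] P R by blast
  moreover have "len y p = len y q" using y len_commute[of y p] len_commute[of y q] len_commute[of p q] by metis
  ultimately show ?thesis using isosceles_midpoint[OF n _ P \<open>B y q Q\<close> _ R] Q(2) by metis
qed (auto intro: Mid_refl)

section \<open>Right angles and perpendiculars\<close>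

text \<open>
  The angle \<open>x f p\<close> is right: \<open>x\<close> is equidistant from \<open>p\<close> and its reflection in \<open>f\<close>. The degenerate cases
  \<open>f = x\<close> and \<open>f = p\<close> are included.
\<close>

definition Per :: "'a \<Rightarrow> 'a \<Rightarrow> 'a \<Rightarrow> bool" where
  "Per x f p \<longleftrightarrow> (\<exists>q. Mid f p q \<and> len x p = len x q)"

lemma PerD: "Per x f p \<Longrightarrow> Mid f p q \<Longrightarrow> len x p = len x q"
  unfolding Per_def using Mid_unique by blast

lemma Per_sym: assumes "Per x f p" shows "Per p f x"
proof -
  obtain q where q: "Mid f p q" "len x p = len x q" using assms by (auto simp: Per_def)
  obtain x' where x': "Mid f x x'" using reflect by blast
  have "len p x' = len q x" using half_turn_len[OF q(1) Mid_sym[OF x']] .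
  then have "len p x = len p x'" using q(2) len_commute[of x p] len_commute[of x q] by metis
  then show ?thesis using x' by (auto simp: Per_def)
qed

lemma Per_Col:
  assumes "Per x f p" "f \<noteq> p" "Col f p p2" shows "Per x f p2"
proof -
  obtain q where q: "Mid f p q" "len x p = len x q" using assms by (auto simp: Per_def)
  obtain q2 where q2: "Mid f p2 q2" using reflect by blast
  have "cong3 f p p2 f q q2"
    using half_turn_len[OF q(1) q2] Mid_len[OF q(1)] Mid_len[OF q2] by (simp add: cong3_def)
  then have "len p2 x = len q2 x"
    by (rule five_Col[OF assms(3) _ refl _ assms(2)])
      (use q(2) len_commute[of x p] len_commute[of x q] in metis)
  then show ?thesis unfolding Per_def using q2 len_commute[of p2 x] len_commute[of q2 x] by metis
qed

lemma Per_cong3: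
  assumes "Per a b c" "cong3 a b c a' b' c'" shows "Per a' b' c'"
proof (cases "b = c")
  case True
  then have "b' = c'" using assms(2) by (auto simp: cong3_def len_null')
  then show ?thesis by (auto simp: Per_def intro!: exI[of _ c'])
next
  case False
  obtain d where d: "Mid b c d" "len a c = len a d" using assms by (auto simp: Per_def)
  obtain d' where d': "Mid b' c' d'" using reflect by blast
  have c: "len c b = len c' b'" "len c a = len c' a'" "len b a = len b' a'" "len a c = len a' c'"
    using assms(2) cong3_rotate[OF assms(2)] cong3_swap[OF assms(2)] cong3_rotate[OF cong3_swap[OF assms(2)]]
      cong3_rotate[OF cong3_rotate[OF cong3_swap[OF assms(2)]]]
    by (auto simp: cong3_def)
  have "len d a = len d' a'"
    using five[of c b d c' b' d' a a'] False d(1) d' c by (auto simp: Mid_def)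
  then have "len a' c' = len a' d'" using d(2) c len_commute[of d a] len_commute[of d' a'] by metis
  then show ?thesis using d' by (auto simp: Per_def)
qed

text \<open>
  A triangle has at most one right angle. If \<open>c'\<close> is the reflection of \<open>c\<close> in \<open>b\<close> and \<open>a'\<close> that of \<open>a\<close> in \<open>c\<close>, then both
  \<open>a\<close> and \<open>a'\<close> are equidistant from \<open>c\<close> and \<open>c'\<close>; hence so is \<open>c\<close>, which lies on \<open>aa'\<close>, and \<open>c = c'\<close>.
\<close>

lemma two_right_angles:
  assumes "Per a b c" "Per a c b" shows "b = c"
proof (rule ccontr)
  assume "b \<noteq> c"
  obtain c' where c': "Mid b c c'" "len a c = len a c'" using assms by (auto simp: Per_def)
  obtain a' where a': "Mid c a a'" using reflect by blast
  have "Col c b c'" using Mid_Col[OF c'(1)] .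
  then have "Per c' c a" using Per_Col[OF assms(2)] \<open>b \<noteq> c\<close> Per_sym by blast
  then have "len c' a = len c' a'" using a' by (rule PerD)
  moreover have "len c a = len c a'" by (rule Mid_len[OF a'])
  ultimately have e: "len a' c = len a' c'"
    using c'(2) len_commute[of c' a] len_commute[of c' a'] len_commute[of c a] len_commute[of c a'] by metis
  show False
  proof (cases "a = a'")
    case True
    then have "a = c" using a' Mid_same by blast
    then have "c' = c" using c'(2) by (simp add: len_null')
    then show False using c'(1) Mid_same \<open>b \<noteq> c\<close> by blast
  next
    case False
    have "Col a a' c" using Mid_Col[OF a'] Col_rotate Col_swap by blast
    then have "c = c'" using equidistant_point_unique[OF False _ c'(2) e] by blast
    then show False using c'(1) Mid_same \<open>b \<noteq> c\<close> by blast
  qed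
qed

text \<open>
  A line meets a circle in at most two points: \<open>x\<close> would have two feet on the line, the midpoints of two
  different chords.
\<close>

lemma three_equidistant_on_line:
  assumes "p \<noteq> q" "q \<noteq> w" "p \<noteq> w" "Col p q w" "len x p = len x q" "len x w = len x q"
  shows False
proof -
  obtain m where m: "Mid m p q" using midpoint by blast
  obtain n where n: "Mid n w q" using midpoint by blast
  have "Per x m q" "Per x n q" using Mid_sym[OF m] Mid_sym[OF n] assms by (auto simp: Per_def)
  moreover have "m \<noteq> q" "n \<noteq> q" using m n assms Mid_self' by blast+
  moreover have "Col p q m" "Col w q n" using Mid_Col[OF m] Mid_Col[OF n] Col_rotate Col_swap by blast+
  moreover then have "Col p q n" using assms Col_on_line[of w q p q n] Col_rotate Col_swap by (metis Col_triv(2))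
  moreover have "Col p q q" by simp
  ultimately have "Per x m n" "Per x n m"
    using Per_Col[of x m q n] Per_Col[of x n q m] Col_on_line[OF assms(1)] by metis+
  then have "m = n" by (rule two_right_angles)
  then have "p = w" using m n Mid_unique Mid_sym by blast
  then show False using assms by blast
qed

lemma perpendicular_unique:
  assumes "Per u s w" "Per v s w" "s \<noteq> w" shows "Col s u v"
proof -
  obtain w' where w': "Mid s w w'" using reflect by blast
  then have "w \<noteq> w'" using assms(3) Mid_same by blast
  then show ?thesis
    using equidistant_Col[of w w' s u v] PerD[OF assms(1) w'] PerD[OF assms(2) w'] Mid_len[OF w'] by blast
qed

text \<open>
  The circles about \<open>a\<close> and \<open>b\<close> through \<open>x\<close> meet at \<open>x\<close>, so both handed intersection points are defined. They
  cannot both be \<open>x\<close>, since \<open>x\<close> lies strictly on one side of the line.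
\<close>

lemma mirror_point:
  assumes "a \<noteq> b" "\<not> Col a b x"
  shows "\<exists>x'. x' \<noteq> x \<and> len a x = len a x' \<and> len b x = len b x'"
proof -
  have n: "\<not> (a = b \<and> C a x b x)" using assms(1) by blast
  obtain w where w: "C a w a x" "C b w b x" "\<not> L b a w"
    using circles_meet_left[OF n C_refl C_refl] by blast
  obtain w' where w': "C a w' a x" "C b w' b x" "\<not> L a b w'"
    using circles_meet_right[OF n C_refl C_refl] by blast
  have "L a b x \<or> L b a x" using turn_total assms(2) by (simp add: on_common_line_iff)
  then have "w' \<noteq> x \<or> w \<noteq> x" using w(3) w'(3) by blast
  moreover have "len a x = len a w" "len b x = len b w" "len a x = len a w'" "len b x = len b w'"
    using w(1,2) w'(1,2) by (simp_all add: C_iff)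
  ultimately show ?thesis by blast
qed

text \<open>
  The foot is the midpoint of \<open>x\<close> and its mirror image \<open>x'\<close>; it lies on the line because the points equidistant
  from \<open>x\<close> and \<open>x'\<close> are collinear.
\<close>

lemma foot:
  assumes "a \<noteq> b" "\<not> Col a b x"
  shows "\<exists>f. Col a b f \<and> (\<forall>w. Col a b w \<longrightarrow> Per x f w)"
proof -
  obtain x' where x': "x' \<noteq> x" "len a x = len a x'" "len b x = len b x'"
    using mirror_point[OF assms] by blast
  obtain f where f: "Mid f x x'" using midpoint by blast
  then have "len f x = len f x'" by (rule Mid_len)
  then have "Col a b f" using equidistant_Col x' by metis
  moreover have "Per x f w" if "Col a b w" for w
    using equidistant_on_line[OF assms(1) that x'(2,3)] f Per_sym unfolding Per_def by blast
  ultimately show ?thesis by blast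
qed

text \<open>
  No line meets all three sides of the triangle \<open>u v w\<close>: each crossing reverses the orientation, and three
  reversals would give \<open>u\<close> the wrong one.
\<close>

lemma crossing_parity:
  assumes "\<not> Col a b u" "a \<noteq> b" "Col a b p" "Col a b q" "Col a b r" "B u p v" "B v q w" "B u r w"
  shows False
proof -
  have *: False if "L a b u" "a \<noteq> b" "Col a b p" "Col a b q" "Col a b r" for a b
  proof -
    have "L b a v" using turn_opposite[of a b u p v] that assms(6) by (simp add: in_line_iff)
    then have "L a b w"
      using turn_opposite[of b a v q w] that assms(7) Col_swap by (simp add: in_line_iff)
    moreover have "L b a w" using turn_opposite[of a b u r w] that assms(8) by (simp add: in_line_iff)
    ultimately show False using turn_asym by blast
  qed
  have "L a b u \<or> L b a u" using turn_total assms(1) by (simp add: on_common_line_iff)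
  then show False using *[of a b] *[of b a] assms Col_swap by blast
qed

text \<open>
  A segment that crosses a line does so between the feet \<open>s\<close> and \<open>t\<close> of its endpoints. The half-turn about the
  midpoint \<open>m\<close> of \<open>st\<close> takes \<open>v\<close> to a point \<open>v'\<close> on the perpendicular at \<open>s\<close>. By parity \<open>v'\<close> lies on the same side
  of the line as \<open>u\<close>, so one of \<open>u\<close>, \<open>v'\<close> is between \<open>s\<close> and the other, and inner Pasch yields a crossing between
  \<open>m\<close> and \<open>s\<close>, or after the half-turn between \<open>m\<close> and \<open>t\<close>.
\<close>

lemma feet_separated:
  assumes ab: "a \<noteq> b" and g: "Col a b g" and s: "Col a b s" and t: "Col a b t"
    and u: "\<not> Col a b u" and ugv: "B u g v"
    and us: "\<And>w. Col a b w \<Longrightarrow> Per u s w" and vt: "\<And>w. Col a b w \<Longrightarrow> Per v t w"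
  shows "bt s g t"
proof -
  have uv: "u \<noteq> v" "Col u v g" using ugv bt_identity B_Col by (auto simp: B_iff)
  have once: "X = g" if "Col a b X" "Col u v X" for X
    using lines_meet_once[OF u ab that(1) g uv(1) that(2) uv(2)] .
  have v: "\<not> Col a b v"
  proof
    assume "Col a b v"
    then have "v = g" using once[of v] by simp
    then show False using ugv by (simp add: B_iff)
  qed
  show ?thesis
  proof (cases "s = t")
    case True
    obtain w where "Col a b w" "w \<noteq> s" using ab by (metis Col_triv(2,3))
    then have "Col s u v" using perpendicular_unique[of u s w v] us vt True by blast
    then have "s = g" using once s Col_rotate by blast
    then show ?thesis by simp
  next
    case False
    obtain m where m: "Mid m s t" using midpoint by blast
    have ms: "s \<noteq> m" "t \<noteq> m" using m False Mid_self Mid_self' by blast+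
    have smt: "bt s m t" using m by (simp add: Mid_def)
    then have abm: "Col a b m"
      using Col_join[OF ab s t False] Col_rotate[OF Mid_Col[OF m]] Col_rotate Col_swap by blast
    obtain v' where v': "Mid m v v'" using reflect by blast
    obtain u' where u': "Mid m u u'" using reflect by blast
    have um: "u \<noteq> m" "v \<noteq> m" using u v abm by blast+
    have "v' \<noteq> m" "u' \<noteq> m" using v' u' um Mid_self' by blast+
    then have vmv: "B v m v'" "B u m u'" using v' u' um by (simp_all add: B_iff Mid_def)
    have off: "\<not> Col a b v'" "\<not> Col a b u'"
      using lines_meet_once[OF v ab abm, of v' v'] lines_meet_once[OF u ab abm, of u' u'] vmv
      by (metis B_Col(2) B_iff Col_triv(2) bt_identity)+
    have h: "len v t = len v' s" "len t s = len s t" "len v s = len v' t"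
      using half_turn_len[OF v' m] half_turn_len[OF v' Mid_sym[OF m]] by (simp_all add: len_commute[of t s])
    then have "Per v' s t" using Per_cong3[OF vt[OF s]] by (auto simp: cong3_def)
    then have suv: "Col s u v'" using perpendicular_unique[OF us[OF t]] False by blast
    have "\<not> B u s v'" using crossing_parity[OF u ab g abm s ugv vmv(1)] by blast
    moreover have "u \<noteq> s" "v' \<noteq> s" using u off s by blast+
    ultimately consider "u = v'" | "B s u v'" | "B s v' u"
      using suv bt_sym[of u v' s] bt_sym[of v' s u] by (auto simp: Col_def B_iff)
    then show ?thesis
    proof cases
      case 1
      then have "m = g" using once[OF abm] B_Col(2)[OF vmv(1)] Col_swap by blast
      then show ?thesis using smt by blast
    next
      case 2
      have "\<not> Col s v v'"
      proof
        assume *: "Col s v v'"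
        have "s = m"
          by (rule lines_meet_once[OF v ab s abm, of v'])
            (use Col_rotate[OF *] B_Col(2)[OF vmv(1)] vmv(1) B_identity in auto)
        then show False using ms by blast
      qed
      then obtain X where X: "B u X v" "B m X s" using Pasch_Col[of s v v' u m] 2 vmv(1) by blast
      have "Col a b X" using Col_join[OF ab abm s _ B_Col(2)[OF X(2)]] ms(1) by blast
      then have "X = g" using once B_Col(2)[OF X(1)] by blast
      then have "bt s g m" using X(2) bt_sym by (auto simp: B_iff)
      then show ?thesis using smt bt_prefix2 by blast
    next
      case 3
      have "\<not> Col u t u'"
      proof
        assume *: "Col u t u'"
        have "t = m"
          by (rule lines_meet_once[OF u ab t abm, of u'])
            (use Col_swap[OF Col_rotate[OF Col_rotate[OF *]]] B_Col(2)[OF vmv(2)] vmv(2) B_identity in auto)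
        then show False using ms by blast
      qed
      moreover have "B t v u'"
      proof -
        have "cong3 s v' u t v u'"
          using half_turn_len[OF m Mid_sym[OF v']] half_turn_len[OF Mid_sym[OF v'] u'] half_turn_len[OF m u']
          by (simp add: cong3_def)
        then have "bt t v u'" using 3 bt_cong3 by (auto simp: B_iff)
        moreover have "v \<noteq> u'"
        proof
          assume "v = u'"
          then have "Mid m v u" using Mid_sym[OF u'] by simp
          then have "v' = u" using Mid_unique[OF v'] by blast
          then show False using 3 by (simp add: B_iff)
        qed
        moreover have "t \<noteq> v" using v t by blast
        ultimately show ?thesis by (simp add: B_iff)
      qed
      ultimately obtain X where X: "B m X t" "B v X u" using Pasch_Col[of u t u' m v] vmv(2) by blast
      have "Col a b X" using Col_join[OF ab abm t _ B_Col(2)[OF X(1)]] ms(2) by blast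
      then have "X = g" using once B_Col(2)[OF X(2)] Col_swap by blast
      then have "bt t g m" using X(1) bt_sym by (auto simp: B_iff)
      then show ?thesis using smt bt_prefix2 bt_sym by blast
    qed
  qed
qed

section \<open>The triangle inequality\<close>

text \<open>
  A leg is not longer than the hypotenuse. Otherwise \<open>g\<close> on the leg \<open>xf\<close> has \<open>xg = xp\<close>. The foot \<open>k\<close> of \<open>x\<close> on
  the line \<open>gp\<close> is the midpoint of \<open>gp\<close>. Let \<open>y\<close> be on this line beyond \<open>g\<close> with \<open>gy = gx\<close>. Exchanging \<open>x\<close> and \<open>y\<close>,
  the foot \<open>k'\<close> of \<open>y\<close> on the line \<open>gx\<close> lies beyond \<open>g\<close> as seen from \<open>x\<close>, and so does the foot \<open>f\<close> of \<open>p\<close>. But \<open>g\<close> is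
  between \<open>p\<close> and \<open>y\<close>, so it would have to be between their feet.
\<close>

lemma right_triangle_crossing:
  assumes n: "\<not> Col f x p" and pf: "Per p f x" and g: "B x g f" and e: "len x g = len x p"
  shows False
proof -
  have xg: "Col x g f" "Col x f g" "x \<noteq> f" "x \<noteq> g" "g \<noteq> f" using g B_Col bt_identity by (auto simp: B_iff)
  have gxp: "\<not> Col g x p" using n xg Col_join[of g x x f p] Col_rotate Col_swap Col_on_line[of g x]
    by (metis Col_triv(1,2,3))
  then have gp: "g \<noteq> p" by auto
  obtain k where k: "Mid k g p" using midpoint by blast
  then have kg: "k \<noteq> g" using gp Mid_self by blast
  have xk: "Per x k g" using k e unfolding Per_def by blast
  \<comment> \<open>The reflection in the bisector of the angle \<open>x g y\<close> would take \<open>k\<close> to \<open>k'\<close>.\<close>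
  obtain y where y: "bt p g y" "len g y = len g x" using extend[of p g] gp by metis
  have gy: "g \<noteq> y" using y(2) xg(4) by (auto simp: len_null')
  have kgy: "bt k g y" using k y(1) bt_prefix1 bt_sym unfolding Mid_def by blast
  then have "Col g y k" using Col_def by blast
  then obtain k' where k': "cong3 g y k g x k'" using transport_Col y(2) gy by blast
  have "len k x = len k' y"
    by (rule five_Col[OF \<open>Col g y k\<close> k' y(2)[symmetric] len_commute gy])
  moreover have "len g k = len g k'" using k' by (simp add: cong3_def)
  ultimately have "cong3 x k g y k' g"
    using y(2) len_commute[of x k] len_commute[of y k'] len_commute[of k g] len_commute[of k' g]
      len_commute[of x g] len_commute[of y g]
    unfolding cong3_def by metis
  then have yk': "Per y k' g" using xk Per_cong3 by blast
  have k'g: "k' \<noteq> g" using k' kg by (auto simp: cong3_def len_null)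
  have gxk': "Col g x k'" using Col_cong3[OF \<open>Col g y k\<close> k'] .
  have "bt k' g x" using bt_cong3[OF kgy] cong3_rotate[OF cong3_rotate[OF k']] by blast
  have gxf: "Col g x f" using xg Col_swap by blast
  have "bt f g k'"
  proof (rule feet_separated[of g x g f k' p y])
    show "Per p f w" if "Col g x w" for w
      using Per_Col[OF pf] that gxf xg Col_on_line[of g x f x w] by (metis Col_triv(2))
    show "Per y k' w" if "Col g x w" for w
      using Per_Col[OF yk' k'g] that gxk' xg Col_on_line[of g x k' g w] by (metis Col_triv(3))
    show "B p g y" using y gp gy by (simp add: B_iff)
  qed (use xg gxf gxk' gxp in auto)
  moreover have "bt x g f" "bt x g k'" using g \<open>bt k' g x\<close> bt_sym by (auto simp: B_iff)
  then have "bt g f k' \<or> bt g k' f" using bt_connect_tail xg(4) by blast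
  ultimately show False using bt_antisym bt_sym k'g xg(5) by metis
qed

definition le :: "'a \<Rightarrow> 'a \<Rightarrow> 'a \<Rightarrow> 'a \<Rightarrow> bool" where
  "le a b c d \<longleftrightarrow> (\<exists>e. bt c e d \<and> len a b = len c e)"

lemma segment_le_iff: "segment_le B C a b c d \<longleftrightarrow> le a b c d"
  by (simp add: segment_le_def le_def C_iff)

lemma le_linear: "le a b c d \<or> le c d a b"
proof (cases "c = d")
  case True
  then have "le c d a b" unfolding le_def using len_null_eq[of c a] by (intro exI[of _ a]) simp
  then show ?thesis by blast
next
  case False
  obtain o' where o': "bt d c o'" "c \<noteq> o'" using extend_distinct[of d c] False by (auto simp: B_iff)
  obtain e where e: "bt o' c e" "len c e = len a b" using extend[of o' c] o'(2) by metis
  have "bt c d e \<or> bt c e d" using bt_connect_tail[of o' c d e] o' e(1) bt_sym by blast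
  then show ?thesis
  proof
    assume "bt c e d"
    then show ?thesis using e(2) unfolding le_def by metis
  next
    assume "bt c d e"
    then obtain f where "bt a f b" "len c d = len a f" using transport_bt e(2) by blast
    then show ?thesis unfolding le_def by blast
  qed
qed

lemma le_trans: assumes "le a b c d" "le c d e f" shows "le a b e f"
proof -
  obtain g h where g: "bt c g d" "len a b = len c g" and h: "bt e h f" "len c d = len e h"
    using assms unfolding le_def by blast
  obtain g' where "bt e g' h" "len c g = len e g'" using transport_bt[OF g(1) h(2)] by blast
  then show ?thesis unfolding le_def using bt_prefix2 h(1) g(2) by metis
qed

lemma le_len: "len a b = len c d \<Longrightarrow> le a b c d"
  unfolding le_def by (intro exI[of _ d]) simp

lemma le_commute2: "le a b c d \<Longrightarrow> le a b d c"
  using le_trans le_len len_commute by blast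

lemma leg_le_hypotenuse:
  assumes "\<not> Col f x p" "Per p f x" shows "le x f x p"
proof (rule disjE[OF le_linear[of x f x p]])
  assume "le x p x f"
  then obtain g where g: "bt x g f" "len x p = len x g" unfolding le_def by blast
  show ?thesis
  proof (cases "g = f")
    case True
    then show ?thesis using g le_len by metis
  next
    case False
    have "x \<noteq> p" using assms(1) by auto
    then have "x \<noteq> g" using g(2) by (auto simp: len_null)
    then have "B x g f" using g(1) False by (simp add: B_iff)
    then show ?thesis using right_triangle_crossing[OF assms] g(2) by metis
  qed
qed

text \<open>
  If \<open>x\<close> is on the line, \<open>f = x\<close> serves; otherwise \<open>f\<close> is the foot, and \<open>fa\<close>, \<open>fz\<close> are legs of right triangles
  with hypotenuses \<open>xa\<close>, \<open>xz\<close>.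
\<close>

lemma projection_shortens:
  assumes "a \<noteq> z"
  shows "\<exists>f. Col a z f \<and> le a f a x \<and> le z f z x"
proof (cases "Col a z x")
  case True
  then show ?thesis using le_len by blast
next
  case False
  obtain f where f: "Col a z f" "\<And>w. Col a z w \<Longrightarrow> Per x f w" using foot[OF assms False] by blast
  have "le w f w x" if "Col a z w" for w
  proof (cases "f = w")
    case True
    then show ?thesis unfolding le_def using len_null_eq by (intro exI[of _ w]) simp
  next
    case ne: False
    have "\<not> Col f w x" using Col_join[OF assms f(1) that ne] False by blast
    then show ?thesis using leg_le_hypotenuse f(2)[OF that] by blast
  qed
  then show ?thesis using f(1) by (metis Col_triv(2,3))
qed

lemma ray_point_unique: "bt a p z \<Longrightarrow> bt a q z \<Longrightarrow> len a p = len a q \<Longrightarrow> p = q"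
  using bt_connect_inner[of a p z q] bt_len_eq[of a p q] bt_len_eq[of a q p] by auto

text \<open>
  The inequality \<open>az \<le> ax + xz\<close>, in the form in which a point \<open>z\<close> is found outside a circle about \<open>x\<close>. It holds
  for the projection \<open>f\<close> of \<open>x\<close> by order on the line: with \<open>c1\<close> on \<open>az\<close> such that \<open>a c1 = xa\<close>, the point \<open>f\<close> is
  not beyond \<open>c1\<close> towards \<open>z\<close>, so \<open>fz\<close> is at least \<open>c1 z = ac\<close>.
\<close>

lemma triangle_inequality:
  assumes az: "a \<noteq> z" and c: "bt a c z" "len c z = len x a"
  shows "le a c x z"
proof -
  obtain f where f: "Col a z f" "le a f a x" "le z f z x" using projection_shortens[OF az] by blast
  obtain c1 where c1: "bt z c1 a" "len a c = len z c1" "len c z = len c1 a"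
    using transport_bt[OF c(1) len_commute] by blast
  then have ac1z: "bt a c1 z" by (simp add: bt_sym)
  have "le a f a c1"
    using le_trans[OF f(2) le_len, of a c1] c(2) c1(3) len_commute[of x a] len_commute[of c1 a] by metis
  then obtain e where e: "bt a e c1" "len a f = len a e" unfolding le_def by blast
  have aez: "bt a e z" using bt_prefix2[OF e(1) ac1z] .
  consider "bt z a f" | "bt a f z" | "bt a z f" using f(1) bt_sym unfolding Col_def by blast
  then have "bt z c1 f"
  proof cases
    case 1 then show ?thesis using bt_prefix2 c1(1) by blast
  next
    case 2
    then have "f = e" using ray_point_unique aez e(2) by blast
    then show ?thesis using bt_prefix1[OF _ ac1z] e(1) bt_sym by blast
  next
    case 3
    then have "e = f" using bt_len_eq[of a e f] bt_prefix2[OF aez 3] e(2) by metis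
    then have "z = f" using bt_antisym[of f z a] 3 aez bt_sym by blast
    then have "c1 = z" using bt_antisym[of c1 z a] e(1) ac1z \<open>e = f\<close> bt_sym by blast
    then show ?thesis by simp
  qed
  then have "le a c z f" using c1(2) unfolding le_def by blast
  then show ?thesis using le_trans[OF _ f(3)] le_commute2 by blast
qed

end

section \<open>The construction in classical models\<close>

text \<open>
  The classical reading of \<open>line_circle_points\<close>, with \<open>same_order\<close> unfolded in the last line.
\<close>

definition line_circle_pair ::
  "('a \<Rightarrow> 'a \<Rightarrow> 'a \<Rightarrow> bool) \<Rightarrow> ('a \<Rightarrow> 'a \<Rightarrow> 'a \<Rightarrow> 'a \<Rightarrow> bool) \<Rightarrow> 'a \<Rightarrow> 'a \<Rightarrow> 'a \<Rightarrow> 'a \<Rightarrow> 'a \<Rightarrow> 'a \<Rightarrow> 'a \<Rightarrow> bool" where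
  "line_circle_pair B C a b u r s p q \<longleftrightarrow>
     a \<noteq> b \<and> in_line B a b p \<and> C u p r s \<and> in_line B a b q \<and> C u q r s \<and>
     (\<forall>w. in_line B a b w \<and> C u w r s \<longrightarrow> w = p \<or> w = q) \<and>
     (\<not> weakly_between B a b p \<longrightarrow> \<not> B q p b) \<and> (weakly_between B a b p \<longrightarrow> weakly_between B a p q)"

context plane
begin

lemma extension_distinct:
  assumes "a \<noteq> b" "bt a b c" "C b c a b" shows "b \<noteq> c"
  using assms by (auto simp: C_iff len_null')

text \<open>
  The point that witnesses an inequality of segments is determined: it is the one obtained by laying off
  \<open>ab\<close> from \<open>c\<close> on the ray opposite to a point \<open>w\<close> beyond \<open>c\<close>.
\<close>

lemma segment_le_witness:
  assumes "c \<noteq> d" "bt d c w" "C c w c d" "bt w c e" "C c e a b" "segment_le B C a b c d"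
  shows "bt c e d"
proof -
  obtain e' where e': "bt c e' d" "len a b = len c e'" using assms(6) by (auto simp: segment_le_iff le_def)
  have "w \<noteq> c" using assms(1,3) by (auto simp: C_iff len_null')
  moreover have "bt w c e'" using bt_inner1[OF bt_sym[OF assms(2)] e'(1)] .
  ultimately have "e = e'" using extend_unique[of w c e e'] assms(4,5) e'(2) by (simp add: C_iff)
  then show ?thesis using e'(1) by simp
qed

text \<open>
  Since \<open>ac = ab + xa\<close> with \<open>a \<noteq> b\<close>, the circle about \<open>x\<close> with radius \<open>ac\<close> contains \<open>a\<close>.
\<close>

lemma point_inside:
  assumes "a \<noteq> b" "bt a b c" "C b c x a"
  shows "a \<noteq> c" "segment_le B C x a a c"
proof -
  show "a \<noteq> c" using assms bt_identity by blast
  obtain e where "bt a e c" "len c b = len a e"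
    using transport_bt[OF bt_sym[OF assms(2)] len_commute] by blast
  moreover have "len x a = len c b" using assms(3) trans[OF len_commute[of c b]] by (simp only: C_iff)
  ultimately have "le x a a c" unfolding le_def by auto
  then show "segment_le B C x a a c" by (simp add: segment_le_iff)
qed

text \<open>
  Here \<open>az = ac + xa\<close>, so \<open>xz\<close> is at least \<open>ac\<close> by the triangle inequality.
\<close>

lemma point_outside:
  assumes "a \<noteq> c" "bt a c z" "C c z x a"
  shows "x \<noteq> z" "segment_le B C a c x z"
proof -
  have az: "a \<noteq> z" using assms bt_identity by blast
  have le: "le a c x z" using triangle_inequality[OF az assms(2)] assms(3) by (simp add: C_iff)
  then show "segment_le B C a c x z" by (simp add: segment_le_iff)
  show "x \<noteq> z"
  proof
    assume "x = z"
    then obtain e where e: "bt x e x" "len a c = len x e" using le by (auto simp: le_def)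
    then have "x = e" using bt_identity by blast
    then show False using e(2) assms(1) by (simp add: len_null)
  qed
qed

lemma point_outside_opposite:
  assumes "a \<noteq> c" "bt a c z" "C c z x a" "C a z' a z"
  shows "x \<noteq> z'" "segment_le B C a c x z'"
proof -
  have az: "len a z = len a z'" using assms(4) by (simp add: C_iff)
  obtain c' where c': "bt a c' z'" "len a c = len a c'" "len c z = len c' z'"
    using transport_bt[OF assms(2) az] by blast
  moreover have "C c' z' x a" "a \<noteq> c'" using c' assms by (auto simp: C_iff len_null)
  ultimately have "x \<noteq> z'" "segment_le B C a c' x z'" using point_outside by blast+
  then show "x \<noteq> z'" "segment_le B C a c x z'" using c'(2) by (simp_all add: segment_le_def C_iff)
qed

lemma only_two_intersections:
  assumes "a \<noteq> b" "in_line B a b p" "in_line B a b q" "in_line B a b w"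
    "C u p r s" "C u q r s" "C u w r s" "p \<noteq> q"
  shows "w = p \<or> w = q"
proof (rule ccontr)
  assume "\<not> ?thesis"
  moreover have "Col p q w" using Col_on_line assms(1-4) by (simp add: in_line_iff)
  ultimately show False using three_equidistant_on_line[of p q w u] assms(5-8) by (auto simp: C_iff)
qed

text \<open>
  The circle about \<open>b\<close> with radius \<open>xa\<close>, possibly null. Its points on the line are obtained by laying off
  \<open>xa\<close> from \<open>b\<close> in both directions, where \<open>a'\<close> replaces \<open>a\<close> for the direction of \<open>a\<close>.
\<close>

lemma diameter_line_circle_pair:
  assumes ab: "a \<noteq> b" "bt a b a'" "C b a' a b" and c: "bt a b c" "C b c x a"
    and c': "bt a' b c'" "C b c' x a"
  shows "line_circle_pair B C a b b x a c' c"
proof -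
  have a': "b \<noteq> a'" using extension_distinct[OF ab] .
  have in_c: "in_line B a b c" using c(1) ab(1) by (simp add: in_line_iff Col_def)
  have in_c': "in_line B a b c'"
  proof -
    have "Col a b a'" "Col b a' c'" using ab(2) c'(1) bt_sym by (auto simp: Col_def)
    then show ?thesis using Col_join[of a b b a' c'] ab(1) a' by (simp add: in_line_iff)
  qed
  have opp: "bt c' b c"
  proof -
    have "bt b c' a \<or> bt b a c'" using bt_connect_tail[of a' b c' a] a' c'(1) ab(2) bt_sym by blast
    then show ?thesis
    proof
      assume "bt b c' a"
      then show ?thesis using bt_prefix1[of a c' b c] c(1) bt_sym by blast
    next
      assume "bt b a c'"
      then show ?thesis using bt_outer2[of c' a b c] bt_outer1[of c' a b c] c(1) ab(1) bt_sym by blast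
    qed
  qed
  have only: "w = c' \<or> w = c" if "in_line B a b w" "C b w x a" for w
  proof (cases "c' = c")
    case True
    then have "b = c" using opp bt_identity by blast
    then have "len b w = len b b" using c(2) that(2) by (simp add: C_iff)
    then show ?thesis using \<open>b = c\<close> by (simp add: len_null)
  next
    case False
    then show ?thesis using only_two_intersections[of a b c' c w b x a] ab(1) in_c in_c' c c' that by blast
  qed
  have "\<not> B c c' b" using opp bt_antisym[of c' b c] bt_sym[of c c' b] B_iff[of c c' b] by blast
  moreover have "bt a c' c" if "bt a b c'"
  proof -
    have "b = c'"
    proof (rule ccontr)
      assume "b \<noteq> c'"
      have "bt b c' a \<or> bt b a c'" using bt_connect_tail[of a' b c' a] a' c'(1) bt_sym[OF ab(2)] by blast
      then show False
        using that bt_antisym[of b c' a] bt_antisym[of a b c'] bt_sym[of a b c'] bt_antisym[of c' b a] bt_sym[of b c' a]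
          \<open>b \<noteq> c'\<close> ab(1) by blast
    qed
    then show ?thesis using c(1) by simp
  qed
  ultimately show ?thesis
    unfolding line_circle_pair_def using ab(1) in_c in_c' c c' only by blast
qed

text \<open>
  Here \<open>z\<close> and \<open>z'\<close> are points outside the circle in the two directions from \<open>a\<close>. The two intersection
  points are distinct because \<open>a\<close> is strictly between them: \<open>xa = bc\<close> differs from the radius \<open>ac\<close>.
\<close>

lemma secant_line_circle_pair:
  assumes ab: "a \<noteq> b" and c: "bt a b c" "C b c x a" and z: "bt a c z" and z': "bt c a z'"
    and q: "C x q a c" "bt a q z" and p: "C x p a c" "bt a p z'"
  shows "line_circle_pair B C a b x a c p q" "p \<noteq> q"
proof -
  have ac: "a \<noteq> c" using point_inside(1)[OF ab c] .
  have az: "a \<noteq> z" using ac z bt_identity by blast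
  have off: "y \<noteq> a" if "C x y a c" for y
  proof
    assume "y = a"
    then have "len b c = len a c" using that c(2) by (simp add: C_iff)
    then have "len c b = len c a" using len_commute[of b c] len_commute[of a c] by metis
    then show False using bt_len_eq[of c b a] c(1) bt_sym ab by blast
  qed
  have pq: "p \<noteq> a" "q \<noteq> a" using off p q by blast+
  have az': "bt b a z'" using z' c(1) bt_prefix1 bt_sym by blast
  have "z' \<noteq> a" using p(2) pq bt_identity by blast
  have baz: "bt a b z" using bt_prefix2[OF c(1) z] .
  have in_q: "in_line B a b q"
    using bt_connect_inner[OF q(2) baz] ab bt_sym unfolding in_line_iff[OF ab] Col_def by blast
  have bap: "bt b a p" using bt_inner1[OF bt_sym[of z' a b]] az' p(2) bt_prefix1 bt_sym by meson
  then have in_p: "in_line B a b p" unfolding in_line_iff[OF ab] Col_def using bt_sym by blast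
  have opp: "bt p a q"
  proof -
    have "bt z a p" using bt_outer2[of z b a p] bt_outer1[of z b a p] baz bap ab bt_sym by blast
    then show ?thesis using bt_prefix1[of z q a p] q(2) bt_sym by blast
  qed
  then show "p \<noteq> q" using pq bt_identity by blast
  then have only: "w = p \<or> w = q" if "in_line B a b w" "C x w a c" for w
    using only_two_intersections[OF ab in_p in_q that(1) p(1) q(1) that(2)] by blast
  have "\<not> bt a b p" using bap bt_antisym[of a b p] ab by blast
  moreover have "\<not> B q p b"
  proof
    assume "B q p b"
    then have "bt q p b" by (simp add: B_iff)
    have "bt q a p" using opp bt_sym by blast
    then have "bt a p b" using \<open>bt q p b\<close> bt_prefix1 by blast
    then show False using bap bt_antisym[of a p b] bt_sym pq by blast
  qed
  ultimately show "line_circle_pair B C a b x a c p q"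
    unfolding line_circle_pair_def using ab in_p in_q p(1) q(1) only by blast
qed

text \<open>
  A common value of the two handed intersection points would have neither orientation with respect to
  \<open>p, q\<close>, hence lie on the line \<open>pq\<close>.
\<close>

lemma equilateral_apexes_distinct:
  assumes "p \<noteq> q" "C p d p q" "C q d q p" "\<not> L q p d" "\<not> L p q e"
  shows "d \<noteq> e"
proof
  assume "d = e"
  then have "on_common_line B p q d" using turn_total assms(4,5) by blast
  then have "Col d p q" using Col_rotate unfolding on_common_line_iff by blast
  then show False using equilateral_noncollinear[OF assms(1)] assms(2,3) by (simp add: C_iff)
qed

lemma equilateral_sides_extended:
  assumes "p \<noteq> q" "C p d p q" "C q d q p" "bt d p P" "C p P p q" "bt d q Q" "C q Q p q"
  shows "\<not> on_common_line B P Q d" "\<not> on_common_line B d q P" "B d p P" "B d q Q"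
proof -
  have n: "\<not> Col d p q" using equilateral_noncollinear[OF assms(1)] assms(2,3) by (simp add: C_iff)
  then have "d \<noteq> p" "d \<noteq> q" by auto
  moreover have "p \<noteq> P" using assms(1,5) by (auto simp: C_iff len_null')
  moreover have "q \<noteq> Q" using assms(1,7) by (auto simp: C_iff len_null')
  ultimately show B: "B d p P" "B d q Q" using assms(4,6) by (simp_all add: B_iff)
  show "\<not> on_common_line B P Q d" "\<not> on_common_line B d q P"
    using isosceles_crossings[OF n B] by (simp_all add: on_common_line_iff)
qed

lemma equilateral_equidistant:
  assumes "C p d p q" "C q d q p" shows "len d p = len d q"
proof -
  have "len d p = len p d" by (rule len_commute)
  also have "\<dots> = len p q" using assms(1) by (simp only: C_iff)
  also have "\<dots> = len q p" by (rule len_commute)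
  also have "\<dots> = len q d" using assms(2) by (simp only: C_iff)
  also have "\<dots> = len d q" by (rule len_commute)
  finally show ?thesis .
qed

lemma equilateral_midpoint:
  assumes "p \<noteq> q" "C p d p q" "C q d q p" "bt d p P" "C p P p q" "bt d q Q" "C q Q p q"
    "B p R Q" "B q R P" "B p m q" "B R m d"
  shows "d \<noteq> m" "C p m m q"
proof -
  have n: "\<not> Col d p q" using equilateral_noncollinear[OF assms(1)] assms(2,3) by (simp add: C_iff)
  have "len d p = len d q" using equilateral_equidistant[OF assms(2,3)] .
  moreover have "len p P = len q Q" using assms(5,7) by (simp add: C_iff)
  ultimately have "Mid m p q"
    using isosceles_midpoint[OF n _ equilateral_sides_extended(3,4)[OF assms(1-7)] _ assms(8-11)] by blast
  then show "C p m m q" by (simp add: Mid_def C_iff)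
  show "d \<noteq> m" using n B_Col[OF assms(10)] Col_rotate by blast
qed

lemma perpendicular_bisector:
  assumes "p \<noteq> q" "d \<noteq> e" "C p d p q" "C q d q p" "C p e p q" "C q e q p" "C p m m q" "C x p r s" "C x q r s"
  shows "in_line B d e m" "in_line B d e x"
proof -
  have "len d p = len d q" "len e p = len e q"
    using equilateral_equidistant assms(3-6) by blast+
  moreover have "len m p = len m q" using trans[OF len_commute[of m p]] assms(7) by (simp only: C_iff)
  moreover have "len x p = len x q" using assms(8,9) by (simp add: C_iff)
  ultimately have "Col d e m" "Col d e x" using equidistant_Col[OF assms(1)] by blast+
  then show "in_line B d e m" "in_line B d e x" using assms(2) by (simp_all add: in_line_iff)
qed

lemma between_in_line:
  assumes "a \<noteq> b" "in_line B a b p" "in_line B a b q" "B p m q"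
  shows "in_line B a b m"
proof -
  have "p \<noteq> q" using assms(4) bt_identity by (auto simp: B_iff)
  then show ?thesis using Col_join[of a b p q m] assms B_Col(2) by (simp add: in_line_iff)
qed

end

section \<open>Transfer from classical truth to intuitionistic derivability\<close>

lemma sat_T [simp]: "sat D B C L v (T a b c) = weakly_between B (v a) (v b) (v c)"
  by (auto simp: T_def weakly_between_def)

lemma sat_on_line [simp]: "sat D B C L v (on_line a b x) = in_line B (v a) (v b) (v x)"
  by (simp add: on_line_def in_line_def)

lemma sat_collinear [simp]: "sat UNIV B C L v (collinear a b c) = on_common_line B (v a) (v b) (v c)"
  by (auto simp: collinear_def on_common_line_def)

lemma sat_seg_le [simp]: "sat UNIV B C L v (seg_le a b c d) = segment_le B C (v a) (v b) (v c) (v d)"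
  by (simp add: seg_le_def segment_le_def)

lemma sat_circles [simp]:
  "sat D B C L v (on_circle u r s x) = C (v u) (v x) (v r) (v s)"
  "sat UNIV B C L v (inside_circle u r s x) = segment_le B C (v u) (v x) (v r) (v s)"
  "sat UNIV B C L v (outside_circle u r s x) = segment_le B C (v r) (v s) (v u) (v x)"
  "sat D B C L v (circles_coincide u r s u' r' s') = (v u = v u' \<and> C (v r) (v s) (v r') (v s'))"
  by (simp_all add: on_circle_def inside_circle_def outside_circle_def circles_coincide_def)

lemma sat_IntersectCircles1 [simp]:
  "sat D B C L v (IntersectCircles1 u r s u' r' s' y) \<longleftrightarrow>
     \<not> (v u = v u' \<and> C (v r) (v s) (v r') (v s')) \<and>
     C (v u) (v y) (v r) (v s) \<and> C (v u') (v y) (v r') (v s') \<and> \<not> L (v u') (v u) (v y)"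
  by (simp add: IntersectCircles1_def)

lemma sat_IntersectCircles2 [simp]:
  "sat D B C L v (IntersectCircles2 u r s u' r' s' y) \<longleftrightarrow>
     \<not> (v u = v u' \<and> C (v r) (v s) (v r') (v s')) \<and>
     C (v u) (v y) (v r) (v s) \<and> C (v u') (v y) (v r') (v s') \<and> \<not> L (v u) (v u') (v y)"
  by (simp add: IntersectCircles2_def)

lemma forall_stable_geo [simp]:
  "forall_stable (T a b c)" "forall_stable (on_line a b x)" "forall_stable (collinear a b c)" "forall_stable (seg_le a b c d)"
  "forall_stable (on_circle u r s x)" "forall_stable (inside_circle u r s x)" "forall_stable (outside_circle u r s x)"
  "forall_stable (circles_coincide u r s u' r' s')" "forall_stable (IntersectCircles1 u r s u' r' s' y)"
  "forall_stable (IntersectCircles2 u r s u' r' s' y)" "forall_stable (line_circle_points a b u r s p q)"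
  by (simp_all add: T_def on_line_def collinear_def seg_le_def on_circle_def inside_circle_def
      outside_circle_def circles_coincide_def IntersectCircles1_def IntersectCircles2_def
      line_circle_points_def same_order_def)

lemma stable_geo [simp]:
  "stable (T a b c)" "stable (on_line a b x)" "stable (on_circle u r s x)"
  "stable (line_circle_points a b u r s p q)"
  by (simp_all add: T_def on_line_def on_circle_def line_circle_points_def same_order_def)

lemma forall_stable_neutral_geometry: "A \<in> neutral_geometry \<Longrightarrow> forall_stable A"
  unfolding neutral_geometry_def by (auto elim: neutral_axioms.cases handedness_axioms.cases)

interpretation neutral: stable_theory neutral_geometry
proof
  show "ren f A \<in> neutral_geometry" if "A \<in> neutral_geometry" for A f
    using that by (rule ren_neutral_geometry)
qed (simp_all add: neutral_geometry_def neutral_axioms.intros)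

text \<open>
  The axioms are instantiated at distinct variables, and the valuation lists the points in question.
\<close>

lemma plane_of_model:
  fixes B :: "'a \<Rightarrow> 'a \<Rightarrow> 'a \<Rightarrow> bool"
  assumes "\<And>v A. A \<in> neutral_geometry \<Longrightarrow> sat UNIV B C L v A"
  shows "plane B C L"
proof -
  have N: "sat UNIV B C L v A" if "A \<in> neutral_axioms" for v A
    using that assms by (simp add: neutral_geometry_def)
  have H: "sat UNIV B C L v A" if "A \<in> handedness_axioms" for v A
    using that assms by (simp add: neutral_geometry_def)
  have extension: "v a \<noteq> v b \<Longrightarrow> \<exists>x. weakly_between B (v a) (v b) x \<and> C (v b) x (v c) (v d)" for v :: "nat \<Rightarrow> 'a" and a b c d
    using N[OF neutral_axioms.extension[of a b c d], of v] by simp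
  have Pasch: "\<not> on_common_line B (v a) (v b) (v c) \<Longrightarrow> B (v a) (v p) (v c) \<Longrightarrow> B (v b) (v q) (v c) \<Longrightarrow>
      \<exists>x. B (v p) x (v b) \<and> B (v q) x (v a)" for v :: "nat \<Rightarrow> 'a" and a b c p q
    using N[OF neutral_axioms.inner_Pasch[of a b c p q], of v] by simp
  have lower: "\<exists>a b c. \<not> on_common_line B a b c"
    using N[OF neutral_axioms.lower_dimension] by (simp add: numeral_2_eq_2)
  have circle_circle: "v u \<noteq> v u' \<Longrightarrow> C (v u) (v y) (v r) (v s) \<Longrightarrow>
      segment_le B C (v u') (v y) (v r') (v s') \<Longrightarrow> C (v u) (v z) (v r) (v s) \<Longrightarrow>
      segment_le B C (v r') (v s') (v u') (v z) \<Longrightarrow>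
      \<exists>x. C (v u) x (v r) (v s) \<and> C (v u') x (v r') (v s')" for v :: "nat \<Rightarrow> 'a" and u u' y z r s r' s'
    using N[OF neutral_axioms.circle_circle_continuity[of u u' r s y r' s' z], of v] by simp
  have meet: "\<not> (v u = v u' \<and> C (v r) (v s) (v r') (v s')) \<Longrightarrow> C (v u) (v y) (v r) (v s) \<Longrightarrow>
      C (v u') (v y) (v r') (v s') \<Longrightarrow>
      (\<exists>w. C (v u) w (v r) (v s) \<and> C (v u') w (v r') (v s') \<and> \<not> L (v u') (v u) w) \<and>
      (\<exists>w. C (v u) w (v r) (v s) \<and> C (v u') w (v r') (v s') \<and> \<not> L (v u) (v u') w)" for v :: "nat \<Rightarrow> 'a" and u u' y r s r' s'
    using H[OF handedness_axioms.IntersectCircles_defined[of u r s u' r' s' y], of v] by simp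
  show ?thesis
  proof
    show "C a b b a" for a b using N[OF neutral_axioms.cong_swap[of 0 1], of "\<lambda>i. [a, b] ! i"] by simp
    show "C p q r s" if "C a b p q" "C a b r s" for a b p q r s
      using N[OF neutral_axioms.cong_trans[of 0 1 2 3 4 5], of "\<lambda>i. [a, b, p, q, r, s] ! i"] that by simp
    show "a = b" if "C a b c c" for a b c
      using N[OF neutral_axioms.cong_null[of 0 1 2], of "\<lambda>i. [a, b, c] ! i"] that by simp
    show "\<exists>x. weakly_between B a b x \<and> C b x c d" if "a \<noteq> b" for a b c d
      using extension[of "\<lambda>i. [a, b, c, d] ! i" 0 1 2 3] that by simp
    show "C c d c' d'" if "a \<noteq> b" "weakly_between B a b c" "weakly_between B a' b' c'"
      "C a b a' b'" "C b c b' c'" "C a d a' d'" "C b d b' d'" for a b c a' b' c' d d'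
      using N[OF neutral_axioms.five_segment[of 0 1 2 3 4 5 6 7], of "\<lambda>i. [a, b, c, a', b', c', d, d'] ! i"] that
      by simp
    show "B c b a" "a \<noteq> b \<and> b \<noteq> c" if "B a b c" for a b c
      using N[OF neutral_axioms.betw_sym[of 0 1 2], of "\<lambda>i. [a, b, c] ! i"] that by simp_all
    show "\<not> B a b a" for a b
      using N[OF neutral_axioms.betw_identity[of 0 1], of "\<lambda>i. [a, b] ! i"] by simp
    show "weakly_between B a b c \<and> weakly_between B a c d"
      if "weakly_between B a b d" "weakly_between B b c d" for a b c d
      using N[OF neutral_axioms.inner_transitivity[of 0 1 3 2], of "\<lambda>i. [a, b, c, d] ! i"] that by simp
    show "weakly_between B a c d \<and> weakly_between B a b d"
      if "weakly_between B a b c" "weakly_between B b c d" "b \<noteq> c" for a b c d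
      using N[OF neutral_axioms.outer_transitivity[of 0 1 2 3], of "\<lambda>i. [a, b, c, d] ! i"] that by simp
    show "weakly_between B a c d \<or> weakly_between B a d c" if "B a b c" "B a b d" for a b c d
      using N[OF neutral_axioms.connectivity[of 0 1 2 3], of "\<lambda>i. [a, b, c, d] ! i"] that by auto
    show "\<exists>x. B p x b \<and> B q x a" if "\<not> on_common_line B a b c" "B a p c" "B b q c" for a b c p q
      using Pasch[of "\<lambda>i. [a, b, c, p, q] ! i" 0 1 2 3 4] that by simp
    show "\<exists>a b c. \<not> on_common_line B a b c" by (rule lower)
    show "on_common_line B p q r" if "a \<noteq> b" "C p a p b" "C q a q b" "C r a r b" for a b p q r
      using N[OF neutral_axioms.upper_dimension[of 0 1 2 3 4], of "\<lambda>i. [a, b, p, q, r] ! i"] that by simp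
    show "\<exists>x. C u x r s \<and> C v x r' s'"
      if "u \<noteq> v" "C u y r s" "segment_le B C v y r' s'" "C u z r s" "segment_le B C r' s' v z"
      for u v y r s r' s' z
      using circle_circle[of "\<lambda>i. [u, v, y, r, s, r', s', z] ! i" 0 1 2 3 4 5 6 7] that by simp
    show "\<not> L b a c" if "L a b c" for a b c
      using H[OF handedness_axioms.turn_asym[of 0 1 2], of "\<lambda>i. [a, b, c] ! i"] that by simp
    show "L a b c \<or> L b a c" if "\<not> on_common_line B a b c" for a b c
      using H[OF handedness_axioms.turn_total[of 0 1 2], of "\<lambda>i. [a, b, c] ! i"] that by auto
    show "L b a d" if "L a b c" "in_line B a b y" "B c y d" for a b c y d
      using H[OF handedness_axioms.turn_opposite_sides[of 0 1 2 3 4], of "\<lambda>i. [a, b, c, y, d] ! i"] that by simp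
    show "\<exists>w. C u w r s \<and> C v w r' s' \<and> \<not> L v u w" "\<exists>w. C u w r s \<and> C v w r' s' \<and> \<not> L u v w"
      if "\<not> (u = v \<and> C r s r' s')" "C u y r s" "C v y r' s'" for u v r s r' s' y
      using meet[of "\<lambda>i. [u, v, r, s, r', s', y] ! i" 0 1 2 3 4 5 6] that by simp_all
  qed
qed

text \<open>
  Given two points, the order on a ray from \<open>a\<close> has no maximal element, by the extension axiom. A finite
  domain would have one.
\<close>

lemma infinite_points:
  assumes sat: "\<And>v A. range v \<subseteq> D \<Longrightarrow> A \<in> neutral_axioms \<Longrightarrow> sat D B C L v A"
    and ab: "a \<in> D" "b \<in> D" "a \<noteq> b"
  shows "infinite D"
proof
  assume "finite D"
  define D' where "D' = D - {a}"
  have v: "range (\<lambda>i. if i = 0 then x else if i = Suc 0 then y else if i = Suc (Suc 0) then z else w) \<subseteq> D"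
    if "x \<in> D" "y \<in> D" "z \<in> D" "w \<in> D" for x y z w
    using that by auto
  have sym: "B z y x \<and> x \<noteq> y \<and> y \<noteq> z" if "B x y z" "x \<in> D" "y \<in> D" "z \<in> D" for x y z
    using sat[OF v neutral_axioms.betw_sym[of 0 1 2], of x y z z] that by simp
  have id: "\<not> B x y x" if "x \<in> D" "y \<in> D" for x y
    using sat[OF v neutral_axioms.betw_identity[of 0 1], of x y y y] that by simp
  have inner: "weakly_between B x z w" "weakly_between B x y z"
    if "weakly_between B x y w" "weakly_between B y z w" "x \<in> D" "y \<in> D" "z \<in> D" "w \<in> D" for x y z w
    using sat[OF v neutral_axioms.inner_transitivity[of 0 1 3 2], of x y z w] that by simp_all
  have asym: "\<not> B a y x" if "x \<in> D'" "y \<in> D'" "B a x y" for x y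
  proof
    assume "B a y x"
    have d: "a \<in> D" "x \<in> D" "y \<in> D" using ab that by (auto simp: D'_def)
    have "weakly_between B x y a" "weakly_between B y x a"
      using sym[OF that(3)] sym[OF \<open>B a y x\<close>] d by (auto simp: weakly_between_def)
    then have "weakly_between B x y x" using inner(2) d by blast
    then show False using id[OF d(2,3)] sym[OF that(3)] d by (auto simp: weakly_between_def)
  qed
  have step: "\<exists>y\<in>D. B a x y" if x: "x \<in> D'" for x
  proof -
    have "\<exists>y\<in>D. weakly_between B a x y \<and> C x y a x"
      using sat[OF v neutral_axioms.extension[of 0 1 0 1], of a x x x] that ab by (auto simp: D'_def)
    then obtain y where y: "y \<in> D" "weakly_between B a x y" "C x y a x" by blast
    moreover have "x \<noteq> y"
    proof
      assume "x = y"
      have "C x x x x"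
        using sat[OF v neutral_axioms.cong_swap[of 0 0], of x x x x] that by (simp add: D'_def)
      then have "C a x x x"
        using sat[OF v neutral_axioms.cong_trans[of 1 1 0 1 1 1], of a x x x] that ab y(3) \<open>x = y\<close>
        by (simp add: D'_def)
      then show False
        using sat[OF v neutral_axioms.cong_null[of 0 1 1], of a x x x] that ab by (simp add: D'_def)
    qed
    ultimately show ?thesis using that by (auto simp: weakly_between_def D'_def)
  qed
  have "\<exists>m\<in>D'. \<forall>x\<in>D'. x \<noteq> m \<longrightarrow> \<not> B a m x"
  proof (rule Finite_Set.bex_max_element)
    show "finite D'" "D' \<noteq> {}" using \<open>finite D\<close> ab by (auto simp: D'_def)
    show "asymp_on D' (B a)" using asym by (rule asymp_onI)
    show "transp_on D' (B a)"
    proof (rule transp_onI)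
      fix x y z assume *: "x \<in> D'" "y \<in> D'" "z \<in> D'" "B a x y" "B a y z"
      then have d: "a \<in> D" "x \<in> D" "y \<in> D" "z \<in> D" using ab by (auto simp: D'_def)
      have "weakly_between B z y a" "weakly_between B y x a"
        using sym[OF *(4)] sym[OF *(5)] d by (auto simp: weakly_between_def)
      then have "weakly_between B z x a" using inner(1) d by blast
      moreover have "z \<noteq> x" using asym * by blast
      ultimately show "B a x z" using sym d * by (auto simp: weakly_between_def D'_def)
    qed
  qed
  then obtain m where m: "m \<in> D'" "\<And>x. x \<in> D' \<Longrightarrow> x \<noteq> m \<Longrightarrow> \<not> B a m x" by blast
  obtain y where y: "y \<in> D" "B a m y" using step[OF m(1)] by blast
  moreover have "m \<in> D" using m(1) by (simp add: D'_def)
  ultimately have "y \<noteq> a" "y \<noteq> m" using id sym[of a m y] ab by auto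
  then show False using m(2)[of y] y by (simp add: D'_def)
qed

text \<open>
  Classical reasoning is conservative for stable conclusions. If \<open>F\<close> is not derivable from \<open>G\<close>, then neither
  is \<open>\<not>\<not>F\<close>, so \<open>\<not>F\<close> is consistent with \<open>G\<close> and a maximal consistent extension gives a model of \<open>G\<close> and \<open>\<not>F\<close>.
  It has infinitely many points, so they can be renumbered by all natural numbers; the model then
  lives on the whole type \<open>nat\<close>, and equality in it is identity. The hypothesis \<open>a \<noteq> b\<close> provides two
  points.
\<close>

theorem classical_transfer:
  assumes fin: "finite G" and forall_stable: "\<And>A. A \<in> G \<Longrightarrow> forall_stable A" "forall_stable F" and F: "stable F"
    and ab: "(a \<^bold>\<noteq> b) \<in> G"
    and valid: "\<And>B C L (v :: nat \<Rightarrow> nat). plane B C L \<Longrightarrow> \<forall>A\<in>G. sat UNIV B C L v A \<Longrightarrow>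
      sat UNIV B C L v F"
  shows "derives neutral_geometry G F"
proof (rule ccontr)
  assume not: "\<not> derives neutral_geometry G F"
  have "\<not> derives neutral_geometry (insert (\<^bold>\<not> F) G) \<^bold>\<bottom>"
    using not neutral.stable_not_notE[OF F] derives.ImpI by blast
  then obtain M where M: "insert (\<^bold>\<not> F) G \<subseteq> M" "neutral.maximal M"
    using neutral.maximal_extension[of "insert (\<^bold>\<not> F) G"] fin by auto
  have ax: "ren f A \<in> M" if "A \<in> neutral_geometry" for f A
    using neutral.maximal_closed[OF M(2) derives.axiom] ren_neutral_geometry[OF that] by blast
  define rep where "rep i = (LEAST j. (i \<^bold>= j) \<in> M)" for i
  have rep_iff: "rep i = rep j \<longleftrightarrow> (i \<^bold>= j) \<in> M" for i j
  proof
    have *: "(i \<^bold>= rep i) \<in> M" for i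
      unfolding rep_def using neutral.maximal_refl[OF M(2), of i] by (rule LeastI)
    assume "rep i = rep j"
    then show "(i \<^bold>= j) \<in> M"
      using *[of i] *[of j] neutral.maximal_sym[OF M(2)] neutral.maximal_trans[OF M(2)] by metis
  next
    assume "(i \<^bold>= j) \<in> M"
    then have "(i \<^bold>= k) \<in> M \<longleftrightarrow> (j \<^bold>= k) \<in> M" for k
      using neutral.maximal_sym[OF M(2)] neutral.maximal_trans[OF M(2)] by metis
    then show "rep i = rep j" by (simp add: rep_def)
  qed
  have range: "\<exists>f. v = h \<circ> f" if "range v \<subseteq> range h" for v :: "nat \<Rightarrow> nat" and h :: "nat \<Rightarrow> nat"
  proof -
    have "v i = h (inv h (v i))" for i using that by (simp add: f_inv_into_f subset_iff)
    then show ?thesis by (intro exI[of _ "\<lambda>i. inv h (v i)"]) auto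
  qed
  \<comment> \<open>The classes of provably equal variables, represented by their least members, form a first model.\<close>
  have "infinite (range rep)"
  proof (rule infinite_points)
    have "(a \<^bold>= b) \<notin> M" using ab M neutral.maximal_not by blast
    then show "rep a \<noteq> rep b" by (simp add: rep_iff)
    show "sat (range rep)
     (\<lambda>x y z. \<exists>a b c. x = rep a \<and> y = rep b \<and> z = rep c \<and> Betw a b c \<in> M)
     (\<lambda>x y z w. \<exists>a b c d. x = rep a \<and> y = rep b \<and> z = rep c \<and> w = rep d \<and> Cong a b c d \<in> M)
     (\<lambda>x y z. \<exists>a b c. x = rep a \<and> y = rep b \<and> z = rep c \<and> LeftTurn a b c \<in> M) v A"
      if "range v \<subseteq> range rep" "A \<in> neutral_axioms" for v A
      using neutral.truth_lemma[OF M(2) rep_iff, of A] range[OF that(1)] ax that(2) forall_stable_neutral_geometry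
      unfolding neutral.canonical_sat_def neutral_geometry_def by blast
  qed auto
  then obtain k where k: "bij_betw k (range rep) (UNIV :: nat set)"
    using bij_betw_inv bij_enumerate by blast
  define h where "h = k \<circ> rep"
  have h: "h i = h j \<longleftrightarrow> (i \<^bold>= j) \<in> M" for i j
    using k rep_iff[of i j] by (auto simp: h_def bij_betw_def inj_on_def)
  have surj: "range h = UNIV" using k by (auto simp: h_def bij_betw_def image_comp[symmetric])
  define B C L where
    "B = (\<lambda>x y z. \<exists>a b c. x = h a \<and> y = h b \<and> z = h c \<and> Betw a b c \<in> M)"
    and "C = (\<lambda>x y z w. \<exists>a b c d. x = h a \<and> y = h b \<and> z = h c \<and> w = h d \<and> Cong a b c d \<in> M)"
    and "L = (\<lambda>x y z. \<exists>a b c. x = h a \<and> y = h b \<and> z = h c \<and> LeftTurn a b c \<in> M)"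
  have truth: "sat UNIV B C L (h \<circ> f) A \<longleftrightarrow> ren f A \<in> M" if "forall_stable A" for f A
    using neutral.truth_lemma[OF M(2) h that, of f] by (simp add: neutral.canonical_sat_def B_def C_def L_def surj)
  have "sat UNIV B C L v A" if "A \<in> neutral_geometry" for v A
    using range[of v h] truth ax that forall_stable_neutral_geometry surj by blast
  then have "plane B C L" by (rule plane_of_model)
  moreover have "\<forall>A\<in>G. sat UNIV B C L h A"
    using truth[of _ "\<lambda>j. j"] forall_stable(1) M(1) by (auto simp: ren_id comp_def)
  ultimately have "sat UNIV B C L h F" by (rule valid)
  then have "F \<in> M" using truth[of F "\<lambda>j. j"] forall_stable(2) by (simp add: ren_id comp_def)
  then show False using M neutral.maximal_not by blast
qed

section \<open>Derivations that introduce points\<close>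

lemma sat_line_circle_points [simp]:
  "sat UNIV B C L v (line_circle_points a b u r s p q) =
     line_circle_pair B C (v a) (v b) (v u) (v r) (v s) (v p) (v q)"
  by (simp add: line_circle_points_def line_circle_pair_def same_order_def)

lemma bound_geo [simp]:
  "bound n (T a b c) \<longleftrightarrow> a < n \<and> b < n \<and> c < n"
  "bound n (on_line a b x) \<longleftrightarrow> a < n \<and> b < n \<and> x < n"
  "bound n (on_circle u r s x) \<longleftrightarrow> u < n \<and> r < n \<and> s < n \<and> x < n"
  by (auto simp: T_def on_line_def on_circle_def)

lemma bound_seg_le [simp]: "bound n (seg_le a b c d) \<longleftrightarrow> a < n \<and> b < n \<and> c < n \<and> d < n"
  by (auto simp: seg_le_def)

lemma bound_circles_coincide [simp]:
  "bound n (circles_coincide u r s u' r' s') \<longleftrightarrow> u < n \<and> r < n \<and> s < n \<and> u' < n \<and> r' < n \<and> s' < n"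
  by (auto simp: circles_coincide_def)

lemma bound_IntersectCircles [simp]:
  "bound n (IntersectCircles1 u r s u' r' s' y) \<longleftrightarrow>
     u < n \<and> r < n \<and> s < n \<and> u' < n \<and> r' < n \<and> s' < n \<and> y < n"
  "bound n (IntersectCircles2 u r s u' r' s' y) \<longleftrightarrow>
     u < n \<and> r < n \<and> s < n \<and> u' < n \<and> r' < n \<and> s' < n \<and> y < n"
  by (auto simp: IntersectCircles1_def IntersectCircles2_def)

lemma bound_line_circle_points [simp]:
  "bound n (line_circle_points a b u r s p q) \<longleftrightarrow>
     a < n \<and> b < n \<and> u < n \<and> r < n \<and> s < n \<and> p < n \<and> q < n"
  by (auto simp: line_circle_points_def same_order_def)

lemma bound_IntersectLineCircle [simp]:
  "bound n (IntersectLineCircle1 a b u r s p) \<longleftrightarrow> a < n \<and> b < n \<and> u < n \<and> r < n \<and> s < n \<and> p < n"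
  "bound n (IntersectLineCircle2 a b u r s p) \<longleftrightarrow> a < n \<and> b < n \<and> u < n \<and> r < n \<and> s < n \<and> p < n"
  by (auto simp: IntersectLineCircle1_def IntersectLineCircle2_def)

lemma bound_Perp [simp]:
  "bound n (Perp x a b d e) \<longleftrightarrow> x < n \<and> a < n \<and> b < n \<and> d < n \<and> e < n"
  by (auto simp: Perp_def numeral_3_eq_3 numeral_2_eq_2)

lemma bound_perpendicular [simp]:
  "bound n (perpendicular k k' l l') \<longleftrightarrow> k < n \<and> k' < n \<and> l < n \<and> l' < n"
  by (auto simp: perpendicular_def perpendicular_at_def numeral_3_eq_3 numeral_2_eq_2)

lemma ren_line_circle_points [ren_geo]:
  "ren f (line_circle_points a b u r s p q) =
     line_circle_points (f a) (f b) (f u) (f r) (f s) (f p) (f q)"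
  by (simp add: line_circle_points_def same_order_def ren_geo)

abbreviation provable :: "fm set \<Rightarrow> fm \<Rightarrow> bool" (infix "\<tturnstile>" 20) where
  "G \<tturnstile> F \<equiv> derives neutral_geometry G F"

lemma provable_axiom: "A \<in> neutral_axioms \<Longrightarrow> G \<tturnstile> A" "A \<in> handedness_axioms \<Longrightarrow> G \<tturnstile> A"
  by (simp_all add: derives.axiom neutral_geometry_def)

lemma provable_ImpE: "G \<tturnstile> A \<^bold>\<longrightarrow> B \<Longrightarrow> G \<tturnstile> A \<Longrightarrow> G \<tturnstile> B"
  by (rule derives.ImpE)

lemma ExistsE_named:
  "G \<tturnstile> \<^bold>\<exists> A \<Longrightarrow> insert (ren (case_nat n (\<lambda>j. j)) A) G \<tturnstile> F \<Longrightarrow> \<forall>B\<in>G. bound n B \<Longrightarrow>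
    bound (Suc n) A \<Longrightarrow> bound n F \<Longrightarrow> G \<tturnstile> F"
  using ExistsE_fresh[OF ren_neutral_geometry, of G A n F] by (simp add: inst_def)

lemma ExistsI_named: "G \<tturnstile> ren (case_nat n (\<lambda>j. j)) A \<Longrightarrow> G \<tturnstile> \<^bold>\<exists> A"
  using derives.ExistsI[of neutral_geometry G n A] by (simp add: inst_def)

lemma AndE_rule: "G \<tturnstile> A \<^bold>\<and> B \<Longrightarrow> insert A (insert B G) \<tturnstile> F \<Longrightarrow> G \<tturnstile> F"
  by (meson derives.AndE1 derives.AndE2 derives.ImpE derives.ImpI)

lemma assume_And: "insert A (insert B G) \<tturnstile> F \<Longrightarrow> insert (A \<^bold>\<and> B) G \<tturnstile> F"
proof (rule AndE_rule)
  show "insert (A \<^bold>\<and> B) G \<tturnstile> A \<^bold>\<and> B" by (rule derives.assumption) simp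
  assume "insert A (insert B G) \<tturnstile> F"
  then show "insert A (insert B (insert (A \<^bold>\<and> B) G)) \<tturnstile> F" by (rule derives_mono) auto
qed

lemma assume_Exists:
  assumes "insert (ren (case_nat n (\<lambda>j. j)) A) G \<tturnstile> F" "\<forall>B\<in>G. bound n B" "bound (Suc n) A" "bound n F"
  shows "insert (\<^bold>\<exists> A) G \<tturnstile> F"
proof (rule ExistsE_named[of _ A n])
  show "insert (\<^bold>\<exists> A) G \<tturnstile> \<^bold>\<exists> A" by (rule derives.assumption) simp
  show "insert (ren (case_nat n (\<lambda>j. j)) A) (insert (\<^bold>\<exists> A) G) \<tturnstile> F"
    using assms(1) by (rule derives_mono) auto
qed (use assms in auto)

text \<open>
  In this and the following rules an existential axiom adds to the context a new point with a fresh
  number \<open>n\<close>. Contexts only grow, so a derivation reads like the construction that it formalizes.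
\<close>

lemma use_extension:
  assumes "G \<tturnstile> a \<^bold>\<noteq> b" "insert (T a b n) (insert (Cong b n c d) G) \<tturnstile> F"
    and "\<forall>A\<in>G. bound n A" "bound n F" "a < n \<and> b < n \<and> c < n \<and> d < n"
  shows "G \<tturnstile> F"
proof (rule ExistsE_named)
  show "G \<tturnstile> \<^bold>\<exists> (T (a+1) (b+1) 0 \<^bold>\<and> Cong (b+1) 0 (c+1) (d+1))"
    using provable_ImpE[OF provable_axiom(1)[OF neutral_axioms.extension] assms(1)] .
  show "insert (ren (case_nat n (\<lambda>j. j)) (T (a+1) (b+1) 0 \<^bold>\<and> Cong (b+1) 0 (c+1) (d+1))) G \<tturnstile> F"
    using assms(2) by (simp add: ren_geo assume_And)
qed (use assms in auto)

lemma use_inner_Pasch: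
  assumes "G \<tturnstile> \<^bold>\<not> collinear a b c" "G \<tturnstile> Betw a p c" "G \<tturnstile> Betw b q c"
    and "insert (Betw p n b) (insert (Betw q n a) G) \<tturnstile> F"
    and "\<forall>A\<in>G. bound n A" "bound n F" "a < n \<and> b < n \<and> p < n \<and> q < n"
  shows "G \<tturnstile> F"
proof (rule ExistsE_named)
  show "G \<tturnstile> \<^bold>\<exists> (Betw (p+1) 0 (b+1) \<^bold>\<and> Betw (q+1) 0 (a+1))"
    using provable_ImpE[OF provable_axiom(1)[OF neutral_axioms.inner_Pasch]] assms(1-3)
    by (blast intro: derives.AndI)
  show "insert (ren (case_nat n (\<lambda>j. j)) (Betw (p+1) 0 (b+1) \<^bold>\<and> Betw (q+1) 0 (a+1))) G \<tturnstile> F"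
    using assms(4) by (simp add: ren_geo assume_And)
qed (use assms in auto)

lemma use_line_circle:
  assumes "G \<tturnstile> a \<^bold>\<noteq> b" "G \<tturnstile> seg_le u a r s" "G \<tturnstile> seg_le r s u b"
    and "insert (Cong u n r s) (insert (T a n b) G) \<tturnstile> F"
    and "\<forall>A\<in>G. bound n A" "bound n F" "a < n \<and> b < n \<and> u < n \<and> r < n \<and> s < n"
  shows "G \<tturnstile> F"
proof (rule ExistsE_named)
  show "G \<tturnstile> \<^bold>\<exists> (on_circle (u+1) (r+1) (s+1) 0 \<^bold>\<and> T (a+1) 0 (b+1))"
    using provable_ImpE[OF provable_axiom(1)[OF neutral_axioms.line_circle_continuity]] assms(1-3)
    unfolding inside_circle_def outside_circle_def by (blast intro: derives.AndI)
  show "insert (ren (case_nat n (\<lambda>j. j)) (on_circle (u+1) (r+1) (s+1) 0 \<^bold>\<and> T (a+1) 0 (b+1))) G \<tturnstile> F"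
    using assms(4) by (simp add: ren_geo assume_And on_circle_def)
qed (use assms in auto)

lemma use_circle_circle:
  assumes "G \<tturnstile> u \<^bold>\<noteq> v" "G \<tturnstile> Cong u y r s" "G \<tturnstile> seg_le v y r' s'" "G \<tturnstile> Cong u z r s" "G \<tturnstile> seg_le r' s' v z"
    and "insert (Cong u n r s) (insert (Cong v n r' s') G) \<tturnstile> F"
    and "\<forall>A\<in>G. bound n A" "bound n F" "u < n \<and> v < n \<and> r < n \<and> s < n \<and> r' < n \<and> s' < n"
  shows "G \<tturnstile> F"
proof (rule ExistsE_named)
  show "G \<tturnstile> \<^bold>\<exists> (on_circle (u+1) (r+1) (s+1) 0 \<^bold>\<and> on_circle (v+1) (r'+1) (s'+1) 0)"
    using provable_ImpE[OF provable_axiom(1)[OF neutral_axioms.circle_circle_continuity]] assms(1-5)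
    unfolding inside_circle_def outside_circle_def on_circle_def by (blast intro: derives.AndI)
  show "insert (ren (case_nat n (\<lambda>j. j)) (on_circle (u+1) (r+1) (s+1) 0 \<^bold>\<and> on_circle (v+1) (r'+1) (s'+1) 0)) G \<tturnstile> F"
    using assms(6) by (simp add: ren_geo assume_And on_circle_def)
qed (use assms in auto)

lemma use_IntersectCircles:
  assumes "G \<tturnstile> \<^bold>\<not> circles_coincide u r s v r' s'" "G \<tturnstile> Cong u y r s" "G \<tturnstile> Cong v y r' s'"
    and "insert (IntersectCircles1 u r s v r' s' n) (insert (IntersectCircles2 u r s v r' s' (Suc n)) G) \<tturnstile> F"
    and "\<forall>A\<in>G. bound n A" "bound n F" "u < n \<and> v < n \<and> r < n \<and> s < n \<and> r' < n \<and> s' < n"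
  shows "G \<tturnstile> F"
proof -
  let ?E1 = "\<^bold>\<exists> (IntersectCircles1 (u+1) (r+1) (s+1) (v+1) (r'+1) (s'+1) 0)"
  let ?E2 = "\<^bold>\<exists> (IntersectCircles2 (u+1) (r+1) (s+1) (v+1) (r'+1) (s'+1) 0)"
  let ?I1 = "IntersectCircles1 u r s v r' s' n"
  have both: "G \<tturnstile> ?E1 \<^bold>\<and> ?E2"
    using provable_ImpE[OF provable_axiom(2)[OF handedness_axioms.IntersectCircles_defined]] assms(1-3)
    unfolding on_circle_def by (blast intro: derives.AndI)
  have G: "\<forall>A\<in>insert ?I1 G. bound (Suc n) A" "bound (Suc n) F"
    using assms(5-7) bound_mono[of n _ "Suc n"] by auto
  have "insert ?I1 G \<tturnstile> F"
  proof (rule ExistsE_named[OF _ _ G(1) _ G(2)])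
    show "insert ?I1 G \<tturnstile> ?E2" using derives.AndE2[OF both] by (rule derives_mono) auto
    show "insert (ren (case_nat (Suc n) (\<lambda>j. j)) (IntersectCircles2 (u+1) (r+1) (s+1) (v+1) (r'+1) (s'+1) 0))
        (insert ?I1 G) \<tturnstile> F"
      using assms(4) by (simp add: ren_geo insert_commute)
  qed (use assms in auto)
  then show ?thesis
    by (intro ExistsE_named[OF derives.AndE1[OF both] _ assms(5) _ assms(6)]) (use assms(7) in \<open>simp_all add: ren_geo\<close>)
qed

text \<open>
  An inequality of segments is existential, hence not stable. It can still be obtained from its classical
  truth: the witness is constructed by two extensions, and that it lies where it should is stable.
\<close>

lemma use_seg_le:
  assumes "finite G" "\<forall>A\<in>G. forall_stable A" "(a' \<^bold>\<noteq> b') \<in> G"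
    and valid: "\<And>B C L (v :: nat \<Rightarrow> nat). plane B C L \<Longrightarrow> \<forall>A\<in>G. sat UNIV B C L v A \<Longrightarrow>
      v c \<noteq> v d \<and> segment_le B C (v a) (v b) (v c) (v d)"
  shows "G \<tturnstile> seg_le a b c d"
proof -
  obtain n0 where n0: "\<forall>A\<in>G. bound n0 A" using bound_exists_finite assms(1) by blast
  define n where "n = Suc (n0 + a + b + c + d)"
  have n: "\<forall>A\<in>G. bound n A" "a < n" "b < n" "c < n" "d < n"
    using n0 bound_mono[of n0 _ n] by (auto simp: n_def)
  have n': "\<forall>A\<in>G. bound (Suc n) A" using n(1) bound_mono[of n _ "Suc n"] by auto
  let ?G1 = "insert (T d c n) (insert (Cong c n c d) G)"
  let ?G2 = "insert (T n c (Suc n)) (insert (Cong c (Suc n) a b) ?G1)"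
  have "?G2 \<tturnstile> T c (Suc n) d"
  proof (rule classical_transfer[of _ _ a' b'])
    fix B C L and v :: "nat \<Rightarrow> nat"
    assume p: "plane B C L" and s: "\<forall>A\<in>?G2. sat UNIV B C L v A"
    then interpret plane B C L by blast
    have "v c \<noteq> v d \<and> segment_le B C (v a) (v b) (v c) (v d)" using valid[OF p] s by blast
    then show "sat UNIV B C L v (T c (Suc n) d)"
      using segment_le_witness[of "v c" "v d" "v n" "v (Suc n)" "v a" "v b"] s by simp
  qed (use assms in auto)
  moreover have "?G2 \<tturnstile> Cong a b c (Suc n)"
  proof (rule classical_transfer[of _ _ a' b'])
    fix B C L and v :: "nat \<Rightarrow> nat"
    assume p: "plane B C L" and s: "\<forall>A\<in>?G2. sat UNIV B C L v A"
    then interpret plane B C L by blast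
    show "sat UNIV B C L v (Cong a b c (Suc n))"
      using s by (simp add: C_iff)
  qed (use assms in auto)
  ultimately have 2: "?G2 \<tturnstile> seg_le a b c d"
    unfolding seg_le_def by (intro ExistsI_named[of _ "Suc n"]) (simp add: ren_geo derives.AndI)
  have "?G1 \<tturnstile> n \<^bold>\<noteq> c"
  proof (rule classical_transfer[of _ _ a' b'])
    fix B C L and v :: "nat \<Rightarrow> nat"
    assume p: "plane B C L" and s: "\<forall>A\<in>?G1. sat UNIV B C L v A"
    then interpret plane B C L by blast
    have "v c \<noteq> v d" using valid[OF p] s by blast
    then show "sat UNIV B C L v (n \<^bold>\<noteq> c)"
      using s by (auto simp: C_iff len_null')
  qed (use assms in auto)
  then have 1: "?G1 \<tturnstile> seg_le a b c d"
    by (rule use_extension[OF _ 2]) (use n n' in auto)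
  have "G \<tturnstile> d \<^bold>\<noteq> c"
  proof (rule classical_transfer[of _ _ a' b'])
    fix B C L and v :: "nat \<Rightarrow> nat"
    assume p: "plane B C L" and s: "\<forall>A\<in>G. sat UNIV B C L v A"
    have "v c \<noteq> v d" using valid[OF p] s by blast
    then show "sat UNIV B C L v (d \<^bold>\<noteq> c)" by auto
  qed (use assms in auto)
  then show ?thesis by (rule use_extension[OF _ 1]) (use n in auto)
qed

lemma IntersectLineCircle1I:
  "G \<tturnstile> line_circle_points a b u r s p q \<Longrightarrow> G \<tturnstile> IntersectLineCircle1 a b u r s p"
  unfolding IntersectLineCircle1_def by (rule ExistsI_named[of _ q]) (simp add: ren_geo)

lemma IntersectLineCircle2I:
  "G \<tturnstile> line_circle_points a b u r s p q \<Longrightarrow> G \<tturnstile> IntersectLineCircle2 a b u r s q"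
  unfolding IntersectLineCircle2_def by (rule ExistsI_named[of _ p]) (simp add: ren_geo)

lemma assume_IntersectLineCircle1:
  assumes "insert (line_circle_points a b u r s p n) G \<tturnstile> F" "\<forall>A\<in>G. bound n A" "bound n F"
    "a < n \<and> b < n \<and> u < n \<and> r < n \<and> s < n \<and> p < n"
  shows "insert (IntersectLineCircle1 a b u r s p) G \<tturnstile> F"
  unfolding IntersectLineCircle1_def
  by (rule assume_Exists[of n]) (use assms in \<open>simp_all add: ren_geo\<close>)

lemma assume_IntersectLineCircle2:
  assumes "insert (line_circle_points a b u r s n q) G \<tturnstile> F" "\<forall>A\<in>G. bound n A" "bound n F"
    "a < n \<and> b < n \<and> u < n \<and> r < n \<and> s < n \<and> q < n"
  shows "insert (IntersectLineCircle2 a b u r s q) G \<tturnstile> F"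
  unfolding IntersectLineCircle2_def
  by (rule assume_Exists[of n]) (use assms in \<open>simp_all add: ren_geo\<close>)

lemma cut_all:
  assumes "finite S" "\<forall>A\<in>S. G \<tturnstile> A" "S \<union> G \<tturnstile> F" shows "G \<tturnstile> F"
  using assms
proof (induction S rule: finite_induct)
  case (insert A S)
  have "S \<union> G \<tturnstile> A" using insert.prems(1) by (auto intro: derives_mono[of _ G])
  then have "S \<union> G \<tturnstile> F" using insert.prems(2) by (auto intro: derives_cut)
  then show ?case using insert by simp
qed simp

lemma Exists2I: "G \<tturnstile> ren (case_nat n (case_nat m (\<lambda>j. j))) A \<Longrightarrow> G \<tturnstile> (\<^bold>\<exists> \<^bold>\<exists> A)"
proof (rule ExistsI_named[of _ m])
  assume *: "G \<tturnstile> ren (case_nat n (case_nat m (\<lambda>j. j))) A"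
  have "case_nat n (\<lambda>j. j) \<circ> lift (case_nat m (\<lambda>j. j)) = case_nat n (case_nat m (\<lambda>j. j))"
    by (rule ext) (simp split: nat.splits)
  then have "G \<tturnstile> (\<^bold>\<exists> (ren (lift (case_nat m (\<lambda>j. j))) A))"
    using * by (intro ExistsI_named[of _ n]) (simp add: ren_ren)
  then show "G \<tturnstile> ren (case_nat m (\<lambda>j. j)) (\<^bold>\<exists> A)" by simp
qed

lemma PerpI:
  assumes "G \<tturnstile> IntersectLineCircle2 a b b x a c" "G \<tturnstile> IntersectLineCircle1 a b x a c p"
    "G \<tturnstile> IntersectLineCircle2 a b x a c q" "G \<tturnstile> IntersectCircles1 p p q q q p d"
    "G \<tturnstile> IntersectCircles2 p p q q q p e" "G \<tturnstile> d \<^bold>\<noteq> e"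
  shows "G \<tturnstile> Perp x a b d e"
  unfolding Perp_def Let_def
  apply (rule ExistsI_named[of _ c], simp, rule ExistsI_named[of _ p], simp, rule ExistsI_named[of _ q])
  using assms by (simp add: ren_geo numeral_2_eq_2 numeral_3_eq_3 derives.AndI)

lemma assume_Perp:
  assumes "insert (IntersectLineCircle2 a b b x a n)
      (insert (IntersectLineCircle1 a b x a n (Suc n))
      (insert (IntersectLineCircle2 a b x a n (Suc (Suc n)))
      (insert (IntersectCircles1 (Suc n) (Suc n) (Suc (Suc n)) (Suc (Suc n)) (Suc (Suc n)) (Suc n) d)
      (insert (IntersectCircles2 (Suc n) (Suc n) (Suc (Suc n)) (Suc (Suc n)) (Suc (Suc n)) (Suc n) e)
      (insert (d \<^bold>\<noteq> e) G))))) \<tturnstile> F"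
    and "\<forall>A\<in>G. bound n A" "bound n F" "x < n \<and> a < n \<and> b < n \<and> d < n \<and> e < n"
  shows "insert (Perp x a b d e) G \<tturnstile> F"
proof -
  have b: "\<forall>A\<in>G. bound (Suc n) A" "\<forall>A\<in>G. bound (Suc (Suc n)) A" "bound (Suc n) F" "bound (Suc (Suc n)) F"
    using assms(2,3) bound_mono[of n _ "Suc n"] bound_mono[of n _ "Suc (Suc n)"] by auto
  let ?p = "Suc n" and ?q = "Suc (Suc n)"
  let ?body = "IntersectLineCircle2 a b b x a n \<^bold>\<and> IntersectLineCircle1 a b x a n ?p \<^bold>\<and>
    IntersectLineCircle2 a b x a n ?q \<^bold>\<and> IntersectCircles1 ?p ?p ?q ?q ?q ?p d \<^bold>\<and>
    IntersectCircles2 ?p ?p ?q ?q ?q ?p e \<^bold>\<and> d \<^bold>\<noteq> e"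
  have "insert ?body G \<tturnstile> F"
  proof (rule cut_all)
    have as: "insert ?body G \<tturnstile> ?body" by (rule derives.assumption) simp
    show "\<forall>A\<in>{IntersectLineCircle2 a b b x a n, IntersectLineCircle1 a b x a n ?p,
        IntersectLineCircle2 a b x a n ?q, IntersectCircles1 ?p ?p ?q ?q ?q ?p d,
        IntersectCircles2 ?p ?p ?q ?q ?q ?p e, d \<^bold>\<noteq> e}. insert ?body G \<tturnstile> A"
      using as derives.AndE1[OF as] derives.AndE2[OF as] by (auto dest: derives.AndE1 derives.AndE2)
  qed (use assms(1) in \<open>auto elim!: derives_mono\<close>)
  then have "insert (ren (case_nat ?q (\<lambda>j. j)) (ren (lift (case_nat ?p (\<lambda>j. j)))
      (ren (lift (lift (case_nat n (\<lambda>j. j)))) (let x = x+3; a = a+3; b = b+3; d = d+3; e = e+3; c = 2; p = 1; q = 0 in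
        IntersectLineCircle2 a b b x a c \<^bold>\<and> IntersectLineCircle1 a b x a c p \<^bold>\<and>
        IntersectLineCircle2 a b x a c q \<^bold>\<and> IntersectCircles1 p p q q q p d \<^bold>\<and>
        IntersectCircles2 p p q q q p e \<^bold>\<and> d \<^bold>\<noteq> e)))) G \<tturnstile> F"
    by (simp add: ren_geo numeral_2_eq_2 numeral_3_eq_3)
  then show ?thesis
    unfolding Perp_def
    apply (intro assume_Exists[of n])
       apply (simp only: ren.simps, rule assume_Exists[of "Suc n"])
          apply (simp only: ren.simps, rule assume_Exists[of "Suc (Suc n)"])
    using assms b
                apply (simp_all add: ren_geo numeral_2_eq_2 numeral_3_eq_3)
    done
qed

section \<open>The construction is defined\<close>

text \<open>
  The first step of the construction, for \<open>x = 2\<close>, \<open>a = 1\<close>, \<open>b = 0\<close>. The new points are \<open>3\<close>, beyond \<open>b\<close> on the line, and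
  the intersection points \<open>4\<close> and \<open>5\<close>, of which \<open>4\<close> is the point \<open>c\<close> of the construction.
\<close>

lemma use_first_circle:
  fixes x a b :: var
  defines "x \<equiv> 2" and "a \<equiv> 1" and "b \<equiv> 0"
  assumes G: "G = {a \<^bold>\<noteq> b}" and n: "bound 3 F"
    and step: "{a \<^bold>\<noteq> b, T a b 4, Cong b 4 x a, line_circle_points a b b x a 5 4} \<tturnstile> F"
  shows "G \<tturnstile> F"
proof -
  note vars = x_def a_def b_def
  let ?G1 = "insert (T a b 3) (insert (Cong b 3 a b) {a \<^bold>\<noteq> b})"
  let ?G2 = "insert (T a b 4) (insert (Cong b 4 x a) ?G1)"
  let ?G3 = "insert (T 3 b 5) (insert (Cong b 5 x a) ?G2)"
  have F: "bound 3 F" "bound 4 F" "bound 5 F" using n bound_mono[OF n] by auto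
  have "?G3 \<tturnstile> line_circle_points a b b x a 5 4"
  proof (rule classical_transfer[of _ _ a b])
    fix B C L and v :: "nat \<Rightarrow> nat"
    assume p: "plane B C L" and s: "\<forall>A\<in>?G3. sat UNIV B C L v A"
    show "sat UNIV B C L v (line_circle_points a b b x a 5 4)"
      using plane.diameter_line_circle_pair[OF p, of "v a" "v b" "v 3" "v 4" "v x" "v 5"] s by simp
  qed auto
  then have 3: "?G3 \<tturnstile> F" by (rule derives_cut) (rule derives_mono[OF step], auto)
  have "?G2 \<tturnstile> 3 \<^bold>\<noteq> b"
  proof (rule classical_transfer[of _ _ a b])
    fix B C L and v :: "nat \<Rightarrow> nat"
    assume p: "plane B C L" and s: "\<forall>A\<in>?G2. sat UNIV B C L v A"
    show "sat UNIV B C L v (3 \<^bold>\<noteq> b)"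
      using plane.extension_distinct[OF p, of "v a" "v b" "v 3"] s by auto
  qed auto
  then have 2: "?G2 \<tturnstile> F" by (rule use_extension[OF _ 3]) (simp_all add: vars F)
  have "?G1 \<tturnstile> a \<^bold>\<noteq> b" by (rule derives.assumption) simp
  then have 1: "?G1 \<tturnstile> F" by (rule use_extension[OF _ 2]) (simp_all add: vars F)
  have "G \<tturnstile> a \<^bold>\<noteq> b" by (rule derives.assumption) (simp add: G)
  then show ?thesis unfolding G by (rule use_extension[OF _ 1]) (simp_all add: vars F)
qed

text \<open>
  The second step. The points \<open>6\<close> and \<open>7\<close> are outside the circle about \<open>x\<close>, in the directions of \<open>b\<close> and away from it.
  Line-circle continuity from \<open>a\<close> towards them gives \<open>8\<close> and \<open>9\<close>, the points \<open>q\<close> and \<open>p\<close> of the construction.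
\<close>

lemma use_secant:
  fixes x a b c :: var
  defines "x \<equiv> 2" and "a \<equiv> 1" and "b \<equiv> 0" and "c \<equiv> 4"
  assumes G: "G = {a \<^bold>\<noteq> b, T a b c, Cong b c x a, line_circle_points a b b x a 5 c}" and n: "bound 6 F"
    and step: "{a \<^bold>\<noteq> b, line_circle_points a b b x a 5 c, line_circle_points a b x a c 9 8, 9 \<^bold>\<noteq> 8} \<tturnstile> F"
  shows "G \<tturnstile> F"
proof -
  note vars = x_def a_def b_def c_def
  let ?G1 = "insert (T a c 6) (insert (Cong c 6 x a) G)"
  let ?G2 = "insert (T c a 7) (insert (Cong a 7 a 6) ?G1)"
  let ?G3 = "insert (Cong x 8 a c) (insert (T a 8 6) ?G2)"
  let ?G4 = "insert (Cong x 9 a c) (insert (T a 9 7) ?G3)"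
  have F: "bound 6 F" "bound 7 F" "bound 8 F" "bound 9 F" using n bound_mono[OF n] by auto
  have ab: "(a \<^bold>\<noteq> b) \<in> G" and fin: "finite G" and forall_stable: "\<forall>A\<in>G. forall_stable A" by (auto simp: G)
  have inside: "v a \<noteq> v c \<and> segment_le B C (v x) (v a) (v a) (v c)"
    if p: "plane B C L" and s: "\<forall>A\<in>H. sat UNIV B C L v A" and H: "G \<subseteq> H"
    for B C L and v :: "nat \<Rightarrow> nat" and H
  proof -
    have "\<forall>A\<in>G. sat UNIV B C L v A" using s H by blast
    then show ?thesis using plane.point_inside[OF p, of "v a" "v b" "v c" "v x"] by (simp add: G)
  qed
  have outside: "v x \<noteq> v 6 \<and> segment_le B C (v a) (v c) (v x) (v 6)"
      "v x \<noteq> v 7 \<and> segment_le B C (v a) (v c) (v x) (v 7)" "v a \<noteq> v 6" "v a \<noteq> v 7"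
    if p: "plane B C L" and s: "\<forall>A\<in>H. sat UNIV B C L v A" and H: "?G2 \<subseteq> H"
    for B C L and v :: "nat \<Rightarrow> nat" and H
  proof -
    interpret plane B C L by fact
    have ac: "v a \<noteq> v c" using inside[OF p s] H by blast
    have "\<forall>A\<in>?G2. sat UNIV B C L v A" using s H by blast
    then have z: "bt (v a) (v c) (v 6)" "C (v c) (v 6) (v x) (v a)" "C (v a) (v 7) (v a) (v 6)" by simp_all
    show "v x \<noteq> v 6 \<and> segment_le B C (v a) (v c) (v x) (v 6)"
      "v x \<noteq> v 7 \<and> segment_le B C (v a) (v c) (v x) (v 7)"
      using point_outside[OF ac z(1,2)] point_outside_opposite[OF ac z] by blast+
    show "v a \<noteq> v 6" using ac z(1) bt_identity by metis
    then show "v a \<noteq> v 7" using z(3) by (auto simp: C_iff len_null')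
  qed
  have seg_in: "H \<tturnstile> seg_le x a a c" if H: "finite H" "\<forall>A\<in>H. forall_stable A" "G \<subseteq> H" for H
    by (rule use_seg_le[OF H(1,2) _ inside[OF _ _ H(3)]]) (use ab H in auto)
  have seg_out: "H \<tturnstile> seg_le a c x 6" "H \<tturnstile> seg_le a c x 7"
    if H: "finite H" "\<forall>A\<in>H. forall_stable A" "?G2 \<subseteq> H" for H
    by (rule use_seg_le[OF H(1,2) _ outside(1)[OF _ _ H(3)]], use ab H in auto)
      (rule use_seg_le[OF H(1,2) _ outside(2)[OF _ _ H(3)]], use ab H in auto)
  have sem: "?G4 \<tturnstile> A" if A: "A = line_circle_points a b x a c 9 8 \<or> A = (9 \<^bold>\<noteq> 8)" for A
  proof (rule classical_transfer[of _ _ a b])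
    fix B C L and v :: "nat \<Rightarrow> nat"
    assume p: "plane B C L" and s: "\<forall>A\<in>?G4. sat UNIV B C L v A"
    have "line_circle_pair B C (v a) (v b) (v x) (v a) (v c) (v 9) (v 8) \<and> v 9 \<noteq> v 8"
      using plane.secant_line_circle_pair[OF p, of "v a" "v b" "v c" "v x" "v 6" "v 7" "v 8" "v 9"] s by (simp add: G)
    then show "sat UNIV B C L v A" using A by auto
  qed (use ab fin forall_stable A in auto)
  have all: "{line_circle_points a b x a c 9 8, 9 \<^bold>\<noteq> 8} \<union> ?G4 \<tturnstile> F"
    by (rule derives_mono[OF step]) (auto simp: G)
  have 4: "?G4 \<tturnstile> F"
    by (rule cut_all[OF _ _ all]) (use sem in auto)
  have 3: "?G3 \<tturnstile> F"
  proof (rule use_line_circle[OF _ _ _ 4])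
    show "?G3 \<tturnstile> a \<^bold>\<noteq> 7"
    proof (rule classical_transfer[of _ _ a b])
      fix B C L and v :: "nat \<Rightarrow> nat"
      assume p: "plane B C L" and s: "\<forall>A\<in>?G3. sat UNIV B C L v A"
      then show "sat UNIV B C L v (a \<^bold>\<noteq> 7)" using outside(4)[OF p s] by auto
    qed (use ab fin forall_stable in auto)
    show "?G3 \<tturnstile> seg_le x a a c" by (rule seg_in) (use fin forall_stable in auto)
    show "?G3 \<tturnstile> seg_le a c x 7" by (rule seg_out) (use fin forall_stable in auto)
  qed (simp_all add: vars F G)
  have 2: "?G2 \<tturnstile> F"
  proof (rule use_line_circle[OF _ _ _ 3])
    show "?G2 \<tturnstile> a \<^bold>\<noteq> 6"
    proof (rule classical_transfer[of _ _ a b])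
      fix B C L and v :: "nat \<Rightarrow> nat"
      assume p: "plane B C L" and s: "\<forall>A\<in>?G2. sat UNIV B C L v A"
      then show "sat UNIV B C L v (a \<^bold>\<noteq> 6)" using outside(3)[OF p s] by auto
    qed (use ab fin forall_stable in auto)
    show "?G2 \<tturnstile> seg_le x a a c" by (rule seg_in) (use fin forall_stable in auto)
    show "?G2 \<tturnstile> seg_le a c x 6" by (rule seg_out) (use fin forall_stable in auto)
  qed (simp_all add: vars F G)
  have ac: "H \<tturnstile> a \<^bold>\<noteq> c" "H \<tturnstile> c \<^bold>\<noteq> a" if H: "finite H" "\<forall>A\<in>H. forall_stable A" "G \<subseteq> H" for H
  proof -
    have ne: "v a \<noteq> v c" "v c \<noteq> v a" if "plane B C L" "\<forall>A\<in>H. sat UNIV B C L v A" for B C L and v :: "nat \<Rightarrow> nat"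
      using inside[OF that H(3)] by auto
    show "H \<tturnstile> a \<^bold>\<noteq> c"
      by (rule classical_transfer[of H _ a b]) (use ne H ab in auto)
    show "H \<tturnstile> c \<^bold>\<noteq> a"
      by (rule classical_transfer[of H _ a b]) (use ne H ab in auto)
  qed
  have 1: "?G1 \<tturnstile> F"
    by (rule use_extension[OF ac(2) 2]) (use fin forall_stable F in \<open>auto simp: vars G\<close>)
  show ?thesis
    by (rule use_extension[OF ac(1) 1]) (use fin forall_stable F in \<open>auto simp: vars G\<close>)
qed

text \<open>
  The third step. Circle-circle continuity applies because \<open>q\<close> is on the first circle and is the center of the
  second, while \<open>10\<close>, the point opposite to \<open>q\<close>, is on the first and outside the second. The common point \<open>11\<close>
  serves only to make the handed points \<open>12\<close> and \<open>13\<close> defined.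
\<close>

lemma use_equilateral_apexes:
  fixes p q :: var
  defines "p \<equiv> 9" and "q \<equiv> 8"
  assumes pq: "(p \<^bold>\<noteq> q) \<in> G" and fin: "finite G" and forall_stable: "\<forall>A\<in>G. forall_stable A" and bound: "\<forall>A\<in>G. bound 10 A"
    and n: "bound 10 F"
    and step: "insert (IntersectCircles1 p p q q q p 12) (insert (IntersectCircles2 p p q q q p 13)
      (insert (12 \<^bold>\<noteq> 13) G)) \<tturnstile> F"
  shows "G \<tturnstile> F"
proof -
  note vars = p_def q_def
  let ?G1 = "insert (T q p 10) (insert (Cong p 10 p q) G)"
  let ?G2 = "insert (Cong p 11 p q) (insert (Cong q 11 q p) ?G1)"
  let ?G3 = "insert (IntersectCircles1 p p q q q p 12) (insert (IntersectCircles2 p p q q q p 13) ?G2)"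
  have F: "bound 10 F" "bound 11 F" "bound 12 F" using bound_mono[OF n] by auto
  have B: "\<forall>A\<in>G. bound 10 A" "\<forall>A\<in>G. bound 11 A" "\<forall>A\<in>G. bound 12 A" using bound bound_mono[of 10] by auto
  have "?G3 \<tturnstile> 12 \<^bold>\<noteq> 13"
  proof (rule classical_transfer[of _ _ p q])
    fix B C L and v :: "nat \<Rightarrow> nat"
    assume pl: "plane B C L" and s: "\<forall>A\<in>?G3. sat UNIV B C L v A"
    show "sat UNIV B C L v (12 \<^bold>\<noteq> 13)"
      using plane.equilateral_apexes_distinct[OF pl, of "v p" "v q" "v 12" "v 13"] bspec[OF s, of "p \<^bold>\<noteq> q"] pq s by simp
  qed (use pq fin forall_stable in auto)
  then have 3: "?G3 \<tturnstile> F" by (rule derives_cut) (rule derives_mono[OF step], auto)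
  have neq: "H \<tturnstile> p \<^bold>\<noteq> q" if "G \<subseteq> H" for H using pq that by (intro derives.assumption) auto
  have 2: "?G2 \<tturnstile> F"
  proof (rule use_IntersectCircles)
    show "?G2 \<tturnstile> \<^bold>\<not> circles_coincide p p q q q p"
    proof (rule derives.ImpI)
      let ?H = "insert (circles_coincide p p q q q p) ?G2"
      have "?H \<tturnstile> p \<^bold>= q"
        using derives.assumption[of "circles_coincide p p q q q p" ?H] derives.AndE1
        unfolding circles_coincide_def by blast
      moreover have "?H \<tturnstile> p \<^bold>\<noteq> q" by (rule neq) auto
      ultimately show "?H \<tturnstile> \<^bold>\<bottom>" by (blast intro: derives.ImpE)
    qed
    show "?G2 \<tturnstile> Cong p 11 p q" "?G2 \<tturnstile> Cong q 11 q p" by (rule derives.assumption, simp)+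
    show "insert (IntersectCircles1 p p q q q p 12) (insert (IntersectCircles2 p p q q q p (Suc 12)) ?G2) \<tturnstile> F"
      using 3 by simp
  qed (simp_all add: vars F B)
  have cong_refl: "?G1 \<tturnstile> Cong i j i j" for i j
    by (rule classical_transfer[of _ _ p q])
      (use pq fin forall_stable in \<open>auto intro: plane.C_refl\<close>)
  have null: "?G1 \<tturnstile> T i i j" for i j
    by (rule classical_transfer[of _ _ p q]) (use pq fin forall_stable in \<open>auto simp: weakly_between_def\<close>)
  have opposite: "?G1 \<tturnstile> T q p 10" by (rule derives.assumption) simp
  have 1: "?G1 \<tturnstile> F"
  proof (rule use_circle_circle[OF _ _ _ _ _ 2])
    show "?G1 \<tturnstile> p \<^bold>\<noteq> q" by (rule neq) auto
    show "?G1 \<tturnstile> Cong p q p q" by (rule cong_refl)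
    show "?G1 \<tturnstile> Cong p 10 p q" by (rule derives.assumption) simp
    show "?G1 \<tturnstile> seg_le q q q p"
      unfolding seg_le_def by (rule ExistsI_named[of _ q]) (simp add: ren_geo derives.AndI cong_refl null)
    show "?G1 \<tturnstile> seg_le q p q 10"
      unfolding seg_le_def by (rule ExistsI_named[of _ p]) (simp add: ren_geo derives.AndI cong_refl opposite)
  qed (simp_all add: vars F B)
  have "G \<tturnstile> q \<^bold>\<noteq> p"
  proof (rule classical_transfer[of _ _ p q])
    fix B C L and v :: "nat \<Rightarrow> nat"
    assume pl: "plane B C L" and s: "\<forall>A\<in>G. sat UNIV B C L v A"
    show "sat UNIV B C L v (q \<^bold>\<noteq> p)" using bspec[OF s pq] by auto
  qed (use pq fin forall_stable in auto)
  then show ?thesis by (rule use_extension[OF _ 1]) (simp_all add: vars F B)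
qed

lemma Perp_defined: "{1 \<^bold>\<noteq> 0} \<tturnstile> (\<^bold>\<exists> \<^bold>\<exists> Perp 4 3 2 1 0)"
proof (rule use_first_circle[OF refl], simp, rule use_secant[OF refl], simp)
  let ?F = "\<^bold>\<exists> \<^bold>\<exists> Perp 4 3 2 1 0"
  let ?G = "{1 \<^bold>\<noteq> 0, line_circle_points 1 0 0 2 1 5 4, line_circle_points 1 0 2 1 4 9 8, 9 \<^bold>\<noteq> 8}"
  let ?H = "insert (IntersectCircles1 9 9 8 8 8 9 12) (insert (IntersectCircles2 9 9 8 8 8 9 13)
    (insert (12 \<^bold>\<noteq> 13) ?G))"
  show "?G \<tturnstile> ?F"
  proof (rule use_equilateral_apexes)
    have as: "A \<in> ?H \<Longrightarrow> ?H \<tturnstile> A" for A by (rule derives.assumption)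
    have "?H \<tturnstile> Perp 2 1 0 12 13"
    proof (rule PerpI)
      show "?H \<tturnstile> IntersectLineCircle2 1 0 0 2 1 4" by (rule IntersectLineCircle2I[where p = 5, OF as]) simp
      show "?H \<tturnstile> IntersectLineCircle1 1 0 2 1 4 9" by (rule IntersectLineCircle1I[where q = 8, OF as]) simp
      show "?H \<tturnstile> IntersectLineCircle2 1 0 2 1 4 8" by (rule IntersectLineCircle2I[where p = 9, OF as]) simp
    qed (rule as; simp)+
    then have "?H \<tturnstile> ren (case_nat 13 (case_nat 12 (\<lambda>j. j))) (Perp 4 3 2 1 0)"
      by (simp add: ren_geo)
    then show "?H \<tturnstile> ?F" by (rule Exists2I)
  qed (auto simp: numeral_2_eq_2 numeral_3_eq_3)
qed

section \<open>The constructed line is the perpendicular through the point\<close>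

lemma perpendicularI:
  assumes "G \<tturnstile> on_line k k' m" "G \<tturnstile> on_line l l' m" "G \<tturnstile> a \<^bold>\<noteq> m" "G \<tturnstile> on_line k k' a"
    "G \<tturnstile> on_line l l' b" "G \<tturnstile> on_line l l' c" "G \<tturnstile> Betw b m c" "G \<tturnstile> Cong a b a c" "G \<tturnstile> Cong b m m c"
  shows "G \<tturnstile> perpendicular k k' l l'"
  unfolding perpendicular_def perpendicular_at_def Let_def
  apply (rule ExistsI_named[of _ m], simp, rule derives.AndI)
   apply (use assms(1) in \<open>simp add: ren_geo\<close>)
  apply (rule derives.AndI)
   apply (use assms(2) in \<open>simp add: ren_geo\<close>)
  apply (rule ExistsI_named[of _ a], simp, rule ExistsI_named[of _ b], simp, rule ExistsI_named[of _ c])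
  using assms by (simp add: ren_geo eval_nat_numeral derives.AndI)

text \<open>
  The foot of the perpendicular is the midpoint of \<open>pq\<close>, and it has to be constructed: \<open>10\<close> and \<open>11\<close> prolong the
  sides \<open>dp\<close> and \<open>dq\<close> of the equilateral triangle \<open>d p q\<close>, and two applications of inner Pasch give \<open>12\<close> and the
  midpoint \<open>13\<close>. The points \<open>d\<close>, \<open>e\<close>, \<open>x\<close> and the midpoint are equidistant from \<open>p\<close> and \<open>q\<close>, hence collinear. The
  points \<open>8\<close> and \<open>9\<close> are the other intersections that the constructions of \<open>p\<close> and \<open>q\<close> mention.
\<close>

lemma Perp_constructs_perpendicular:
  fixes x a b c d e p q :: var
  defines "x \<equiv> 4" and "a \<equiv> 3" and "b \<equiv> 2" and "d \<equiv> 1" and "e \<equiv> 0" and "c \<equiv> 5" and "p \<equiv> 6" and "q \<equiv> 7"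
  assumes G: "G = {line_circle_points a b x a c p 8, line_circle_points a b x a c 9 q,
    IntersectCircles1 p p q q q p d, IntersectCircles2 p p q q q p e, d \<^bold>\<noteq> e}"
  shows "G \<tturnstile> perpendicular d e a b \<^bold>\<and> on_line d e x"
proof -
  note vars = x_def a_def b_def d_def e_def c_def p_def q_def
  let ?F = "perpendicular d e a b \<^bold>\<and> on_line d e x"
  let ?G1 = "insert (T d p 10) (insert (Cong p 10 p q) G)"
  let ?G2 = "insert (T d q 11) (insert (Cong q 11 p q) ?G1)"
  let ?G3 = "insert (Betw p 12 11) (insert (Betw q 12 10) ?G2)"
  let ?G4 = "insert (Betw p 13 q) (insert (Betw 12 13 d) ?G3)"
  have de: "(d \<^bold>\<noteq> e) \<in> G" and fin: "finite G" and forall_stable: "\<forall>A\<in>G. forall_stable A" by (auto simp: G)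
  have base: "v p \<noteq> v q" "v d \<noteq> v e" "v a \<noteq> v b" "in_line B (v a) (v b) (v p)" "in_line B (v a) (v b) (v q)"
    "C (v x) (v p) (v a) (v c)" "C (v x) (v q) (v a) (v c)" "C (v p) (v d) (v p) (v q)" "C (v q) (v d) (v q) (v p)"
    "C (v p) (v e) (v p) (v q)" "C (v q) (v e) (v q) (v p)" "v d \<noteq> v p" "v d \<noteq> v q"
    if pl: "plane B C L" and s: "\<forall>A\<in>H. sat UNIV B C L v A" and H: "G \<subseteq> H"
    for B C L and v :: "nat \<Rightarrow> nat" and H
  proof -
    interpret plane B C L by fact
    have sG: "\<forall>A\<in>G. sat UNIV B C L v A" using s H by blast
    then show pq: "v p \<noteq> v q" using C_swap[of "v p" "v q"] by (auto simp: G)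
    show "v d \<noteq> v e" "v a \<noteq> v b" "in_line B (v a) (v b) (v p)" "in_line B (v a) (v b) (v q)"
      "C (v x) (v p) (v a) (v c)" "C (v x) (v q) (v a) (v c)" "C (v p) (v e) (v p) (v q)" "C (v q) (v e) (v q) (v p)"
      using sG by (simp_all add: G line_circle_pair_def)
    show d: "C (v p) (v d) (v p) (v q)" "C (v q) (v d) (v q) (v p)" using sG by (simp_all add: G)
    show "v d \<noteq> v p" "v d \<noteq> v q"
      using equilateral_noncollinear[OF pq, of "v d"] d by (auto simp: C_iff)
  qed
  have extended: "\<not> on_common_line B (v 10) (v 11) (v d)" "\<not> on_common_line B (v d) (v q) (v 10)"
    "B (v d) (v p) (v 10)" "B (v d) (v q) (v 11)" "B (v 10) (v p) (v d)" "B (v 11) (v q) (v d)"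
    if pl: "plane B C L" and s: "\<forall>A\<in>H. sat UNIV B C L v A" and H: "?G2 \<subseteq> H"
    for B C L and v :: "nat \<Rightarrow> nat" and H
  proof -
    interpret plane B C L by fact
    have "G \<subseteq> H" using H by blast
    note b = base[OF pl s this]
    have "\<forall>A\<in>?G2. sat UNIV B C L v A" using s H by blast
    then show "\<not> on_common_line B (v 10) (v 11) (v d)" "\<not> on_common_line B (v d) (v q) (v 10)"
      and B: "B (v d) (v p) (v 10)" "B (v d) (v q) (v 11)"
      using equilateral_sides_extended[OF b(1,8,9), of "v 10" "v 11"] by simp_all
    show "B (v 10) (v p) (v d)" "B (v 11) (v q) (v d)" using B by (simp_all add: B_sym)
  qed
  have crossing: "H \<tturnstile> A"
    if H: "finite H" "\<forall>A\<in>H. forall_stable A" "?G2 \<subseteq> H"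
    and A: "A \<in> {\<^bold>\<not> collinear 10 11 d, \<^bold>\<not> collinear d q 10, Betw d p 10, Betw 10 p d, Betw 11 q d}" for H A
  proof (rule classical_transfer[of _ _ d e])
    fix B C L and v :: "nat \<Rightarrow> nat"
    assume pl: "plane B C L" and s: "\<forall>A\<in>H. sat UNIV B C L v A"
    show "sat UNIV B C L v A" using extended[OF pl s H(3)] A by auto
  qed (use de H A in auto)
  have apex: "H \<tturnstile> A" if H: "finite H" "\<forall>A\<in>H. forall_stable A" "G \<subseteq> H" and A: "A \<in> {d \<^bold>\<noteq> p, d \<^bold>\<noteq> q}" for H A
  proof (rule classical_transfer[of _ _ d e])
    fix B C L and v :: "nat \<Rightarrow> nat"
    assume pl: "plane B C L" and s: "\<forall>A\<in>H. sat UNIV B C L v A"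
    show "sat UNIV B C L v A" using base(12,13)[OF pl s H(3)] A by auto
  qed (use de H A in auto)
  have final: "?G4 \<tturnstile> A"
    if A: "A \<in> {on_line d e 13, on_line a b 13, d \<^bold>\<noteq> 13, on_line d e d, on_line a b p, on_line a b q,
      Betw p 13 q, Cong d p d q, Cong p 13 13 q, on_line d e x}" for A
  proof (rule classical_transfer[of _ _ d e])
    fix B C L and v :: "nat \<Rightarrow> nat"
    assume pl: "plane B C L" and s: "\<forall>A\<in>?G4. sat UNIV B C L v A"
    interpret plane B C L by fact
    have "G \<subseteq> ?G4" by blast
    note b = base[OF pl s this]
    have m: "B (v p) (v 13) (v q)" using s by simp
    have mid: "v d \<noteq> v 13" "C (v p) (v 13) (v 13) (v q)"
      using equilateral_midpoint[OF b(1,8,9), of "v 10" "v 11" "v 12" "v 13"] s by simp_all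
    have "in_line B (v d) (v e) (v 13)" "in_line B (v d) (v e) (v x)"
      using perpendicular_bisector[OF b(1,2,8-11) mid(2) b(6,7)] .
    moreover have "in_line B (v a) (v b) (v 13)" using between_in_line[OF b(3-5) m] .
    moreover have "C (v d) (v p) (v d) (v q)" using equilateral_equidistant[OF b(8,9)] by (simp add: C_iff)
    moreover have "in_line B (v d) (v e) (v d)" by (simp add: in_line_def)
    ultimately show "sat UNIV B C L v A" using A b m mid by auto
  qed (use de fin forall_stable A in auto)
  have 4: "?G4 \<tturnstile> ?F"
    by (rule derives.AndI[OF perpendicularI[of _ _ _ 13 _ _ d p q]]; rule final; simp)
  have 3: "?G3 \<tturnstile> ?F"
  proof (rule use_inner_Pasch[OF _ _ _ 4])
    show "?G3 \<tturnstile> \<^bold>\<not> collinear d q 10" "?G3 \<tturnstile> Betw d p 10"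
      by (rule crossing; use fin forall_stable in auto)+
    show "?G3 \<tturnstile> Betw q 12 10" by (rule derives.assumption) simp
  qed (simp_all add: vars G)
  have 2: "?G2 \<tturnstile> ?F"
  proof (rule use_inner_Pasch[OF _ _ _ 3])
    show "?G2 \<tturnstile> \<^bold>\<not> collinear 10 11 d" "?G2 \<tturnstile> Betw 10 p d" "?G2 \<tturnstile> Betw 11 q d"
      by (rule crossing; use fin forall_stable in auto)+
  qed (simp_all add: vars G)
  have 1: "?G1 \<tturnstile> ?F"
  proof (rule use_extension[OF _ 2])
    show "?G1 \<tturnstile> d \<^bold>\<noteq> q"
      by (rule apex) (use fin forall_stable in auto)
  qed (simp_all add: vars G)
  show ?thesis
  proof (rule use_extension[OF _ 1])
    show "G \<tturnstile> d \<^bold>\<noteq> p"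
      by (rule apex) (use fin forall_stable in auto)
  qed (simp_all add: vars G)
qed

lemma Perp_correct: "{Perp 4 3 2 1 0, 3 \<^bold>\<noteq> 2} \<tturnstile> perpendicular 1 0 3 2 \<^bold>\<and> on_line 1 0 4"
proof -
  let ?F = "perpendicular 1 0 3 2 \<^bold>\<and> on_line 1 0 4"
  let ?K = "{IntersectCircles1 6 6 7 7 7 6 1, IntersectCircles2 6 6 7 7 7 6 0, 1 \<^bold>\<noteq> 0, 3 \<^bold>\<noteq> 2}"
  have "insert (line_circle_points 3 2 4 3 5 9 7) (insert (line_circle_points 3 2 4 3 5 6 8) ?K) \<tturnstile> ?F"
    by (rule derives_mono[OF Perp_constructs_perpendicular[OF refl]]) auto
  then have "insert (IntersectLineCircle2 3 2 4 3 5 7) (insert (line_circle_points 3 2 4 3 5 6 8) ?K) \<tturnstile> ?F"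
    by (rule assume_IntersectLineCircle2) simp_all
  then have "insert (line_circle_points 3 2 4 3 5 6 8) (insert (IntersectLineCircle2 3 2 4 3 5 7) ?K) \<tturnstile> ?F"
    by (simp add: insert_commute)
  then have "insert (IntersectLineCircle1 3 2 4 3 5 6) (insert (IntersectLineCircle2 3 2 4 3 5 7) ?K) \<tturnstile> ?F"
    by (rule assume_IntersectLineCircle1) simp_all
  then have "insert (IntersectLineCircle2 3 2 2 4 3 5) (insert (IntersectLineCircle1 3 2 4 3 5 6)
      (insert (IntersectLineCircle2 3 2 4 3 5 7) ?K)) \<tturnstile> ?F"
    by (rule derives_mono) auto
  then show ?thesis by (intro assume_Perp[of _ _ _ 5]) simp_all
qed

theorem lemma5p40:
  shows "derives neutral_geometry {}
    (\<^bold>\<forall> \<^bold>\<forall> \<^bold>\<forall> (let x = 2; a = 1; b = 0 in a \<^bold>\<noteq> b \<^bold>\<longrightarrow>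
       (\<^bold>\<exists> \<^bold>\<exists> Perp (x+2) (a+2) (b+2) 1 0) \<^bold>\<and>
       (\<^bold>\<forall> \<^bold>\<forall> (let x = x+2; a = a+2; b = b+2; d = 1; e = 0 in
          Perp x a b d e \<^bold>\<longrightarrow> perpendicular d e a b \<^bold>\<and> on_line d e x))))"
proof -
  have "{1 \<^bold>\<noteq> 0} \<tturnstile> (\<^bold>\<forall> \<^bold>\<forall> (Perp 4 3 2 1 0 \<^bold>\<longrightarrow> perpendicular 1 0 3 2 \<^bold>\<and> on_line 1 0 4))"
  proof (rule derives.ForallI, rule derives.ForallI, rule derives.ImpI)
    show "insert (Perp 4 3 2 1 0) (shift ` shift ` {1 \<^bold>\<noteq> 0}) \<tturnstile>
        perpendicular 1 0 3 2 \<^bold>\<and> on_line 1 0 4"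
      using Perp_correct by (simp add: numeral_2_eq_2 numeral_3_eq_3)
  qed
  with Perp_defined have "{1 \<^bold>\<noteq> 0} \<tturnstile> (\<^bold>\<exists> \<^bold>\<exists> Perp 4 3 2 1 0) \<^bold>\<and>
      (\<^bold>\<forall> \<^bold>\<forall> (Perp 4 3 2 1 0 \<^bold>\<longrightarrow> perpendicular 1 0 3 2 \<^bold>\<and> on_line 1 0 4))"
    by (rule derives.AndI)
  then have "{} \<tturnstile> (\<^bold>\<forall> \<^bold>\<forall> \<^bold>\<forall> (1 \<^bold>\<noteq> 0 \<^bold>\<longrightarrow> (\<^bold>\<exists> \<^bold>\<exists> Perp 4 3 2 1 0) \<^bold>\<and>
      (\<^bold>\<forall> \<^bold>\<forall> (Perp 4 3 2 1 0 \<^bold>\<longrightarrow> perpendicular 1 0 3 2 \<^bold>\<and> on_line 1 0 4))))"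
    by (intro derives.ForallI derives.ImpI) simp
  moreover have "(2::nat) + 2 = 4" "(1::nat) + 2 = 3" "(0::nat) + 2 = 2" by simp_all
  ultimately show ?thesis by (simp only: Let_def)
qed

end
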